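(* In the setting of the context, let the Volterra assumptions be satisfied. If $\Psi\in\mathcal N^2(0,T;L_2^0)$ and $\Psi(\cdot,\cdot)(U_0)\subset D(A)$, $P$-a.s., then the stochastic convolution $W^\Psi(t):=\int_0^tS(t-\tau)\Psi(\tau)\,dW(\tau)$, $t\in[0,T]$, satisfies, for any $t\in[0,T]$ and any $\xi\in D(A^* )$, $$\langle W^\Psi(t),\xi\rangle_H=\int_0^t\langle a(t-\tau)W^\Psi(\tau),A^*\xi\rangle_H\,d\tau+\int_0^t\langle\xi,\Psi(\tau)\,dW(\tau)\rangle_H,\quad P\text{-a.s.}$$
   Context: $H$ and $U$ are separable (real) Hilbert spaces and $T>0$ is fixed. $(\Omega,\mathcal F,(\mathcal F_t)_{t\ge0},P)$ is a filtered probability space whose filtration is normal ($\mathcal F_0$ contains all $P$-null sets of $\mathcal F$, and $\mathcal F_t=\bigcap_{s>t}\mathcal F_s$). $W$ is a cylindrical Wiener process with respect to $(\mathcal F_t)$ with nonnegative covariance operator $Q\in L(U)$ ($\mathrm{Tr}\,Q<\infty$ is not assumed). There is a complete orthonormal set $\{e_k\}\subset U$ of eigenvectors of $Q$ with eigenvalues $\lambda_k$, and $W(t)=\sum_k e_k\beta_k(t)$ with independent real Wiener processes $\beta_k$, $\mathbb E\beta_k^2(t)=\lambda_k t$. $U_0:=Q^{1/2}(U)$ with inner product $\langle u,v\rangle_{U_0}=\langle Q^{-1/2}u,Q^{-1/2}v\rangle_U$. $L_2^0:=L_2(U_0,H)$ is the space of Hilbert-Schmidt operators from $U_0$ to $H$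 with the Hilbert-Schmidt norm. $\mathcal N^2(0,T;L_2^0)$ is the space of $L_2^0$-valued predictable processes $\Phi$ on $[0,T]$ with $\mathbb E\int_0^T|\Phi(\tau)|_{L_2^0}^2d\tau<\infty$. Stochastic integrals are the usual Hilbert-space stochastic integrals with respect to $W$; $\int_0^t\langle\xi,\Psi(\tau)dW(\tau)\rangle_H$ is the real-valued stochastic integral of $u\mapsto\langle\xi,\Psi(\tau)u\rangle_H$, equal to $\langle\int_0^t\Psi(\tau)dW(\tau),\xi\rangle_H$. $W^\Psi$ is taken in its predictable version. The condition $\Psi(\cdot,\cdot)(U_0)\subset D(A)$, $P$-a.s., means that the operators $\Psi(t,\omega)$ map $U_0$ into $D(A)$. Volterra assumptions: $A:D(A)\subset H\to H$ is a closed, densely defined unbounded linear operator (with adjoint $A^*$); $a\in L^1_{\mathrm{loc}}(\mathbb R_+)$; and the deterministic Volterra equation $X(t)=X_0+\int_0^t a(t-\tau)AX(\tau)\,d\tau+f(t)$ is well-posed, i.e. it admits a resolvent $(S(t))_{t\ge0}$: a family of bounded linear operators on $H$ such that (1) $S$ is strongly continuous on $\mathbb R_+$ and $S(0)=I$; (2) $S(t)D(A)\subset D(A)$ and $AS(t)x=S(t)Ax$ for $x\in D(A)$, $t\ge0$; (3) $S(t)x=x+\int_0^t a(t-\tau)AS(\tau)x\,d\tau$ for all $x\in D(A)$, $t\ge0$. *)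

theory Defs
  imports "HOL-Analysis.Analysis" "HOL-Probability.Probability"
begin

section \<open>The covariance operator and the space U0\<close>

definition nonneg_op :: "('u::real_inner \<Rightarrow>\<^sub>L 'u) \<Rightarrow> bool" where
  "nonneg_op Q \<longleftrightarrow> (\<forall>u v. Q u \<bullet> v = u \<bullet> Q v) \<and> (\<forall>u. 0 \<le> Q u \<bullet> u)"

definition op_sqrt :: "('u::real_inner \<Rightarrow>\<^sub>L 'u) \<Rightarrow> ('u \<Rightarrow>\<^sub>L 'u)" where
  "op_sqrt Q = (THE R. nonneg_op R \<and> R o\<^sub>L R = Q)"

text \<open>\<open>Q\<close> need not be injective: the inverse of its square root is the usual pseudo-inverse, which
  picks the preimage orthogonal to the kernel. It is only meaningful on \<open>U0 Q\<close>.\<close>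

definition op_sqrt_inv :: "('u::real_inner \<Rightarrow>\<^sub>L 'u) \<Rightarrow> 'u \<Rightarrow> 'u" where
  "op_sqrt_inv Q u = (THE x. op_sqrt Q x = u \<and> (\<forall>z. op_sqrt Q z = 0 \<longrightarrow> x \<bullet> z = 0))"

definition U0 :: "('u::real_inner \<Rightarrow>\<^sub>L 'u) \<Rightarrow> 'u set" where
  "U0 Q = range (blinfun_apply (op_sqrt Q))"

definition U0_inner :: "('u::real_inner \<Rightarrow>\<^sub>L 'u) \<Rightarrow> 'u \<Rightarrow> 'u \<Rightarrow> real" where
  "U0_inner Q u v = op_sqrt_inv Q u \<bullet> op_sqrt_inv Q v"

definition U0_norm :: "('u::real_inner \<Rightarrow>\<^sub>L 'u) \<Rightarrow> 'u \<Rightarrow> real" where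
  "U0_norm Q u = sqrt (U0_inner Q u u)"


section \<open>Cylindrical Wiener processes\<close>

text \<open>The data of a cylindrical Wiener process \<open>W(t) = \<Sum>k. e\<^sub>k \<beta>\<^sub>k(t)\<close>: probability space, filtration
  (only times \<open>t \<ge> 0\<close> matter), covariance operator, and its eigenvectors \<open>e\<^sub>k\<close>, eigenvalues
  \<open>\<lambda>\<^sub>k\<close> and real Wiener processes \<open>\<beta>\<^sub>k\<close>, where \<open>k\<close> ranges over an index set of natural numbers
  (so that finite-dimensional \<open>U\<close> is included).\<close>

record (overloaded) ('w, 'u) noise =
  pspace :: "'w measure"
  filt :: "real \<Rightarrow> 'w measure"
  cov :: "'u::real_normed_vector \<Rightarrow>\<^sub>L 'u"
  idx :: "nat set"
  evec :: "nat \<Rightarrow> 'u"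
  eval :: "nat \<Rightarrow> real"
  bm :: "nat \<Rightarrow> real \<Rightarrow> 'w \<Rightarrow> real"

definition normal_filtration :: "'w measure \<Rightarrow> (real \<Rightarrow> 'w measure) \<Rightarrow> bool" where
  "normal_filtration M F \<longleftrightarrow>
     (\<forall>t\<ge>0. subalgebra M (F t)) \<and>
     (\<forall>s\<ge>0. \<forall>t\<ge>s. sets (F s) \<subseteq> sets (F t)) \<and>
     null_sets M \<subseteq> sets (F 0) \<and>
     (\<forall>t\<ge>0. sets (F t) = (\<Inter>s\<in>{t<..}. sets (F s)))"

text \<open>Centred normal law with variance \<open>v \<ge> 0\<close>; for \<open>v = 0\<close> it is the point mass at 0.\<close>

definition centred_gaussian :: "'w measure \<Rightarrow> ('w \<Rightarrow> real) \<Rightarrow> real \<Rightarrow> bool" where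
  "centred_gaussian M X v \<longleftrightarrow>
     (if v = 0 then X \<in> borel_measurable M \<and> (AE \<omega> in M. X \<omega> = 0)
      else distributed M lborel X (normal_density 0 (sqrt v)))"

definition orthonormal_basis_on :: "nat set \<Rightarrow> (nat \<Rightarrow> 'u::real_inner) \<Rightarrow> bool" where
  "orthonormal_basis_on I e \<longleftrightarrow>
     (\<forall>j\<in>I. \<forall>k\<in>I. e j \<bullet> e k = (if j = k then 1 else 0)) \<and> closure (span (e ` I)) = UNIV"

text \<open>The last clause says that the increment of \<open>W\<close> as a whole, i.e. the family of all coordinate
  increments jointly, is independent of the past.\<close>

definition cylindrical_wiener ::
  "('w, 'u::{real_inner,banach,second_countable_topology}) noise \<Rightarrow> bool" where
  "cylindrical_wiener W \<longleftrightarrow>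
     prob_space (pspace W) \<and> normal_filtration (pspace W) (filt W) \<and>
     nonneg_op (cov W) \<and> orthonormal_basis_on (idx W) (evec W) \<and>
     (\<forall>k\<in>idx W. cov W (evec W k) = eval W k *\<^sub>R evec W k) \<and>
     (\<forall>k\<in>idx W.
        (\<forall>t\<ge>0. bm W k t \<in> borel_measurable (filt W t)) \<and>
        (AE \<omega> in pspace W. bm W k 0 \<omega> = 0) \<and>
        (AE \<omega> in pspace W. continuous_on {0..} (\<lambda>t. bm W k t \<omega>)) \<and>
        (\<forall>s\<ge>0. \<forall>t>s. centred_gaussian (pspace W) (\<lambda>\<omega>. bm W k t \<omega> - bm W k s \<omega>)
                          (eval W k * (t - s)))) \<and>
     prob_space.indep_vars (pspace W) (\<lambda>_. PiM {0..} (\<lambda>_. borel))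
        (\<lambda>k \<omega>. \<lambda>t\<in>{0..}. bm W k t \<omega>) (idx W) \<and>
     (\<forall>s\<ge>0. \<forall>t>s. prob_space.indep_set (pspace W) (sets (filt W s))
        (sets (vimage_algebra (space (pspace W)) (\<lambda>\<omega>. \<lambda>k\<in>idx W. bm W k t \<omega> - bm W k s \<omega>)
                 (PiM (idx W) (\<lambda>_. borel)))))"


section \<open>Hilbert-Schmidt operators from U0 to H\<close>

text \<open>The vectors \<open>sqrt \<lambda>\<^sub>k e\<^sub>k\<close> with \<open>\<lambda>\<^sub>k > 0\<close> form an orthonormal basis of \<open>U0\<close>. The Hilbert-Schmidt
  norm is written in this basis; it does not depend on the choice of basis.\<close>

definition U0_idx :: "('w, 'u::real_inner) noise \<Rightarrow> nat set" where
  "U0_idx W = {k \<in> idx W. 0 < eval W k}"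

definition U0_basis :: "('w, 'u::real_inner) noise \<Rightarrow> nat \<Rightarrow> 'u" where
  "U0_basis W k = sqrt (eval W k) *\<^sub>R evec W k"

text \<open>Operators on \<open>U0\<close> are represented by functions on all of \<open>U\<close>; values outside \<open>U0\<close> are
  irrelevant.\<close>

definition L20 :: "('w, 'u::real_inner) noise \<Rightarrow> ('u \<Rightarrow> 'h::real_inner) set" where
  "L20 W = {\<Phi>.
     (\<forall>u\<in>U0 (cov W). \<forall>v\<in>U0 (cov W). \<forall>c. \<Phi> (u + v) = \<Phi> u + \<Phi> v \<and> \<Phi> (c *\<^sub>R u) = c *\<^sub>R \<Phi> u) \<and>
     (\<exists>C. \<forall>u\<in>U0 (cov W). norm (\<Phi> u) \<le> C * U0_norm (cov W) u) \<and>
     (\<lambda>k. (norm (\<Phi> (U0_basis W k)))\<^sup>2) summable_on U0_idx W}"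

definition L20_norm :: "('w, 'u::real_inner) noise \<Rightarrow> ('u \<Rightarrow> 'h::real_inner) \<Rightarrow> real" where
  "L20_norm W \<Phi> = sqrt (\<Sum>\<^sub>\<infinity>k\<in>U0_idx W. (norm (\<Phi> (U0_basis W k)))\<^sup>2)"

definition L20_open :: "('w, 'u::real_inner) noise \<Rightarrow> ('u \<Rightarrow> 'h::real_inner) set \<Rightarrow> bool" where
  "L20_open W G \<longleftrightarrow> G \<subseteq> L20 W \<and>
     (\<forall>\<Phi>\<in>G. \<exists>r>0. \<forall>\<Phi>'\<in>L20 W. L20_norm W (\<lambda>u. \<Phi>' u - \<Phi> u) < r \<longrightarrow> \<Phi>' \<in> G)"

definition L20_borel :: "('w, 'u::real_inner) noise \<Rightarrow> ('u \<Rightarrow> 'h::real_inner) measure" where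
  "L20_borel W = sigma (L20 W) {G. L20_open W G}"


section \<open>Predictable processes and the stochastic integral\<close>

text \<open>Everything is relative to a horizon \<open>r\<close>; a process on \<open>[0,T]\<close> is integrated over \<open>[0,t]\<close> by
  regarding it as a process with horizon \<open>t\<close>.\<close>

definition predictable_sigma :: "('w, 'u::real_normed_vector) noise \<Rightarrow> real \<Rightarrow> (real \<times> 'w) measure"
where
  "predictable_sigma W r = sigma ({0..r} \<times> space (pspace W))
     ({{s<..t} \<times> B | s t B. 0 \<le> s \<and> s < t \<and> t \<le> r \<and> B \<in> sets (filt W s)} \<union>
      {{0} \<times> B | B. B \<in> sets (filt W 0)})"

definition N2 :: "('w, 'u::real_inner) noise \<Rightarrow> real \<Rightarrow> (real \<Rightarrow> 'w \<Rightarrow> 'u \<Rightarrow> 'h::real_inner) set"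
where
  "N2 W r = {\<Phi>. (\<lambda>(\<tau>, \<omega>). \<Phi> \<tau> \<omega>) \<in> predictable_sigma W r \<rightarrow>\<^sub>M L20_borel W \<and>
     (\<integral>\<^sup>+\<omega>. (\<integral>\<^sup>+\<tau>\<in>{0..r}. ennreal ((L20_norm W (\<Phi> \<tau> \<omega>))\<^sup>2) \<partial>lborel) \<partial>pspace W) < \<infinity>}"

text \<open>A list of quadruples \<open>(s, t, B, L)\<close> encodes the elementary process that is the sum of the
  \<open>1\<^bsub>(s,t]\<^esub> 1\<^bsub>B\<^esub> L\<close> with \<open>B\<close> in \<open>\<F>\<^sub>s\<close>. Each operator \<open>L\<close> is required to see only finitely many
  coordinates, so that \<open>L (W(t) - W(s))\<close> makes sense although \<open>W\<close> need not take values in \<open>U\<close>.\<close>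

type_synonym ('w, 'u, 'h) elem = "(real \<times> real \<times> 'w set \<times> ('u \<Rightarrow>\<^sub>L 'h)) list"

definition elementary ::
  "('w, 'u::real_inner) noise \<Rightarrow> real \<Rightarrow> ('w, 'u, 'h::real_inner) elem \<Rightarrow> bool" where
  "elementary W r xs \<longleftrightarrow> (\<forall>(s, t, B, L)\<in>set xs. 0 \<le> s \<and> s < t \<and> t \<le> r \<and> B \<in> sets (filt W s) \<and>
     finite {k \<in> idx W. L (evec W k) \<noteq> 0})"

definition elem_process ::
  "('w, 'u::real_inner, 'h::real_inner) elem \<Rightarrow> real \<Rightarrow> 'w \<Rightarrow> 'u \<Rightarrow> 'h" where
  "elem_process xs \<tau> \<omega> u =
     (\<Sum>(s, t, B, L)\<leftarrow>xs. (indicat_real {s<..t} \<tau> * indicat_real B \<omega>) *\<^sub>R L u)"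

definition elem_integral ::
  "('w, 'u::real_inner) noise \<Rightarrow> ('w, 'u, 'h::real_inner) elem \<Rightarrow> 'w \<Rightarrow> 'h" where
  "elem_integral W xs \<omega> = (\<Sum>(s, t, B, L)\<leftarrow>xs. indicat_real B \<omega> *\<^sub>R
     (\<Sum>k\<in>{k \<in> idx W. L (evec W k) \<noteq> 0}. (bm W k t \<omega> - bm W k s \<omega>) *\<^sub>R L (evec W k)))"

text \<open>Extension by the Ito isometry: \<open>Y\<close> is a version of \<open>\<integral>\<^sub>0\<^sup>r \<Phi>(\<tau>) dW(\<tau>)\<close> if it is the
  mean-square limit of the integrals of elementary processes that converge to \<open>\<Phi>\<close>.\<close>

definition is_stoch_int ::
  "('w, 'u::real_inner) noise \<Rightarrow> real \<Rightarrow> (real \<Rightarrow> 'w \<Rightarrow> 'u \<Rightarrow> 'h::real_inner) \<Rightarrow> ('w \<Rightarrow> 'h) \<Rightarrow> bool"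
where
  "is_stoch_int W r \<Phi> Y \<longleftrightarrow> \<Phi> \<in> N2 W r \<and> Y \<in> borel_measurable (pspace W) \<and>
     (\<exists>xs. (\<forall>n. elementary W r (xs n)) \<and>
       (\<lambda>n. \<integral>\<^sup>+\<omega>. (\<integral>\<^sup>+\<tau>\<in>{0..r}. ennreal ((L20_norm W (\<lambda>u. elem_process (xs n) \<tau> \<omega> u - \<Phi> \<tau> \<omega> u))\<^sup>2)
              \<partial>lborel) \<partial>pspace W) \<longlonglongrightarrow> 0 \<and>
       (\<lambda>n. \<integral>\<^sup>+\<omega>. ennreal ((norm (elem_integral W (xs n) \<omega> - Y \<omega>))\<^sup>2) \<partial>pspace W) \<longlonglongrightarrow> 0)"

text \<open>For \<open>\<Phi> \<in> N2 W r\<close> the integral exists and is unique up to almost sure equality.\<close>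

definition stoch_int ::
  "('w, 'u::real_inner) noise \<Rightarrow> real \<Rightarrow> (real \<Rightarrow> 'w \<Rightarrow> 'u \<Rightarrow> 'h::real_inner) \<Rightarrow> 'w \<Rightarrow> 'h" where
  "stoch_int W r \<Phi> = (SOME Y. is_stoch_int W r \<Phi> Y)"


section \<open>Volterra equations\<close>

text \<open>"Unbounded operator" means: linear on its domain \<open>D\<close>, not necessarily bounded.\<close>

definition closed_densely_defined :: "'h::real_inner set \<Rightarrow> ('h \<Rightarrow> 'h) \<Rightarrow> bool" where
  "closed_densely_defined D A \<longleftrightarrow> subspace D \<and> closure D = UNIV \<and>
     (\<forall>x\<in>D. \<forall>y\<in>D. \<forall>c. A (x + y) = A x + A y \<and> A (c *\<^sub>R x) = c *\<^sub>R A x) \<and>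
     closed {(x, A x) | x. x \<in> D}"

definition adj_dom :: "'h::real_inner set \<Rightarrow> ('h \<Rightarrow> 'h) \<Rightarrow> 'h set" where
  "adj_dom D A = {\<xi>. \<exists>\<eta>. \<forall>x\<in>D. A x \<bullet> \<xi> = x \<bullet> \<eta>}"

definition adj_op :: "'h::real_inner set \<Rightarrow> ('h \<Rightarrow> 'h) \<Rightarrow> 'h \<Rightarrow> 'h" where
  "adj_op D A \<xi> = (THE \<eta>. \<forall>x\<in>D. A x \<bullet> \<xi> = x \<bullet> \<eta>)"

definition is_resolvent ::
  "(real \<Rightarrow> real) \<Rightarrow> 'h::{real_inner,banach,second_countable_topology} set \<Rightarrow> ('h \<Rightarrow> 'h) \<Rightarrow>
   (real \<Rightarrow> 'h \<Rightarrow>\<^sub>L 'h) \<Rightarrow> bool" where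
  "is_resolvent a D A S \<longleftrightarrow>
     (\<forall>x. continuous_on {0..} (\<lambda>t. S t x)) \<and> S 0 = id_blinfun \<and>
     (\<forall>t\<ge>0. \<forall>x\<in>D. S t x \<in> D \<and> A (S t x) = S t (A x)) \<and>
     (\<forall>x\<in>D. \<forall>t\<ge>0. S t x = x + (LINT \<tau>:{0..t}|lebesgue. a (t - \<tau>) *\<^sub>R A (S \<tau> x)))"

definition stoch_conv ::
  "('w, 'u::real_inner) noise \<Rightarrow> (real \<Rightarrow> 'h \<Rightarrow>\<^sub>L 'h) \<Rightarrow> (real \<Rightarrow> 'w \<Rightarrow> 'u \<Rightarrow> 'h::real_inner) \<Rightarrow>
   real \<Rightarrow> 'w \<Rightarrow> 'h" where
  "stoch_conv W S \<Psi> t = stoch_int W t (\<lambda>\<tau> \<omega> u. S (t - \<tau>) (\<Psi> \<tau> \<omega> u))"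

definition predictable_version ::
  "('w, 'u::real_inner) noise \<Rightarrow> real \<Rightarrow> (real \<Rightarrow> 'w \<Rightarrow> 'h::real_inner) \<Rightarrow> (real \<Rightarrow> 'w \<Rightarrow> 'h) \<Rightarrow> bool"
where
  "predictable_version W T Y X \<longleftrightarrow>
     (\<lambda>(t, \<omega>). X t \<omega>) \<in> borel_measurable (predictable_sigma W T) \<and>
     (\<forall>t\<in>{0..T}. AE \<omega> in pspace W. X t \<omega> = Y t \<omega>)"

end

theory Submission
  imports Defs
begin

text \<open>Write \<open>\<eta> = A\<^sup>* \<xi>\<close>. Testing the resolvent equation against \<open>\<xi>\<close> gives
  \<open>\<langle>S(u)x, \<xi>\<rangle> - \<langle>x, \<xi>\<rangle> = \<integral>\<^sub>0\<^sup>u a(u - \<sigma>) \<langle>S(\<sigma>)x, \<eta>\<rangle> d\<sigma>\<close> for \<open>x \<in> D(A)\<close>, hence for all \<open>x\<close> by density and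
  the uniform boundedness of \<open>S\<close>. The stochastic Fubini theorem is replaced by a duality argument in
  \<open>L\<^sup>2(\<Omega>)\<close>. Let \<open>Z = \<langle>W\<^sup>\<Psi>(t), \<xi>\<rangle> - \<integral>\<^sub>0\<^sup>t \<langle>\<xi>, \<Psi> dW\<rangle>\<close> and \<open>Y = \<integral>\<^sub>0\<^sup>t a(t - \<tau>) \<langle>W\<^sup>\<Psi>(\<tau>), \<eta>\<rangle> d\<tau>\<close>. By the Ito isometry, the
  ordinary Fubini theorem and the displayed equation, \<open>Z - Y\<close> is orthogonal to the integral of every
  elementary process, hence to every stochastic integral up to time \<open>t\<close>. So it is orthogonal to \<open>Z\<close>
  and to each \<open>\<langle>W\<^sup>\<Psi>(\<tau>), \<eta>\<rangle>\<close>, therefore also to \<open>Y\<close> and to itself.\<close>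

section \<open>Square-integrable functions\<close>

text \<open>The obstacle is measurability rather than algebra. \<open>stoch_int\<close> is chosen by
  \<open>SOME\<close> separately for every horizon, so nothing joint in time and chance is known
  about the family of integrals beyond the predictable version \<open>X\<close>; and the kernel is
  merely integrable, so it cannot enter an \<open>L2\<close> theory in the time variable. Duality
  works with integrals of a fixed horizon. Time enters through ordinary Fubini, with the kernel as a
  weight and a bound on the second moments of the convolution that is uniform in time; for that
  bound any constant serves. Operators never appear as such: a Hilbert-Schmidt process is handled as
  the sequence of its values on the basis of \<open>U0\<close>, zero outside the index set
  (\<open>coord\<close>, \<open>xcoord\<close>). A real elementary test integral sees only finitely
  many coordinates, so the main computation interchanges no infinite sum over coordinates. Second
  moments are \<open>ennreal\<close>-valued (\<open>sqn\<close>, \<open>sqN\<close>), so that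
  estimates can be stated before finiteness is known.\<close>

definition sqn :: "'a::real_normed_vector \<Rightarrow> ennreal" where
  "sqn x = ennreal ((norm x)\<^sup>2)"

lemma sqn_measurable [measurable]:
  "sqn \<in> borel_measurable (borel :: 'a::{real_normed_vector,second_countable_topology} measure)"
  unfolding sqn_def by measurable

lemma sqn_0 [simp]: "sqn 0 = 0"
  by (simp add: sqn_def)

lemma sqn_minus [simp]: "sqn (- x) = sqn x"
  by (simp add: sqn_def)

lemma sqn_minus_commute: "sqn (x - y) = sqn (y - x)"
  by (simp add: sqn_def norm_minus_commute)

lemma sqn_less_top [simp]: "sqn x < \<infinity>"
  by (simp add: sqn_def)

lemma norm_add_sq_le: "(norm (x + y))\<^sup>2 \<le> 2 * (norm x)\<^sup>2 + 2 * (norm (y::'a::real_normed_vector))\<^sup>2"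
proof -
  have "(norm (x + y))\<^sup>2 \<le> (norm x + norm y)\<^sup>2"
    by (intro power_mono norm_triangle_ineq) auto
  also have "\<dots> \<le> 2 * (norm x)\<^sup>2 + 2 * (norm y)\<^sup>2"
    using zero_le_power2[of "norm x - norm y"] by (simp add: power2_eq_square algebra_simps)
  finally show ?thesis .
qed

text \<open>The factors 2 stand in for the triangle inequality of the \<open>L2\<close> norm. They
  keep squares free of roots and are harmless, since only convergence to 0 and finite bounds are
  derived from them.\<close>

lemma sqn_add: "sqn (x + y) \<le> 2 * sqn x + 2 * sqn y"
proof -
  have "sqn (x + y) \<le> ennreal (2 * (norm x)\<^sup>2 + 2 * (norm y)\<^sup>2)"
    unfolding sqn_def by (intro ennreal_leI norm_add_sq_le)
  also have "\<dots> = 2 * sqn x + 2 * sqn y"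
    by (simp add: sqn_def ennreal_plus ennreal_mult)
  finally show ?thesis .
qed

lemma sqn_diff: "sqn (x - y) \<le> 2 * sqn x + 2 * sqn y"
  using sqn_add[of x "- y"] by simp

lemma sqn_triangle: "sqn (x - z) \<le> 2 * sqn (x - y) + 2 * sqn (y - z)"
  using sqn_add[of "x - y" "y - z"] by simp

abbreviation msq :: "'a measure \<Rightarrow> ('a \<Rightarrow> 'b::real_normed_vector) \<Rightarrow> ennreal" where
  "msq M f \<equiv> \<integral>\<^sup>+x. sqn (f x) \<partial>M"

lemma msq_triangle:
  fixes f g h :: "'a \<Rightarrow> 'b::{real_normed_vector,second_countable_topology}"
  assumes [measurable]: "f \<in> borel_measurable M" "g \<in> borel_measurable M" "h \<in> borel_measurable M"
  shows "msq M (\<lambda>x. f x - h x) \<le> 2 * msq M (\<lambda>x. f x - g x) + 2 * msq M (\<lambda>x. g x - h x)"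
proof -
  have "msq M (\<lambda>x. f x - h x) \<le> (\<integral>\<^sup>+x. 2 * sqn (f x - g x) + 2 * sqn (g x - h x) \<partial>M)"
    by (intro nn_integral_mono sqn_triangle)
  also have "\<dots> = 2 * msq M (\<lambda>x. f x - g x) + 2 * msq M (\<lambda>x. g x - h x)"
    by (simp add: nn_integral_add nn_integral_cmult)
  finally show ?thesis .
qed

lemma integrable_inner_sqn:
  fixes f g :: "'a \<Rightarrow> 'b::{real_inner,second_countable_topology}"
  assumes [measurable]: "f \<in> borel_measurable M" "g \<in> borel_measurable M"
    and f: "msq M f < \<infinity>" and g: "msq M g < \<infinity>"
  shows "integrable M (\<lambda>x. f x \<bullet> g x)"
proof (rule integrableI_bounded)
  have *: "ennreal (norm (f x \<bullet> g x)) \<le> sqn (f x) + sqn (g x)" for x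
  proof -
    have "norm (f x \<bullet> g x) \<le> norm (f x) * norm (g x)"
      using Cauchy_Schwarz_ineq2 by auto
    also have "\<dots> \<le> (norm (f x))\<^sup>2 + (norm (g x))\<^sup>2"
      using sum_squares_bound[of "norm (f x)" "norm (g x)"] zero_le_power2[of "norm (f x)"] zero_le_power2[of "norm (g x)"]
        mult_nonneg_nonneg[of "norm (f x)" "norm (g x)"] by linarith
    finally show ?thesis
      by (simp add: sqn_def ennreal_leI flip: ennreal_plus)
  qed
  have "(\<integral>\<^sup>+x. ennreal (norm (f x \<bullet> g x)) \<partial>M) \<le> (\<integral>\<^sup>+x. sqn (f x) + sqn (g x) \<partial>M)"
    by (intro nn_integral_mono *)
  also have "\<dots> = msq M f + msq M g"
    by (simp add: nn_integral_add)
  also have "\<dots> < \<infinity>" using f g by (simp add: less_top)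
  finally show "(\<integral>\<^sup>+x. ennreal (norm (f x \<bullet> g x)) \<partial>M) < \<infinity>" .
qed simp

lemma integrable_mult_sqn:
  fixes f g :: "'a \<Rightarrow> real"
  assumes "f \<in> borel_measurable M" "g \<in> borel_measurable M"
    and "msq M f < \<infinity>" and "msq M g < \<infinity>"
  shows "integrable M (\<lambda>x. f x * g x)"
  using integrable_inner_sqn[OF assms] by simp

text \<open>Cauchy-Schwarz bounds the \<open>L1\<close> distance of the products by the
  \<open>L2\<close> distance of the first factors. This is how identities known for elementary
  integrals are carried to their limits.\<close>

lemma integral_mult_tendsto_sqn:
  fixes f :: "nat \<Rightarrow> 'a \<Rightarrow> real" and f0 g :: "'a \<Rightarrow> real"
  assumes [measurable]: "\<And>n. f n \<in> borel_measurable M" "f0 \<in> borel_measurable M" "g \<in> borel_measurable M"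
    and f: "\<And>n. msq M (\<lambda>x. f n x) < \<infinity>" and f0: "msq M f0 < \<infinity>"
    and g: "msq M g < \<infinity>"
    and lim: "(\<lambda>n. \<integral>\<^sup>+x. sqn (f n x - f0 x) \<partial>M) \<longlonglongrightarrow> 0"
  shows "(\<lambda>n. \<integral>x. f n x * g x \<partial>M) \<longlonglongrightarrow> (\<integral>x. f0 x * g x \<partial>M)"
proof (rule tendsto_L1_int)
  show "integrable M (\<lambda>x. f n x * g x)" for n by (rule integrable_mult_sqn) (use f g in auto)
  show "integrable M (\<lambda>x. f0 x * g x)" by (rule integrable_mult_sqn) (use f0 g in auto)
  let ?I = "\<lambda>n. \<integral>\<^sup>+x. ennreal (norm (f n x * g x - f0 x * g x)) \<partial>M"
  have le: "(?I n)\<^sup>2 \<le> msq M (\<lambda>x. f n x - f0 x) * msq M g" for n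
  proof -
    have "?I n = (\<integral>\<^sup>+x. ennreal \<bar>f n x - f0 x\<bar> * ennreal \<bar>g x\<bar> \<partial>M)"
      by (intro nn_integral_cong) (simp add: abs_mult ennreal_mult flip: left_diff_distrib)
    moreover have "(\<integral>\<^sup>+x. ennreal \<bar>f n x - f0 x\<bar> * ennreal \<bar>g x\<bar> \<partial>M)\<^sup>2 \<le>
      (\<integral>\<^sup>+x. ennreal \<bar>f n x - f0 x\<bar> ^ 2 \<partial>M) * (\<integral>\<^sup>+x. ennreal \<bar>g x\<bar> ^ 2 \<partial>M)"
      by (rule Cauchy_Schwarz_nn_integral) measurable
    ultimately show ?thesis by (simp add: sqn_def ennreal_power)
  qed
  have "(\<lambda>n. msq M g * msq M (\<lambda>x. f n x - f0 x)) \<longlonglongrightarrow> msq M g * 0"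
    by (rule ennreal_tendsto_cmult[OF _ lim]) (use g in auto)
  hence lim': "(\<lambda>n. msq M (\<lambda>x. f n x - f0 x) * msq M g) \<longlonglongrightarrow> 0"
    by (simp add: mult.commute)
  have sq: "(\<lambda>n. (?I n)\<^sup>2) \<longlonglongrightarrow> 0"
    by (rule tendsto_sandwich[OF _ _ tendsto_const lim']) (use le in auto)
  \<comment> \<open>Cauchy-Schwarz controls only the squares; comparing with the square of
    \<open>e\<close> avoids a root in \<open>ennreal\<close>.\<close>
  show "?I \<longlonglongrightarrow> 0"
  proof (rule order_tendstoI)
    fix e :: ennreal assume "0 < e"
    hence "0 < e\<^sup>2" by (simp add: power2_eq_square ennreal_zero_less_mult_iff)
    with sq have "\<forall>\<^sub>F n in sequentially. (?I n)\<^sup>2 < e\<^sup>2" by (rule order_tendstoD)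
    thus "\<forall>\<^sub>F n in sequentially. ?I n < e"
      by eventually_elim (meson linorder_not_less power_mono zero_le)
  qed simp
qed

lemma sqn_indicator: "sqn (indicat_real A x *\<^sub>R y) = indicator A x * sqn y"
  by (auto simp: indicator_def)

lemma ennreal_split4:
  fixes e :: ennreal
  assumes "0 < e"
  shows "\<exists>\<delta>>0. \<forall>a b. a < \<delta> \<longrightarrow> b < \<delta> \<longrightarrow> 2 * a + 2 * b < e"
proof -
  \<comment> \<open>\<open>e\<close> may be infinite, so a finite positive \<open>y\<close> below it
    is inserted; 4 is the total weight of the two terms.\<close>
  obtain y where y: "0 < y" "y < e" using assms dense by blast
  then obtain x where x: "y = ennreal x" "x > 0" by (cases y) auto
  show ?thesis
  proof (intro exI[of _ "ennreal (x / 4)"] conjI allI impI)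
    fix a b assume ab: "a < ennreal (x / 4)" "b < ennreal (x / 4)"
    have "2 * a + 2 * b \<le> 2 * ennreal (x / 4) + 2 * ennreal (x / 4)"
      using ab by (intro add_mono mult_left_mono) auto
    also have "\<dots> = ennreal x"
    proof -
      have "2 * ennreal (x / 4) = ennreal (x / 2)" using x by (simp add: ennreal_mult[of 2, simplified, symmetric])
      thus ?thesis using x by (simp flip: ennreal_plus)
    qed
    finally show "2 * a + 2 * b < e" using y x by simp
  qed (use x in simp)
qed

lemma sqn_inner_le:
  fixes x h :: "'h::real_inner" shows "sqn (x \<bullet> h) \<le> ennreal ((norm h)\<^sup>2) * sqn x"
proof -
  have "(x \<bullet> h)\<^sup>2 \<le> (norm x * norm h)\<^sup>2"
    using Cauchy_Schwarz_ineq2[of x h] by (metis abs_ge_zero power2_abs power_mono)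
  thus ?thesis by (simp add: sqn_def power_mult_distrib mult.commute flip: ennreal_mult)
qed

lemma msq_inner_le:
  fixes f :: "'x \<Rightarrow> 'h::{real_inner,second_countable_topology}"
  assumes [measurable]: "f \<in> borel_measurable M"
  shows "msq M (\<lambda>x. f x \<bullet> h) \<le> ennreal ((norm h)\<^sup>2) * msq M f"
proof -
  have "msq M (\<lambda>x. f x \<bullet> h) \<le> (\<integral>\<^sup>+x. ennreal ((norm h)\<^sup>2) * sqn (f x) \<partial>M)"
    by (intro nn_integral_mono sqn_inner_le)
  also have "\<dots> = ennreal ((norm h)\<^sup>2) * msq M f" by (rule nn_integral_cmult) measurable
  finally show ?thesis .
qed

lemma msq_inner_finite:
  fixes f :: "'x \<Rightarrow> 'h::{real_inner,second_countable_topology}"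
  assumes "f \<in> borel_measurable M" "msq M f < \<infinity>"
  shows "msq M (\<lambda>x. f x \<bullet> h) < \<infinity>"
  by (rule order.strict_trans1[OF msq_inner_le[OF assms(1)]])
    (use assms(2) in \<open>simp add: ennreal_mult_less_top\<close>)

lemma msq_inner_tendsto:
  fixes f :: "nat \<Rightarrow> 'x \<Rightarrow> 'h::{real_inner,second_countable_topology}"
  assumes f: "\<And>n. f n \<in> borel_measurable M" and g: "g \<in> borel_measurable M"
    and lim: "(\<lambda>n. \<integral>\<^sup>+x. sqn (f n x - g x) \<partial>M) \<longlonglongrightarrow> 0"
  shows "(\<lambda>n. \<integral>\<^sup>+x. sqn (f n x \<bullet> h - g x \<bullet> h) \<partial>M) \<longlonglongrightarrow> 0"
proof (rule tendsto_sandwich[OF _ _ tendsto_const])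
  have "(\<lambda>n. ennreal ((norm h)\<^sup>2) * msq M (\<lambda>x. f n x - g x)) \<longlonglongrightarrow> ennreal ((norm h)\<^sup>2) * 0"
    by (rule ennreal_tendsto_cmult[OF _ lim]) simp
  thus "(\<lambda>n. ennreal ((norm h)\<^sup>2) * msq M (\<lambda>x. f n x - g x)) \<longlonglongrightarrow> 0" by simp
  show "\<forall>\<^sub>F n in sequentially. msq M (\<lambda>x. f n x \<bullet> h - g x \<bullet> h) \<le> ennreal ((norm h)\<^sup>2) * msq M (\<lambda>x. f n x - g x)"
    using msq_inner_le[OF borel_measurable_diff[OF f g], where h=h] by (simp add: inner_diff_left)
qed simp

text \<open>The weights \<open>2\<^sup>n\<close> turn the summable bound on the mean-square increments into an almost sure
  geometric bound on the increments themselves.\<close>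

lemma L2_complete:
  fixes f :: "nat \<Rightarrow> 'a \<Rightarrow> 'b::{banach,second_countable_topology}"
  assumes [measurable]: "\<And>n. f n \<in> borel_measurable M"
    and dist: "\<And>m n. m \<le> n \<Longrightarrow> msq M (\<lambda>x. f m x - f n x) \<le> ennreal (C / 4 ^ m)"
    and C: "0 \<le> C"
  obtains g where "g \<in> borel_measurable M"
    "\<And>n. msq M (\<lambda>x. f n x - g x) \<le> ennreal (C / 4 ^ n)"
proof -
  have "(\<integral>\<^sup>+x. (\<Sum>n. ennreal (2 ^ n) * sqn (f n x - f (Suc n) x)) \<partial>M) =
      (\<Sum>n. ennreal (2 ^ n) * msq M (\<lambda>x. f n x - f (Suc n) x))"
    by (simp add: nn_integral_suminf nn_integral_cmult)
  also have "\<dots> \<le> (\<Sum>n. ennreal (C * (1/2) ^ n))"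
  proof (intro suminf_le)
    fix n
    have "ennreal (2 ^ n) * msq M (\<lambda>x. f n x - f (Suc n) x) \<le> ennreal (2 ^ n) * ennreal (C / 4 ^ n)"
      by (intro mult_left_mono dist) auto
    also have "\<dots> = ennreal (C * (1/2) ^ n)"
      using C by (simp flip: ennreal_mult add: field_simps) (simp flip: power_mult_distrib)
    finally show "ennreal (2 ^ n) * msq M (\<lambda>x. f n x - f (Suc n) x) \<le> ennreal (C * (1/2) ^ n)" .
  qed auto
  also have "\<dots> < \<infinity>"
    using C by (subst suminf_ennreal2) (auto intro!: summable_mult)
  finally have fin: "(\<integral>\<^sup>+x. (\<Sum>n. ennreal (2 ^ n) * sqn (f n x - f (Suc n) x)) \<partial>M) \<noteq> \<infinity>" by simp
  have conv: "AE x in M. convergent (\<lambda>n. f n x)"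
  proof -
    have "AE x in M. (\<Sum>n. ennreal (2 ^ n) * sqn (f n x - f (Suc n) x)) \<noteq> \<infinity>"
      by (rule nn_integral_PInf_AE[OF _ fin]) measurable
    thus ?thesis
    proof eventually_elim
      case (elim x)
      let ?S = "\<Sum>n. ennreal (2 ^ n) * sqn (f n x - f (Suc n) x)"
      obtain K where K: "?S = ennreal K" "0 \<le> K" using elim by (cases ?S) auto
      have "norm (f (Suc n) x - f n x) \<le> sqrt K * (sqrt (1/2)) ^ n" for n
      proof -
        have "sum (\<lambda>n. ennreal (2 ^ n) * sqn (f n x - f (Suc n) x)) {n} \<le> ?S"
          by (intro sum_le_suminf) auto
        hence "ennreal (2 ^ n * (norm (f n x - f (Suc n) x))\<^sup>2) \<le> ennreal K"
          unfolding K by (simp add: sqn_def ennreal_mult)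
        hence "2 ^ n * (norm (f (Suc n) x - f n x))\<^sup>2 \<le> K" using K by (simp add: norm_minus_commute)
        hence "(norm (f (Suc n) x - f n x))\<^sup>2 \<le> K * (1/2) ^ n"
          by (simp add: field_simps)
        hence "norm (f (Suc n) x - f n x) \<le> sqrt (K * (1/2) ^ n)"
          by (rule real_le_rsqrt)
        thus ?thesis by (simp add: real_sqrt_mult real_sqrt_power)
      qed
      moreover have "summable (\<lambda>n. sqrt K * (sqrt (1/2)) ^ n)"
        by (intro summable_mult summable_geometric) auto
      ultimately have "summable (\<lambda>n. f (Suc n) x - f n x)"
        by (rule summable_comparison_test'[rotated])
      thus "convergent (\<lambda>n. f n x)"
      proof -
        assume "summable (\<lambda>n. f (Suc n) x - f n x)"
        hence "convergent (\<lambda>n. \<Sum>i<n. f (Suc i) x - f i x)" by (simp add: summable_iff_convergent)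
        hence "convergent (\<lambda>n. f n x - f 0 x)" by (simp only: sum_lessThan_telescope[of "\<lambda>n. f n x"])
        hence "convergent (\<lambda>n. (f n x - f 0 x) + f 0 x)"
          by (intro convergent_add convergent_const)
        thus ?thesis by simp
      qed
    qed
  qed
  define g where "g x = lim (\<lambda>n. f n x)" for x
  have g[measurable]: "g \<in> borel_measurable M" unfolding g_def by measurable
  show thesis
  proof
    show "g \<in> borel_measurable M" by fact
    fix n
    \<comment> \<open>Fatou's lemma in \<open>m\<close> with \<open>n\<close> fixed turns the Cauchy
      estimate into the same bound on the distance to the limit.\<close>
    have "msq M (\<lambda>x. f n x - g x) = (\<integral>\<^sup>+x. liminf (\<lambda>m. sqn (f n x - f m x)) \<partial>M)"
    proof (intro nn_integral_cong_AE, use conv in eventually_elim)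
      case (elim x)
      hence "(\<lambda>m. f m x) \<longlonglongrightarrow> g x" unfolding g_def by (simp add: convergent_LIMSEQ_iff)
      hence "(\<lambda>m. sqn (f n x - f m x)) \<longlonglongrightarrow> sqn (f n x - g x)"
        unfolding sqn_def by (intro tendsto_intros)
      thus ?case by (metis lim_imp_Liminf trivial_limit_sequentially)
    qed
    also have "\<dots> \<le> liminf (\<lambda>m. \<integral>\<^sup>+x. sqn (f n x - f m x) \<partial>M)"
      by (intro nn_integral_liminf) measurable
    also have "\<dots> \<le> ennreal (C / 4 ^ n)"
    proof -
      have "\<forall>\<^sub>F m in sequentially. msq M (\<lambda>x. f n x - f m x) \<le> ennreal (C / 4 ^ n)"
        using eventually_ge_at_top[of n] by eventually_elim (rule dist)
      hence "liminf (\<lambda>m. \<integral>\<^sup>+x. sqn (f n x - f m x) \<partial>M) \<le> liminf (\<lambda>m. ennreal (C / 4 ^ n))"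
        by (rule Liminf_mono)
      thus ?thesis by (simp add: Liminf_const)
    qed
    finally show "msq M (\<lambda>x. f n x - g x) \<le> ennreal (C / 4 ^ n)" .
  qed
qed

text \<open>Two sigma-algebras are kept apart: the approximants have to be simple for the small one
  (later the predictable sigma-algebra), while the distance is measured by \<open>M'\<close> on a
  larger one.\<close>

lemma L2_simple_approx:
  fixes f :: "'a \<Rightarrow> 'b::{banach,second_countable_topology}"
  assumes f[measurable]: "f \<in> borel_measurable M" and sets: "space M = space M'" "sets M \<subseteq> sets M'"
    and fin: "msq M' f < \<infinity>"
  obtains F where "\<And>i. simple_function M (F i)" "(\<lambda>i. \<integral>\<^sup>+x. sqn (f x - F i x) \<partial>M') \<longlonglongrightarrow> 0"
proof -
  from borel_measurable_implies_sequence_metric[OF f, of 0] obtain F where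
    F: "\<And>i. simple_function M (F i)" "\<And>x. x \<in> space M \<Longrightarrow> (\<lambda>i. F i x) \<longlonglongrightarrow> f x"
      "\<And>x i. x \<in> space M \<Longrightarrow> norm (F i x) \<le> 2 * norm (f x)"
    by (simp only: dist_norm diff_zero) blast
  have meas: "g \<in> borel_measurable M \<Longrightarrow> g \<in> borel_measurable M'" for g :: "'a \<Rightarrow> 'b"
    using sets by (auto simp: measurable_def)
  have [measurable]: "F i \<in> borel_measurable M'" "f \<in> borel_measurable M'" for i
    using borel_measurable_simple_function[OF F(1)] f by (blast intro: meas)+
  have "(\<lambda>i. \<integral>\<^sup>+x. sqn (f x - F i x) \<partial>M') \<longlonglongrightarrow> (\<integral>\<^sup>+x. 0 \<partial>M')"
  \<comment> \<open>The approximants satisfy \<open>norm (F i x) \<le> 2 * norm (f x)\<close>, hence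
    10 = 2 * 1 + 2 * 4.\<close>
  proof (rule nn_integral_dominated_convergence[where w="\<lambda>x. 10 * sqn (f x)"])
    show "AE x in M'. sqn (f x - F j x) \<le> 10 * sqn (f x)" for j
    proof (rule AE_I2)
      fix x assume "x \<in> space M'"
      hence "norm (F j x) \<le> 2 * norm (f x)" using F sets by auto
      hence "(norm (F j x))\<^sup>2 \<le> (2 * norm (f x))\<^sup>2" by (intro power_mono) auto
      hence "sqn (F j x) \<le> ennreal (4 * (norm (f x))\<^sup>2)" unfolding sqn_def by (intro ennreal_leI) (auto simp: power_mult_distrib)
      also have "\<dots> = 4 * sqn (f x)" by (simp add: sqn_def ennreal_mult)
      finally have "sqn (F j x) \<le> 4 * sqn (f x)" .
      hence "sqn (f x - F j x) \<le> 2 * sqn (f x) + 2 * (4 * sqn (f x))"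
        using sqn_diff[of "f x" "F j x"] by (meson add_left_mono mult_left_mono order_trans zero_le)
      also have "\<dots> = 10 * sqn (f x)" by (simp flip: mult.assoc distrib_right)
      finally show "sqn (f x - F j x) \<le> 10 * sqn (f x)" .
    qed
    show "(\<integral>\<^sup>+x. 10 * sqn (f x) \<partial>M') < \<infinity>"
      using fin by (simp add: nn_integral_cmult ennreal_mult_less_top)
    show "AE x in M'. (\<lambda>i. sqn (f x - F i x)) \<longlonglongrightarrow> 0"
    proof (rule AE_I2)
      fix x assume "x \<in> space M'"
      hence "(\<lambda>i. F i x) \<longlonglongrightarrow> f x" using F sets by auto
      hence "(\<lambda>i. sqn (f x - F i x)) \<longlonglongrightarrow> sqn (f x - f x)" unfolding sqn_def by (intro tendsto_intros)
      thus "(\<lambda>i. sqn (f x - F i x)) \<longlonglongrightarrow> 0" by simp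
    qed
  qed auto
  with F(1) show thesis by (intro that) auto
qed

section \<open>Uniform boundedness and joint continuity of strongly continuous operator
  families\<close>

lemma Banach_Steinhaus:
  fixes F :: "('a::banach \<Rightarrow>\<^sub>L 'b::real_normed_vector) set"
  assumes "\<And>x. bounded ((\<lambda>f. blinfun_apply f x) ` F)"
  obtains K where "0 \<le> K" "\<And>f. f \<in> F \<Longrightarrow> norm f \<le> K"
proof -
  \<comment> \<open>Baire: these closed sets cover the space, so one of them contains a ball;
    linearity moves the bound from that ball to the unit ball.\<close>
  define E where "E n = {x. \<forall>f\<in>F. norm (blinfun_apply f x) \<le> real n}" for n
  have cl: "closed (E n)" for n
  proof -
    have "E n = (\<Inter>f\<in>F. {x. norm (blinfun_apply f x) \<le> real n})" by (auto simp: E_def)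
    thus ?thesis by (auto intro!: closed_INT closed_Collect_le continuous_intros)
  qed
  have UN: "(\<Union>n. E n) = UNIV"
  proof safe
    fix x
    from assms[of x] obtain C where C: "\<And>f. f \<in> F \<Longrightarrow> norm (blinfun_apply f x) \<le> C" by (auto simp: bounded_iff)
    obtain n where "C \<le> real n" using real_arch_simple by blast
    hence "x \<in> E n" using C by (force simp: E_def)
    thus "x \<in> (\<Union>n. E n)" by blast
  qed simp
  have "\<exists>n. interior (E n) \<noteq> {}"
  proof (rule ccontr)
    assume "\<not> ?thesis"
    hence "Met_TC.mtopology interior_of \<Union>(range E) = {}"
      using cl by (intro Met_TC.metric_Baire_category_alt)
        (auto simp: Met_TC.mcomplete_def Cauchy_convergent_iff convergent_def)
    thus False using UN by simp
  qed
  then obtain n x0 where "x0 \<in> interior (E n)" by auto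
  then obtain r where r: "r > 0" "cball x0 r \<subseteq> E n" by (auto simp: mem_interior_cball)
  show thesis
  \<comment> \<open>\<open>f z\<close> is the difference of the values at \<open>x0 + z\<close> and
    \<open>x0\<close>, each of norm at most \<open>n\<close>, for \<open>z\<close> of norm
    \<open>r\<close>.\<close>
  proof (rule that[of "2 * real n / r"])
    fix f assume f: "f \<in> F"
    show "norm f \<le> 2 * real n / r"
    proof (rule norm_blinfun_bound)
      fix y
      show "norm (blinfun_apply f y) \<le> 2 * real n / r * norm y"
      proof (cases "y = 0")
        case False
        define z where "z = (r / norm y) *\<^sub>R y"
        have z: "norm z = r" using False r by (simp add: z_def)
        have "norm (blinfun_apply f z) = norm (blinfun_apply f (x0 + z) - blinfun_apply f x0)"
          by (simp add: blinfun.add_right)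
        also have "\<dots> \<le> norm (blinfun_apply f (x0 + z)) + norm (blinfun_apply f x0)" by (rule norm_triangle_ineq4)
        also have "\<dots> \<le> real n + real n"
        proof (intro add_mono)
          have "x0 + z \<in> E n" "x0 \<in> E n" using r z by (auto simp: dist_norm subset_iff)
          thus "norm (blinfun_apply f (x0 + z)) \<le> real n" "norm (blinfun_apply f x0) \<le> real n" using f by (auto simp: E_def)
        qed
        finally have "r / norm y * norm (blinfun_apply f y) \<le> 2 * real n"
          using False r by (simp add: z_def blinfun.scaleR_right)
        thus ?thesis using False r by (simp add: field_simps)
      qed simp
    qed (use r in auto)
  qed (use r in auto)
qed

text \<open>Orbits over a compact time interval are compact, hence bounded, and uniform boundedness
  applies.\<close>

lemma strongly_continuous_bounded:
  fixes S :: "real \<Rightarrow> 'a::banach \<Rightarrow>\<^sub>L 'b::real_normed_vector"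
  assumes "\<And>x. continuous_on {0..} (\<lambda>t. S t x)"
  obtains K where "0 \<le> K" "\<And>t. t \<in> {0..r} \<Longrightarrow> norm (S t) \<le> K"
proof (rule Banach_Steinhaus[of "S ` {0..r}"])
  fix x
  have "continuous_on {0..r} (\<lambda>t. S t x)" by (rule continuous_on_subset[OF assms]) auto
  hence "bounded ((\<lambda>t. S t x) ` {0..r})"
    by (intro compact_imp_bounded compact_continuous_image) auto
  thus "bounded ((\<lambda>f. blinfun_apply f x) ` S ` {0..r})" by (simp add: image_image)
qed (use that in auto)

text \<open>The time increment is split off at fixed \<open>x\<close>, where strong continuity
  applies; the rest, \<open>S\<close> applied to \<open>snd p - x\<close>, is small by the local
  uniform bound. Joint continuity gives the joint Borel measurability that Fubini needs;
  \<open>max 0\<close> extends the family to negative times, so that the domain is the whole product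
  space.\<close>

lemma strongly_continuous_jointly:
  fixes S :: "real \<Rightarrow> 'a::banach \<Rightarrow>\<^sub>L 'b::real_normed_vector"
  assumes S: "\<And>x. continuous_on {0..} (\<lambda>t. S t x)"
  shows "continuous_on UNIV (\<lambda>(t, x). S (max 0 t) x)"
proof (clarsimp simp: continuous_on_eq_continuous_within continuous_within, rename_tac t x)
  fix t :: real and x :: 'a
  obtain K where K: "0 \<le> K" "\<And>u. u \<in> {0..\<bar>t\<bar> + 1} \<Longrightarrow> norm (S u) \<le> K"
    by (rule strongly_continuous_bounded[OF S, of "\<bar>t\<bar> + 1"]) blast
  have c: "continuous_on UNIV (\<lambda>u. S (max 0 u) x)"
    by (rule continuous_on_compose2[OF S, of UNIV "max 0"]) (auto intro!: continuous_intros)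
  have 1: "((\<lambda>p. S (max 0 (fst p)) x - S (max 0 t) x) \<longlongrightarrow> 0) (at (t, x))"
  proof -
    have "isCont (\<lambda>u. S (max 0 u) x) t" using c by (simp add: continuous_on_eq_continuous_at)
    moreover have "(fst \<longlongrightarrow> t) (at (t, x))" by (auto intro!: tendsto_eq_intros)
    ultimately have "((\<lambda>p. S (max 0 (fst p)) x) \<longlongrightarrow> S (max 0 t) x) (at (t, x))"
      by (rule isCont_tendsto_compose)
    thus ?thesis by (simp add: LIM_zero_iff)
  qed
  have 2: "((\<lambda>p. S (max 0 (fst p)) (snd p - x)) \<longlongrightarrow> 0) (at (t, x))"
  proof (rule Lim_null_comparison)
    have "eventually (\<lambda>p. dist p (t, x) < 1) (at (t, x))"
      by (rule eventually_at_ball'[of 1, THEN eventually_mono]) (auto simp: dist_commute)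
    thus "eventually (\<lambda>p. norm (S (max 0 (fst p)) (snd p - x)) \<le> K * norm (snd p - x)) (at (t, x))"
    proof eventually_elim
      case (elim p)
      hence "dist (fst p) t < 1" using dist_fst_le[of p "(t, x)"] by simp
      hence "max 0 (fst p) \<in> {0..\<bar>t\<bar> + 1}" by (auto simp: dist_real_def)
      hence "norm (S (max 0 (fst p))) \<le> K" by (rule K)
      thus ?case by (meson mult_right_mono norm_blinfun norm_ge_zero order_trans)
    qed
    show "((\<lambda>p. K * norm (snd p - x)) \<longlongrightarrow> 0) (at (t, x))" by (auto intro!: tendsto_eq_intros)
  qed
  have "((\<lambda>p. (S (max 0 (fst p)) x - S (max 0 t) x) + S (max 0 (fst p)) (snd p - x)) \<longlongrightarrow> 0 + 0) (at (t, x))"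
    by (rule tendsto_add[OF 1 2])
  hence "((\<lambda>p. S (max 0 (fst p)) (snd p) - S (max 0 t) x) \<longlongrightarrow> 0) (at (t, x))"
    by (simp add: blinfun.diff_right)
  thus "((\<lambda>(t, x). S (max 0 t) x) \<longlongrightarrow> S (max 0 t) x) (at (t, x))"
    by (simp add: LIM_zero_iff case_prod_beta')
qed

section \<open>Increments of the Wiener process\<close>

lemma sigma_sets_vimage_subset:
  assumes "f \<in> measurable M N" "space M = S"
  shows "sigma_sets S {f -` A \<inter> S |A. A \<in> sets N} \<subseteq> sets M"
proof -
  have "{f -` A \<inter> space M |A. A \<in> sets N} \<subseteq> sets M" using measurable_sets[OF assms(1)] by blast
  from sets.sigma_sets_subset[OF this] show ?thesis by (simp add: assms(2))
qed

locale cyl_wiener =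
  fixes W :: "('w, 'u::{real_inner,banach,second_countable_topology}) noise"
  assumes wiener: "cylindrical_wiener W"
begin

sublocale prob_space "pspace W"
  using wiener by (simp add: cylindrical_wiener_def)

abbreviation P :: "'w measure" where
  "P \<equiv> pspace W"

abbreviation incr :: "nat \<Rightarrow> real \<Rightarrow> real \<Rightarrow> 'w \<Rightarrow> real" where
  "incr k s t w \<equiv> bm W k t w - bm W k s w"

lemma
  shows filt_subalgebra: "0 \<le> t \<Longrightarrow> subalgebra P (filt W t)"
    and filt_sets_mono: "0 \<le> s \<Longrightarrow> s \<le> t \<Longrightarrow> sets (filt W s) \<subseteq> sets (filt W t)"
proof -
  have n: "normal_filtration P (filt W)"
    using wiener unfolding cylindrical_wiener_def by (elim conjE)
  have "\<forall>t\<ge>0. subalgebra P (filt W t)"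
    using n unfolding normal_filtration_def by (elim conjE)
  thus "0 \<le> t \<Longrightarrow> subalgebra P (filt W t)" by simp
  have "\<forall>s\<ge>0. \<forall>t\<ge>s. sets (filt W s) \<subseteq> sets (filt W t)"
    using n unfolding normal_filtration_def by (elim conjE)
  thus "0 \<le> s \<Longrightarrow> s \<le> t \<Longrightarrow> sets (filt W s) \<subseteq> sets (filt W t)"
    by simp
qed

lemma filt_sets: "0 \<le> t \<Longrightarrow> A \<in> sets (filt W t) \<Longrightarrow> A \<in> sets P"
  using filt_subalgebra by (auto simp: subalgebra_def)

lemma filt_mono: "0 \<le> s \<Longrightarrow> s \<le> t \<Longrightarrow> A \<in> sets (filt W s) \<Longrightarrow> A \<in> sets (filt W t)"
  using filt_sets_mono by blast

lemma measurable_filt_mono: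
  "0 \<le> s \<Longrightarrow> s \<le> t \<Longrightarrow> f \<in> borel_measurable (filt W s) \<Longrightarrow> f \<in> borel_measurable (filt W t)"
  using filt_sets_mono[of s t] filt_subalgebra[of s] filt_subalgebra[of t]
  by (intro measurable_from_subalg[of "filt W t" "filt W s"]) (simp_all add: subalgebra_def)

lemma measurable_filt: "0 \<le> t \<Longrightarrow> f \<in> borel_measurable (filt W t) \<Longrightarrow> f \<in> borel_measurable P"
  by (rule measurable_from_subalg[OF filt_subalgebra])

lemma bm_adapted: "k \<in> idx W \<Longrightarrow> 0 \<le> t \<Longrightarrow> bm W k t \<in> borel_measurable (filt W t)"
  using wiener by (simp add: cylindrical_wiener_def)

lemma bm_measurable: "k \<in> idx W \<Longrightarrow> 0 \<le> t \<Longrightarrow> bm W k t \<in> borel_measurable P"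
  using bm_adapted measurable_filt by blast

lemma incr_measurable:
  "k \<in> idx W \<Longrightarrow> 0 \<le> s \<Longrightarrow> 0 \<le> t \<Longrightarrow> incr k s t \<in> borel_measurable P"
  by (intro borel_measurable_diff bm_measurable)

lemma incr_adapted:
  assumes "k \<in> idx W" "0 \<le> s" "s \<le> t"
  shows "incr k s t \<in> borel_measurable (filt W t)"
  using assms by (intro borel_measurable_diff bm_adapted) (auto intro: measurable_filt_mono[OF _ _ bm_adapted])

lemma evec_inner: "j \<in> idx W \<Longrightarrow> k \<in> idx W \<Longrightarrow> evec W j \<bullet> evec W k = (if j = k then 1 else 0)"
  using wiener by (simp add: cylindrical_wiener_def orthonormal_basis_on_def)

lemma eval_nonneg: assumes "k \<in> idx W" shows "0 \<le> eval W k"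
proof -
  have "nonneg_op (cov W)" and ev: "cov W (evec W k) = eval W k *\<^sub>R evec W k"
    using wiener assms by (simp_all add: cylindrical_wiener_def)
  hence "0 \<le> cov W (evec W k) \<bullet> evec W k" unfolding nonneg_op_def by blast
  thus ?thesis using evec_inner[OF assms assms] by (simp add: ev)
qed

lemma
  assumes k: "k \<in> idx W" and st: "0 \<le> s" "s \<le> t"
  shows integrable_incr_sq: "integrable P (\<lambda>w. (incr k s t w)\<^sup>2)"
    and integral_incr_sq: "(\<integral>w. (incr k s t w)\<^sup>2 \<partial>P) = eval W k * (t - s)"
    and integral_incr: "(\<integral>w. incr k s t w \<partial>P) = 0"
proof -
  have [measurable]: "incr k s t \<in> borel_measurable P" using assms by (intro incr_measurable) auto
  have "integrable P (\<lambda>w. (incr k s t w)\<^sup>2) \<and>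
    (\<integral>w. (incr k s t w)\<^sup>2 \<partial>P) = eval W k * (t - s) \<and> (\<integral>w. incr k s t w \<partial>P) = 0"
  proof (cases "s = t")
    case False
    hence "s < t" using st by simp
    hence cg: "centred_gaussian P (incr k s t) (eval W k * (t - s))"
      using wiener k st by (simp add: cylindrical_wiener_def)
    \<comment> \<open>A zero eigenvalue is allowed; then the increment has no density and vanishes
      almost surely.\<close>
    show ?thesis
    proof (cases "eval W k * (t - s) = 0")
      case True
      hence ae: "AE w in P. incr k s t w = 0" using cg by (simp add: centred_gaussian_def)
      have "integrable P (\<lambda>w. (incr k s t w)\<^sup>2) \<longleftrightarrow> integrable P (\<lambda>w. 0::real)"
        by (intro integrable_cong_AE) (use ae in auto)
      moreover have "(\<integral>w. (incr k s t w)\<^sup>2 \<partial>P) = (\<integral>w. 0 \<partial>P)"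
        by (intro integral_cong_AE) (use ae in auto)
      moreover have "(\<integral>w. incr k s t w \<partial>P) = (\<integral>w. 0 \<partial>P)"
        by (intro integral_cong_AE) (use ae in auto)
      ultimately show ?thesis using True by simp
    next
      case False
      define \<sigma> where "\<sigma> = sqrt (eval W k * (t - s))"
      have pos: "0 < \<sigma>" using False eval_nonneg[OF k] st unfolding \<sigma>_def
        by (metis diff_ge_0_iff_ge mult_nonneg_nonneg order_le_less real_sqrt_gt_0_iff)
      have sq: "\<sigma>\<^sup>2 = eval W k * (t - s)" using eval_nonneg[OF k] st by (simp add: \<sigma>_def)
      have D: "distributed P lborel (incr k s t) (normal_density 0 \<sigma>)"
        using cg False by (simp add: centred_gaussian_def \<sigma>_def)
      have E: "expectation (incr k s t) = 0" by (rule normal_distributed_expectation[OF pos D])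
      have "integrable lborel (\<lambda>x. normal_density 0 \<sigma> x * x\<^sup>2)"
        using integrable_normal_moment[OF pos, of 0 2] by simp
      hence "integrable P (\<lambda>w. (incr k s t w)\<^sup>2)"
        by (subst (asm) distributed_integrable[OF D]) auto
      moreover have "(\<integral>w. (incr k s t w)\<^sup>2 \<partial>P) = \<sigma>\<^sup>2"
        using normal_distributed_variance[OF pos D] E by simp
      ultimately show ?thesis using E sq by simp
    qed
  qed auto
  thus "integrable P (\<lambda>w. (incr k s t w)\<^sup>2)"
    "(\<integral>w. (incr k s t w)\<^sup>2 \<partial>P) = eval W k * (t - s)"
    "(\<integral>w. incr k s t w \<partial>P) = 0" by auto
qed

lemma msq_incr:
  assumes "k \<in> idx W" "0 \<le> s" "s \<le> t"
  shows "msq P (\<lambda>w. incr k s t w) < \<infinity>"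
proof -
  have "msq P (\<lambda>w. incr k s t w) = ennreal (\<integral>w. (incr k s t w)\<^sup>2 \<partial>P)"
    unfolding sqn_def real_norm_def power2_abs
    by (intro nn_integral_eq_integral integrable_incr_sq assms) auto
  thus ?thesis by simp
qed

lemma integrable_incr_mult:
  assumes "k \<in> idx W" "0 \<le> s" "s \<le> t" "j \<in> idx W" "0 \<le> s'" "s' \<le> t'"
  shows "integrable P (\<lambda>w. incr k s t w * incr j s' t' w)"
  using assms by (intro integrable_mult_sqn incr_measurable msq_incr) auto

lemma integrable_incr:
  assumes "k \<in> idx W" "0 \<le> s" "s \<le> t"
  shows "integrable P (incr k s t)"
  using integrable_mult_sqn[OF incr_measurable, of k s t "\<lambda>_. 1"] assms msq_incr[of k s t]
  by (simp add: sqn_def emeasure_space_1)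

text \<open>All coordinates are taken jointly, because products of two different coordinate
  increments have to be measurable in \<open>integral_same_incr\<close>.\<close>

abbreviation incr_sigma :: "real \<Rightarrow> real \<Rightarrow> 'w measure" where
  "incr_sigma s t \<equiv> vimage_algebra (space P) (\<lambda>w. \<lambda>k\<in>idx W. incr k s t w) (PiM (idx W) (\<lambda>_. borel))"

lemma incr_measurable_incr_sigma:
  assumes "k \<in> idx W"
  shows "incr k s t \<in> borel_measurable (incr_sigma s t)"
proof -
  have "(\<lambda>w. (\<lambda>k\<in>idx W. incr k s t w) k) \<in> borel_measurable (incr_sigma s t)"
    by (rule measurable_compose[OF measurable_vimage_algebra1 measurable_component_singleton])
      (use assms in \<open>auto simp: space_PiM\<close>)
  thus ?thesis using assms by simp
qed

text \<open>The assumed independence of the two sigma-algebras passes to random variables measurable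
  for them, and then the mean of the product factorises.\<close>

lemma integral_past_mult_incr:
  assumes st: "0 \<le> s" "s < t"
    and Y: "Y \<in> borel_measurable (filt W s)" "integrable P Y"
    and Z: "Z \<in> borel_measurable (incr_sigma s t)" "integrable P Z"
  shows "(\<integral>w. Y w * Z w \<partial>P) = (\<integral>w. Y w \<partial>P) * (\<integral>w. (Z w::real) \<partial>P)"
proof (rule indep_var_lebesgue_integral)
  have ind: "indep_set (sets (filt W s)) (sets (incr_sigma s t))"
    using wiener st by (simp add: cylindrical_wiener_def)
  have sp: "space (filt W s) = space P" "space (incr_sigma s t) = space P"
    using filt_subalgebra[of s] st by (auto simp: subalgebra_def)
  have "sigma_sets (space P) {Y -` A \<inter> space P |A. A \<in> sets borel} \<subseteq> sets (filt W s)"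
    by (rule sigma_sets_vimage_subset[OF Y(1) sp(1)])
  moreover have "sigma_sets (space P) {Z -` A \<inter> space P |A. A \<in> sets borel} \<subseteq> sets (incr_sigma s t)"
    by (rule sigma_sets_vimage_subset[OF Z(1) sp(2)])
  ultimately have "indep_set (sigma_sets (space P) {Y -` A \<inter> space P |A. A \<in> sets borel})
     (sigma_sets (space P) {Z -` A \<inter> space P |A. A \<in> sets borel})"
    using ind unfolding indep_set_def by (elim indep_sets_mono_sets) (auto split: bool.split)
  thus "indep_var borel Y borel Z"
    using Y(2) Z(2) by (simp add: indep_var_eq)
qed fact+

lemma integral_past_mult_incr_0:
  assumes "k \<in> idx W" "0 \<le> s" "s \<le> t" "Y \<in> borel_measurable (filt W s)" "integrable P Y"
  shows "(\<integral>w. Y w * incr k s t w \<partial>P) = 0"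
proof (cases "s = t")
  case False
  thus ?thesis
    using assms by (subst integral_past_mult_incr) (auto intro!: incr_measurable_incr_sigma integrable_incr simp: integral_incr)
qed simp

lemma integral_incr_mult:
  assumes jk: "j \<in> idx W" "k \<in> idx W" and st: "0 \<le> s" "s \<le> t"
  shows "(\<integral>w. incr j s t w * incr k s t w \<partial>P) = (if j = k then eval W k * (t - s) else 0)"
proof (cases "j = k")
  case True
  thus ?thesis using integral_incr_sq[OF jk(2) st] by (simp add: power2_eq_square)
next
  case False
  \<comment> \<open>Independence is given for whole paths; the increment is a measurable function of
    the path.\<close>
  have "indep_vars (\<lambda>_. PiM {0..} (\<lambda>_. borel)) (\<lambda>k w. \<lambda>t\<in>{0..}. bm W k t w) (idx W)"
    using wiener by (simp add: cylindrical_wiener_def)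
  hence "indep_vars (\<lambda>_. borel) (\<lambda>k w. (\<lambda>x. x t - x s) (\<lambda>t\<in>{0..}. bm W k t w)) (idx W)"
    by (rule indep_vars_compose2) (intro borel_measurable_diff measurable_component_singleton; use st in simp)
  hence "indep_vars (\<lambda>_. borel) (\<lambda>k. incr k s t) (idx W)" using st by simp
  hence iv: "indep_vars (\<lambda>_. borel) (\<lambda>k. incr k s t) {j, k}"
    by (rule indep_vars_subset) (use jk in auto)
  have "(\<integral>w. (\<Prod>i\<in>{j, k}. incr i s t w) \<partial>P) = (\<Prod>i\<in>{j, k}. \<integral>w. incr i s t w \<partial>P)"
    by (rule indep_vars_lebesgue_integral[OF _ iv]) (use jk st in \<open>auto intro: integrable_incr\<close>)
  thus ?thesis using False integral_incr[OF jk(2) st] by simp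
qed

lemma integrable_past_mult_incr:
  assumes "k \<in> idx W" "0 \<le> s" "s \<le> t" "A \<in> sets P"
  shows "integrable P (\<lambda>w. indicat_real A w * incr k s t w)"
  using integrable_real_mult_indicator[OF assms(4) integrable_incr[OF assms(1-3)]] by (simp add: mult.commute)

text \<open>The earlier increment, like \<open>B\<close>, is known at time \<open>s'\<close>, so the
  later increment is centred against it.\<close>

lemma integral_disjoint_incr:
  assumes k: "k \<in> idx W" "j \<in> idx W" and st: "0 \<le> s" "s \<le> t" "t \<le> s'" "s' \<le> t'"
    and B: "B \<in> sets (filt W s')"
  shows "(\<integral>w. (indicat_real B w * incr k s t w) * incr j s' t' w \<partial>P) = 0"
proof (rule integral_past_mult_incr_0)
  have "incr k s t \<in> borel_measurable (filt W s')"
    using measurable_filt_mono[OF _ _ incr_adapted] k st by auto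
  thus "(\<lambda>w. indicat_real B w * incr k s t w) \<in> borel_measurable (filt W s')"
    using B by measurable
  show "integrable P (\<lambda>w. indicat_real B w * incr k s t w)"
    using k st B by (intro integrable_past_mult_incr filt_sets[of s']) auto
qed (use k st in auto)

text \<open>\<open>B\<close> belongs to the past of \<open>s\<close>, while the product of the two
  increments is a function of the joint increment after \<open>s\<close>; hence the mean
  factorises.\<close>

lemma integral_same_incr:
  assumes k: "k \<in> idx W" "j \<in> idx W" and st: "0 \<le> s" "s \<le> t" and B: "B \<in> sets (filt W s)"
  shows "(\<integral>w. indicat_real B w * (incr k s t w * incr j s t w) \<partial>P) =
    prob B * (if k = j then eval W k * (t - s) else 0)"
proof (cases "s = t")
  case False
  have BP: "B \<in> sets P" using B st by (intro filt_sets)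
  have "(\<integral>w. indicat_real B w * (incr k s t w * incr j s t w) \<partial>P) =
    (\<integral>w. indicat_real B w \<partial>P) * (\<integral>w. incr k s t w * incr j s t w \<partial>P)"
    using False st B BP k
    by (intro integral_past_mult_incr[of s t] borel_measurable_times incr_measurable_incr_sigma integrable_incr_mult)
      (auto simp: less_top[symmetric])
  thus ?thesis using integral_incr_mult[OF k st] BP sets.sets_into_space[OF BP] by (auto simp: Int_absorb2)
qed simp

text \<open>Both increments are split at the ends of the overlap of the two time intervals; only the product of
  the increments over the overlap has nonzero mean.\<close>

lemma integral_incr_overlap_aux:
  assumes k: "k \<in> idx W" "j \<in> idx W" and st: "0 \<le> s" "s \<le> t" and st': "0 \<le> s'" "s' \<le> t'" and ss': "s \<le> s'"
    and B: "B \<in> sets (filt W s')"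
  shows "(\<integral>w. indicat_real B w * (incr k s t w * incr j s' t' w) \<partial>P) =
    prob B * (if k = j then eval W k else 0) * max 0 (min t t' - s')"
proof (cases "t \<le> s'")
  case True
  thus ?thesis using integral_disjoint_incr[OF k st True st'(2) B] by (simp add: mult.assoc)
next
  case False
  let ?f = "\<lambda>a b c d w. indicat_real B w * (incr k a b w * incr j c d w)"
  let ?E = "\<lambda>a b c d. \<integral>w. ?f a b c d w \<partial>P"
  \<comment> \<open>With \<open>q\<close> as right end of the overlap, \<open>(s,t]\<close> is cut
    into \<open>(s,s']\<close>, \<open>(s',q]\<close>, \<open>(q,t]\<close> and
    \<open>(s',t']\<close> into \<open>(s',q]\<close>, \<open>(q,t']\<close>; the two pieces after
    \<open>q\<close> are never both nonempty.\<close>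
  define q where "q = min t t'"
  have q: "s' \<le> q" "q \<le> t" "q \<le> t'" using False st' by (auto simp: q_def)
  have BP: "B \<in> sets P" using B st' by (intro filt_sets)
  have Bq: "B \<in> sets (filt W q)" by (rule filt_mono[OF st'(1) q(1) B])
  have int: "integrable P (\<lambda>w. indicat_real B w * (incr i u v w * incr i' u' v' w))"
    if "i \<in> idx W" "i' \<in> idx W" "0 \<le> u" "u \<le> v" "0 \<le> u'" "u' \<le> v'" for i i' u v u' v'
    using integrable_real_mult_indicator[OF BP integrable_incr_mult[of i u v i' u' v']] that
    by (simp add: mult.commute)
  have add5: "(\<integral>w. f1 w + (f2 w + (f3 w + (f4 w + f5 w))) \<partial>P) = (\<integral>w. f1 w \<partial>P) +
      ((\<integral>w. f2 w \<partial>P) + ((\<integral>w. f3 w \<partial>P) + ((\<integral>w. f4 w \<partial>P) + (\<integral>w. f5 w \<partial>P))))"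
    if "integrable P f1" "integrable P f2" "integrable P f3"
      "integrable P f4" "integrable P f5" for f1 f2 f3 f4 f5 :: "'w \<Rightarrow> real"
    using that by simp
  have "?E s t s' t' =
     (\<integral>w. ?f s s' s' t' w + (?f s' q s' q w
        + (?f s' q q t' w
        + (?f q t s' q w + ?f q t q t' w))) \<partial>P)"
    by (intro Bochner_Integration.integral_cong) (auto simp: algebra_simps)
  also have "\<dots> = ?E s s' s' t' +
     (?E s' q s' q
     + (?E s' q q t'
     + (?E q t s' q
      + ?E q t q t')))"
    by (rule add5; rule int) (use k st st' ss' q in auto)
  also have "?E s s' s' t' = 0"
    using integral_disjoint_incr[OF k st(1) ss' order_refl st'(2) B] by (simp add: mult.assoc)
  also have "?E s' q q t' = 0"
    using integral_disjoint_incr[OF k st'(1) q(1) order_refl q(3) Bq] by (simp add: mult.assoc)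
  also have "?E q t s' q = 0"
    using integral_disjoint_incr[OF k(2,1) st'(1) q(1) order_refl q(2) Bq] by (simp add: ac_simps)
  also have "?E q t q t' = 0"
    by (cases "t \<le> t'") (auto simp: q_def min_def)
  also have "?E s' q s' q =
      prob B * (if k = j then eval W k * (q - s') else 0)"
    by (rule integral_same_incr[OF k st'(1) q(1) B])
  finally show ?thesis using q by (simp add: q_def)
qed

text \<open>Symmetric form of \<open>integral_incr_overlap_aux\<close>, which asks for a single
  event known at the later of the two starting times; \<open>B \<inter> B'\<close> is such an
  event.\<close>

lemma integral_incr_overlap:
  assumes k: "k \<in> idx W" "j \<in> idx W" and st: "0 \<le> s" "s \<le> t" and st': "0 \<le> s'" "s' \<le> t'"
    and B: "B \<in> sets (filt W s)" and B': "B' \<in> sets (filt W s')"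
  shows "(\<integral>w. (indicat_real B w * incr k s t w) * (indicat_real B' w * incr j s' t' w) \<partial>P) =
    prob (B \<inter> B') * (if k = j then eval W k else 0) * max 0 (min t t' - max s s')"
proof -
  have eq: "(indicat_real B w * incr k s t w) * (indicat_real B' w * incr j s' t' w) =
     indicat_real (B \<inter> B') w * (incr k s t w * incr j s' t' w)" for w
    by (auto simp: indicator_def)
  show ?thesis
  proof (cases "s \<le> s'")
    case True
    thus ?thesis unfolding eq using filt_mono[OF st(1) True B] B'
      by (subst integral_incr_overlap_aux[OF k st st']) (auto simp: max_def)
  next
    case False
    hence le: "s' \<le> s" by simp
    have "(\<integral>w. indicat_real (B \<inter> B') w * (incr j s' t' w * incr k s t w) \<partial>P) =
      prob (B \<inter> B') * (if j = k then eval W j else 0) * max 0 (min t' t - s)"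
      using filt_mono[OF st'(1) le B'] B by (intro integral_incr_overlap_aux[OF k(2,1) st' st le]) auto
    thus ?thesis unfolding eq using le by (cases "k = j") (simp_all add: max_def min.commute mult.commute)
  qed
qed

end

section \<open>The Ito isometry for elementary processes\<close>

text \<open>Values on the orthonormal basis of \<open>U0\<close>, padded by 0, so that
  Hilbert-Schmidt norms become \<open>suminf\<close> over all natural numbers and operators become
  sequences in the target space.\<close>

definition coord :: "('w, 'u::real_inner) noise \<Rightarrow> ('u \<Rightarrow> 'h::real_vector) \<Rightarrow> nat \<Rightarrow> 'h" where
  "coord W \<Phi> k = (if k \<in> U0_idx W then \<Phi> (U0_basis W k) else 0)"

lemma elem_process_Nil [simp]: "elem_process [] \<tau> w u = 0"
  by (simp add: elem_process_def)

lemma elem_process_Cons: "elem_process (x # xs) \<tau> w u = elem_process [x] \<tau> w u + elem_process xs \<tau> w u"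
  by (simp add: elem_process_def)

lemma elem_process_append:
  "elem_process (xs @ ys) \<tau> w u = elem_process xs \<tau> w u + elem_process ys \<tau> w u"
  by (simp add: elem_process_def)

lemma elem_process_tuple:
  "elem_process ((s, t, B, L) # xs) \<tau> w u =
     (indicat_real {s<..t} \<tau> * indicat_real B w) *\<^sub>R L u + elem_process xs \<tau> w u"
  by (simp add: elem_process_def)

lemma elem_process_scaleR: "elem_process xs \<tau> w (c *\<^sub>R u) = c *\<^sub>R elem_process xs \<tau> w u"
proof (induction xs)
  case (Cons x xs)
  thus ?case
    by (cases x rule: prod_cases4)
      (simp add: elem_process_tuple blinfun.scaleR_right scaleR_add_right mult.commute)
qed simp

lemma elem_integral_Nil [simp]: "elem_integral W [] w = 0"
  by (simp add: elem_integral_def)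

lemma elem_integral_Cons:
  "elem_integral W (x # xs) w = elem_integral W [x] w + elem_integral W xs w"
  by (simp add: elem_integral_def)

lemma elem_integral_append:
  "elem_integral W (xs @ ys) w = elem_integral W xs w + elem_integral W ys w"
  by (simp add: elem_integral_def)

lemma elementary_Nil [simp]: "elementary W r []"
  by (simp add: elementary_def)

lemma elementary_tuple: "elementary W r ((s, t, B, L) # xs) \<longleftrightarrow> 0 \<le> s \<and> s < t \<and> t \<le> r \<and>
    B \<in> sets (filt W s) \<and> finite {k \<in> idx W. L (evec W k) \<noteq> 0} \<and> elementary W r xs"
  by (simp add: elementary_def)

lemma elementary_append: "elementary W r (xs @ ys) \<longleftrightarrow> elementary W r xs \<and> elementary W r ys"
  by (simp only: elementary_def set_append ball_Un)

lemma elementary_Cons: "elementary W r (x # xs) \<longleftrightarrow> elementary W r [x] \<and> elementary W r xs"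
  using elementary_append[of W r "[x]" xs] by simp

lemma elementary_mono: "elementary W r xs \<Longrightarrow> r \<le> r' \<Longrightarrow> elementary W r' xs"
proof (induction xs)
  case (Cons x xs)
  thus ?case by (cases x rule: prod_cases4) (simp add: elementary_tuple)
qed simp

text \<open>Needed for two choices of \<open>R\<close>: the scalar product with a fixed vector, and
  \<open>- id_blinfun\<close> for differences.\<close>

definition elem_map ::
  "('h::real_inner \<Rightarrow>\<^sub>L 'k::real_inner) \<Rightarrow> ('w, 'u::real_inner, 'h) elem \<Rightarrow> ('w, 'u, 'k) elem" where
  "elem_map R xs = map (\<lambda>(s, t, B, L). (s, t, B, R o\<^sub>L L)) xs"

lemma elem_map_Nil [simp]: "elem_map R [] = []"
  by (simp add: elem_map_def)

lemma elem_map_tuple: "elem_map R ((s, t, B, L) # xs) = (s, t, B, R o\<^sub>L L) # elem_map R xs"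
  by (simp add: elem_map_def)

lemma elementary_elem_map: 
  assumes "elementary W r xs" shows "elementary W r (elem_map R xs)"
proof -
  have fin: "finite {k \<in> idx W. R (L (evec W k)) \<noteq> 0}" if "finite {k \<in> idx W. L (evec W k) \<noteq> 0}" for L :: "'b \<Rightarrow>\<^sub>L 'c"
    by (rule finite_subset[OF _ that]) (auto simp: blinfun.zero_right)
  show ?thesis
    using assms
  proof (induction xs)
    case (Cons x xs)
    thus ?case by (cases x rule: prod_cases4) (simp add: elem_map_tuple elementary_tuple fin)
  qed simp
qed

lemma elem_process_elem_map: "elem_process (elem_map R xs) \<tau> w u = R (elem_process xs \<tau> w u)"
proof (induction xs)
  case (Cons x xs)
  thus ?case
    by (cases x rule: prod_cases4)
      (simp add: elem_process_tuple elem_map_tuple blinfun.add_right blinfun.scaleR_right)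
qed (simp add: blinfun.zero_right)

lemma elem_integral_elem_map:
  assumes "elementary W r xs"
  shows "elem_integral W (elem_map R xs) w = R (elem_integral W xs w)"
  using assms
proof (induction xs)
  case (Cons x xs)
  obtain s t B L where x: "x = (s, t, B, L)" by (cases x rule: prod_cases4)
  have fin: "finite {k \<in> idx W. L (evec W k) \<noteq> 0}" using Cons.prems by (simp add: elementary_tuple x)
  \<comment> \<open>\<open>R\<close> may annihilate some of the vectors \<open>L (evec W k)\<close>,
    so the index set on the left can be smaller.\<close>
  have "(\<Sum>k\<in>{k \<in> idx W. R (L (evec W k)) \<noteq> 0}. (bm W k t w - bm W k s w) *\<^sub>R R (L (evec W k))) =
     (\<Sum>k\<in>{k \<in> idx W. L (evec W k) \<noteq> 0}. (bm W k t w - bm W k s w) *\<^sub>R R (L (evec W k)))"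
    using fin by (intro sum.mono_neutral_left) (auto simp: blinfun.zero_right)
  hence "elem_integral W [(s, t, B, R o\<^sub>L L)] w = R (elem_integral W [x] w)"
    by (simp add: elem_integral_def x blinfun.scaleR_right blinfun.sum_right)
  moreover have "elem_integral W (elem_map R xs) w = R (elem_integral W xs w)"
    using Cons elementary_Cons by blast
  ultimately show ?case
    by (simp add: x elem_map_tuple elem_integral_Cons[of _ "(_, _)" xs]
        elem_integral_Cons[of _ "(_, _)" "elem_map R xs"] blinfun.add_right)
qed (simp add: blinfun.zero_right)

text \<open>Lists act as formal sums, so subtraction is concatenation with the negated list.\<close>

definition elem_diff :: "('w, 'u::real_inner, 'h::real_inner) elem \<Rightarrow> ('w, 'u, 'h) elem \<Rightarrow> ('w, 'u, 'h) elem" where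
  "elem_diff xs ys = xs @ elem_map (- id_blinfun) ys"

lemma elementary_elem_diff: "elementary W r xs \<Longrightarrow> elementary W r ys \<Longrightarrow> elementary W r (elem_diff xs ys)"
  by (simp add: elem_diff_def elementary_append elementary_elem_map)

lemma elem_process_elem_diff:
  "elem_process (elem_diff xs ys) \<tau> w u = elem_process xs \<tau> w u - elem_process ys \<tau> w u"
  by (simp add: elem_diff_def elem_process_append elem_process_elem_map blinfun.minus_left)

lemma elem_integral_elem_diff:
  "elementary W r ys \<Longrightarrow> elem_integral W (elem_diff xs ys) w = elem_integral W xs w - elem_integral W ys w"
  by (simp add: elem_diff_def elem_integral_append elem_integral_elem_map blinfun.minus_left)

context cyl_wiener
begin

abbreviation PP :: "(real \<times> 'w) measure" where
  "PP \<equiv> lborel \<Otimes>\<^sub>M P"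

sublocale PP: pair_sigma_finite lborel "P"
  by unfold_locales

definition elem_supp :: "('w, 'u, 'h::real_inner) elem \<Rightarrow> nat set" where
  "elem_supp xs = (\<Union>(s, t, B, L)\<in>set xs. {k \<in> idx W. blinfun_apply L (evec W k) \<noteq> 0})"

lemma elem_supp_tuple: "elem_supp ((s, t, B, L) # xs) = {k \<in> idx W. L (evec W k) \<noteq> 0} \<union> elem_supp xs"
  by (simp add: elem_supp_def)

lemma elem_supp_Cons: "elem_supp (x # xs) = elem_supp [x] \<union> elem_supp xs"
  by (auto simp: elem_supp_def)

lemma finite_elem_supp: "elementary W r xs \<Longrightarrow> finite (elem_supp xs)"
proof (induction xs)
  case (Cons x xs)
  thus ?case by (cases x rule: prod_cases4) (simp add: elem_supp_tuple elementary_tuple)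
qed (simp add: elem_supp_def)

lemma elem_supp_idx: "elem_supp xs \<subseteq> idx W"
  by (auto simp: elem_supp_def)

lemma elem_process_outside_supp:
  "k \<in> idx W \<Longrightarrow> k \<notin> elem_supp xs \<Longrightarrow> elem_process xs \<tau> w (evec W k) = 0"
proof (induction xs)
  case (Cons x xs)
  moreover have "elem_process [x] \<tau> w (evec W k) = 0"
    using Cons.prems by (cases x rule: prod_cases4) (auto simp: elem_process_tuple elem_supp_def)
  ultimately show ?case by (simp add: elem_process_Cons[of x xs] elem_supp_Cons[of x xs])
qed simp

text \<open>The share of the \<open>k\<close>-th Wiener process in the integral.
  \<open>elem_integral\<close> sums over coordinates inside each list entry; grouping by coordinate
  instead lets the independence of the Wiener processes act.\<close>

definition elem_comp :: "nat \<Rightarrow> ('w, 'u, 'h::real_inner) elem \<Rightarrow> 'w \<Rightarrow> 'h" where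
  "elem_comp k xs w = (\<Sum>(s, t, B, L)\<leftarrow>xs. (indicat_real B w * incr k s t w) *\<^sub>R blinfun_apply L (evec W k))"

lemma elem_comp_Nil [simp]: "elem_comp k [] w = 0"
  by (simp add: elem_comp_def)

lemma elem_comp_Cons: "elem_comp k (x # xs) w = elem_comp k [x] w + elem_comp k xs w"
  by (simp add: elem_comp_def)

lemma elem_comp_single: "elem_comp k [(s, t, B, L)] w = (indicat_real B w * incr k s t w) *\<^sub>R L (evec W k)"
  by (simp add: elem_comp_def)

abbreviation ito :: "('w, 'u, 'h::real_inner) elem \<Rightarrow> 'w \<Rightarrow> 'h" where
  "ito \<equiv> elem_integral W"

lemma elem_integral_comp:
  assumes "finite F" "elem_supp xs \<subseteq> F" "F \<subseteq> idx W"
  shows "ito xs w = (\<Sum>k\<in>F. elem_comp k xs w)"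
  using assms(2)
proof (induction xs)
  case (Cons x xs)
  obtain s t B L where x: "x = (s, t, B, L)" by (cases x rule: prod_cases4)
  have sub: "{k \<in> idx W. L (evec W k) \<noteq> 0} \<subseteq> F" using Cons.prems by (auto simp: elem_supp_def x)
  have "(\<Sum>k\<in>{k \<in> idx W. L (evec W k) \<noteq> 0}. incr k t s w *\<^sub>R L (evec W k)) =
     (\<Sum>k\<in>F. incr k t s w *\<^sub>R L (evec W k))" for t s
    using sub assms by (intro sum.mono_neutral_left) auto
  hence "ito [x] w = (\<Sum>k\<in>F. elem_comp k [x] w)"
    by (simp add: x elem_integral_def elem_comp_single flip: scaleR_scaleR scaleR_sum_right)
  thus ?case using Cons
    by (simp add: elem_integral_Cons[of _ x xs] elem_comp_Cons[of _ x xs] sum.distrib elem_supp_Cons[of x xs])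
qed simp

lemma indicator_PP_measurable:
  assumes "B \<in> sets P"
  shows "(\<lambda>x. indicat_real {s<..t} (fst x) * indicat_real B (snd x)) \<in> borel_measurable PP"
proof -
  have "(\<lambda>x. indicat_real B (snd x)) \<in> borel_measurable PP"
    by (rule measurable_compose[OF measurable_snd borel_measurable_indicator[OF assms]])
  thus ?thesis by measurable
qed

lemma elem_process_measurable:
  fixes xs :: "('w, 'u, 'h::{real_inner,second_countable_topology}) elem"
  assumes "elementary W r xs"
  shows "(\<lambda>x. elem_process xs (fst x) (snd x) u) \<in> borel_measurable PP"
  using assms
proof (induction xs)
  case (Cons x xs)
  obtain s t B L where x: "x = (s, t, B, L)" by (cases x rule: prod_cases4)
  have "B \<in> sets P" using Cons.prems by (auto simp: elementary_tuple x intro: filt_sets)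
  hence "(\<lambda>z. elem_process [x] (fst z) (snd z) u) \<in> borel_measurable PP"
    unfolding x elem_process_tuple elem_process_Nil add_0_right by (intro borel_measurable_scaleR indicator_PP_measurable) auto
  moreover have "(\<lambda>x. elem_process xs (fst x) (snd x) u) \<in> borel_measurable PP"
    using Cons elementary_Cons by blast
  ultimately show ?case by (simp add: elem_process_Cons[of x xs])
qed simp

lemma elem_comp_measurable:
  fixes xs :: "('w, 'u, 'h::{real_inner,second_countable_topology}) elem"
  assumes "elementary W r xs" "k \<in> idx W"
  shows "elem_comp k xs \<in> borel_measurable P"
  using assms(1)
proof (induction xs)
  case (Cons x xs)
  obtain s t B L where x: "x = (s, t, B, L)" by (cases x rule: prod_cases4)
  have "B \<in> sets P" and st: "0 \<le> s" "0 \<le> t" using Cons.prems by (auto simp: elementary_tuple x intro: filt_sets)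
  moreover have "incr k s t \<in> borel_measurable P" using incr_measurable assms st by auto
  ultimately have "(\<lambda>w. elem_comp k [x] w) \<in> borel_measurable P"
    unfolding x elem_comp_single by measurable
  moreover have "(\<lambda>w. elem_comp k xs w) \<in> borel_measurable P"
    using Cons elementary_Cons by blast
  ultimately have "(\<lambda>w. elem_comp k [x] w + elem_comp k xs w) \<in> borel_measurable P" by measurable
  thus ?case by (simp add: elem_comp_Cons[of k x xs, abs_def])
qed (simp add: elem_comp_def[abs_def])

lemma elem_integral_measurable:
  fixes xs :: "('w, 'u, 'h::{real_inner,second_countable_topology}) elem"
  assumes "elementary W r xs"
  shows "ito xs \<in> borel_measurable P"
proof -
  have "ito xs = (\<lambda>w. \<Sum>k\<in>elem_supp xs. elem_comp k xs w)"
    using finite_elem_supp[OF assms] elem_supp_idx by (intro ext elem_integral_comp) auto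
  moreover have "\<dots> \<in> borel_measurable P"
    using elem_comp_measurable[OF assms] elem_supp_idx[of xs] by (intro borel_measurable_sum) auto
  ultimately show ?thesis by simp
qed

text \<open>For equal coordinates and apart from the eigenvalue this is the number in
  \<open>integral_incr_overlap\<close>; their agreement is the Ito isometry for a pair of elementary
  terms.\<close>

lemma PP_rectangles:
  assumes B: "B \<in> sets P" "B' \<in> sets P"
  shows "has_bochner_integral PP
     (\<lambda>x. (indicat_real {s<..t} (fst x) * indicat_real B (snd x)) * (indicat_real {s'<..t'} (fst x) * indicat_real B' (snd x)))
     (prob (B \<inter> B') * max 0 (min t t' - max s s'))"
proof -
  let ?A = "{max s s'<..min t t'} \<times> (B \<inter> B')"
  have "emeasure PP ?A = ennreal (max 0 (min t t' - max s s')) * ennreal (prob (B \<inter> B'))"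
    using B by (subst emeasure_pair_measure_Times) (auto simp: emeasure_eq_measure emeasure_lborel_Ioc max_def)
  hence em: "emeasure PP ?A = ennreal (prob (B \<inter> B') * max 0 (min t t' - max s s'))"
    by (subst ennreal_mult) (auto simp del: ennreal_max_0 simp: mult.commute)
  have "?A \<in> sets PP" using B by auto
  hence "has_bochner_integral PP (indicat_real ?A) (measure PP ?A)"
    by (intro has_bochner_integral_real_indicator) (simp_all only: em ennreal_less_top infinity_ennreal_def)
  also have "measure PP ?A = prob (B \<inter> B') * max 0 (min t t' - max s s')"
    by (rule measure_eq_emeasure_eq_ennreal[OF _ em]) simp
  also have "indicat_real ?A = (\<lambda>x. (indicat_real {s<..t} (fst x) * indicat_real B (snd x)) *
       (indicat_real {s'<..t'} (fst x) * indicat_real B' (snd x)))"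
    by (auto simp: indicator_def fun_eq_iff)
  finally show ?thesis .
qed

abbreviation evec_coord :: "('w, 'u, 'h::real_inner) elem \<Rightarrow> real \<times> 'w \<Rightarrow> nat \<Rightarrow> 'h" where
  "evec_coord xs z k \<equiv> elem_process xs (fst z) (snd z) (evec W k)"

text \<open>Both sides of the isometry for one pair of coordinates, tied together by a common
  constant \<open>c\<close>. Since both are bilinear, the constants add when the lists grow, and no
  formula for \<open>c\<close> is ever required.\<close>

definition elem_cov :: "nat \<Rightarrow> nat \<Rightarrow> ('w, 'u, 'h::real_inner) elem \<Rightarrow> ('w, 'u, 'h) elem \<Rightarrow> real \<Rightarrow> bool" where
  "elem_cov k j xs ys c \<longleftrightarrow> has_bochner_integral PP (\<lambda>z. evec_coord xs z k \<bullet> evec_coord ys z j) c \<and>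
     has_bochner_integral P (\<lambda>w. elem_comp k xs w \<bullet> elem_comp j ys w) ((if k = j then eval W k else 0) * c)"

lemma elem_cov_Nil: "elem_cov k j [] ys 0" "elem_cov k j xs [] 0"
  by (auto simp: elem_cov_def)

lemma elem_cov_Cons_left:
  assumes "elem_cov k j [x] ys c" "elem_cov k j xs ys c'"
  shows "elem_cov k j (x # xs) ys (c + c')"
  using assms unfolding elem_cov_def elem_process_Cons[of x xs] elem_comp_Cons[of _ x xs] inner_add_left distrib_left
  by - (elim conjE, intro conjI has_bochner_integral_add; assumption)

lemma elem_cov_Cons_right:
  assumes "elem_cov k j xs [y] c" "elem_cov k j xs ys c'"
  shows "elem_cov k j xs (y # ys) (c + c')"
  using assms unfolding elem_cov_def elem_process_Cons[of y ys] elem_comp_Cons[of _ y ys] inner_add_right distrib_left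
  by - (elim conjE, intro conjI has_bochner_integral_add; assumption)

lemma elem_cov_single:
  fixes L L' :: "'u \<Rightarrow>\<^sub>L 'h::{real_inner,banach,second_countable_topology}"
  assumes kj: "k \<in> idx W" "j \<in> idx W"
    and x: "elementary W r [(s, t, B, L)]" and y: "elementary W r' [(s', t', B', L')]"
  shows "\<exists>c. elem_cov k j [(s, t, B, L)] [(s', t', B', L')] c"
proof -
  have st: "0 \<le> s" "s \<le> t" "0 \<le> s'" "s' \<le> t'" and B: "B \<in> sets (filt W s)" "B' \<in> sets (filt W s')"
    using x y by (auto simp: elementary_tuple)
  have BP: "B \<in> sets P" "B' \<in> sets P" using B st filt_sets by auto
  define v where "v = L (evec W k) \<bullet> L' (evec W j)"
  define p where "p = prob (B \<inter> B')"
  define m where "m = max 0 (min t t' - max s s')"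
  let ?f = "\<lambda>w. (indicat_real B w * incr k s t w) * (indicat_real B' w * incr j s' t' w)"
  have 1: "has_bochner_integral PP (\<lambda>z. evec_coord [(s, t, B, L)] z k \<bullet> evec_coord [(s', t', B', L')] z j) (p * m * v)"
    using has_bochner_integral_mult_left[where c=v, OF PP_rectangles[where s=s and t=t and s'=s' and t'=t', OF BP]]
    by (simp add: elem_process_tuple v_def p_def m_def ac_simps)
  have "integrable P (\<lambda>w. incr k s t w * incr j s' t' w * indicat_real (B \<inter> B') w)"
    by (intro integrable_real_mult_indicator integrable_incr_mult) (use kj st BP in auto)
  hence "integrable P ?f" by (simp add: indicator_inter_arith ac_simps)
  hence "has_bochner_integral P ?f (p * (if k = j then eval W k else 0) * m)"
    unfolding p_def m_def integral_incr_overlap[OF kj st B, symmetric] by (rule has_bochner_integral_integrable)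
  hence "has_bochner_integral P (\<lambda>w. ?f w * v) (p * (if k = j then eval W k else 0) * m * v)"
    by (rule has_bochner_integral_mult_left)
  hence "has_bochner_integral P (\<lambda>w. elem_comp k [(s, t, B, L)] w \<bullet> elem_comp j [(s', t', B', L')] w)
     ((if k = j then eval W k else 0) * (p * m * v))"
    by (simp add: elem_comp_single v_def ac_simps)
  with 1 show ?thesis unfolding elem_cov_def by blast
qed

lemma elem_cov_exists:
  fixes xs ys :: "('w, 'u, 'h::{real_inner,banach,second_countable_topology}) elem"
  assumes kj: "k \<in> idx W" "j \<in> idx W" and xs: "elementary W r xs" and ys: "elementary W r' ys"
  shows "\<exists>c. elem_cov k j xs ys c"
  using xs
proof (induction xs)
  case Nil
  show ?case using elem_cov_Nil by blast
next
  case (Cons x xs)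
  have x: "elementary W r [x]" "elementary W r xs" using Cons.prems elementary_Cons by blast+
  have "\<exists>c. elem_cov k j [x] ys c"
    using ys
  proof (induction ys)
    case Nil
    show ?case using elem_cov_Nil by blast
  next
    case (Cons y ys)
    have y: "elementary W r' [y]" "elementary W r' ys" using Cons.prems elementary_Cons by blast+
    have "\<exists>c. elem_cov k j [x] [y] c"
      using elem_cov_single[OF kj] x(1) y(1) by (cases x rule: prod_cases4, cases y rule: prod_cases4) blast
    with Cons.IH[OF y(2)] show ?case using elem_cov_Cons_right by blast
  qed
  with Cons.IH[OF x(2)] show ?case using elem_cov_Cons_left by blast
qed

abbreviation elem_coord :: "('w, 'u, 'h::real_inner) elem \<Rightarrow> real \<times> 'w \<Rightarrow> nat \<Rightarrow> 'h" where
  "elem_coord xs z k \<equiv> coord W (elem_process xs (fst z) (snd z)) k"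

text \<open>A coordinate in \<open>idx W\<close> but outside \<open>U0_idx W\<close> has eigenvalue
  0, so the root on the right reproduces the padding by 0.\<close>

lemma elem_coord_eq:
  assumes "k \<in> idx W"
  shows "elem_coord xs z k = sqrt (eval W k) *\<^sub>R evec_coord xs z k"
  using eval_nonneg[OF assms] assms by (auto simp: coord_def U0_idx_def U0_basis_def elem_process_scaleR)

lemma elem_coord_outside: "k \<notin> elem_supp xs \<Longrightarrow> elem_coord xs z k = 0"
  by (cases "k \<in> idx W") (simp_all add: elem_coord_eq elem_process_outside_supp, simp add: coord_def U0_idx_def)

lemma elem_coord_measurable:
  fixes xs :: "('w, 'u, 'h::{real_inner,second_countable_topology}) elem"
  assumes "elementary W r xs"
  shows "(\<lambda>z. elem_coord xs z k) \<in> borel_measurable PP"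
  using elem_process_measurable[OF assms] by (cases "k \<in> U0_idx W") (simp_all add: coord_def)

text \<open>The polarised isometry. Distinct coordinates contribute nothing, and the eigenvalue of
  an equal pair is absorbed by the two factors \<open>sqrt (eval W k)\<close> in
  \<open>U0_basis\<close>. It suffices that \<open>F\<close> contains one support, since a product
  vanishes with either factor; so \<open>F\<close> can stay fixed while \<open>xs\<close> runs
  through a sequence.\<close>

lemma elem_isometry:
  fixes xs ys :: "('w, 'u, 'h::{real_inner,banach,second_countable_topology}) elem"
  assumes xs: "elementary W r xs" and ys: "elementary W r' ys" and F: "finite F" "elem_supp ys \<subseteq> F"
  shows "has_bochner_integral P (\<lambda>w. ito xs w \<bullet> ito ys w)
    (\<integral>z. (\<Sum>k\<in>F. elem_coord xs z k \<bullet> elem_coord ys z k) \<partial>PP)"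
    and "integrable PP (\<lambda>z. \<Sum>k\<in>F. elem_coord xs z k \<bullet> elem_coord ys z k)"
proof -
  define G where "G = elem_supp xs \<union> elem_supp ys"
  have G: "finite G" "G \<subseteq> idx W" using xs ys finite_elem_supp elem_supp_idx unfolding G_def by blast+
  have "\<forall>k j. \<exists>c. k \<in> G \<longrightarrow> j \<in> G \<longrightarrow> elem_cov k j xs ys c"
    using elem_cov_exists[OF _ _ xs ys] G(2) by blast
  then obtain c where "\<And>k j. k \<in> G \<Longrightarrow> j \<in> G \<Longrightarrow> elem_cov k j xs ys (c k j)" by metis
  note c = this[unfolded elem_cov_def, THEN conjunct1] this[unfolded elem_cov_def, THEN conjunct2]
  have "has_bochner_integral P (\<lambda>w. \<Sum>k\<in>G. \<Sum>j\<in>G. elem_comp k xs w \<bullet> elem_comp j ys w)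
     (\<Sum>k\<in>G. \<Sum>j\<in>G. (if k = j then eval W k else 0) * c k j)"
    by (intro has_bochner_integral_sum c)
  moreover have "(\<lambda>w. \<Sum>k\<in>G. \<Sum>j\<in>G. elem_comp k xs w \<bullet> elem_comp j ys w) =
     (\<lambda>w. ito xs w \<bullet> ito ys w)"
  proof (intro ext)
    fix w
    have I: "ito xs w = (\<Sum>k\<in>G. elem_comp k xs w)" "ito ys w = (\<Sum>k\<in>G. elem_comp k ys w)"
      using G by (intro elem_integral_comp; auto simp: G_def)+
    show "(\<Sum>k\<in>G. \<Sum>j\<in>G. elem_comp k xs w \<bullet> elem_comp j ys w) = ito xs w \<bullet> ito ys w"
      unfolding I inner_sum_left unfolding inner_sum_right ..
  qed
  moreover have "(\<Sum>k\<in>G. \<Sum>j\<in>G. (if k = j then eval W k else 0) * c k j) = (\<Sum>k\<in>G. eval W k * c k k)"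
    using G by (simp add: if_distrib[of "\<lambda>x. x * _"] cong: if_cong)
  ultimately have 1: "has_bochner_integral P (\<lambda>w. ito xs w \<bullet> ito ys w)
     (\<Sum>k\<in>G. eval W k * c k k)" by simp
  have "has_bochner_integral PP (\<lambda>z. \<Sum>k\<in>G. eval W k * (evec_coord xs z k \<bullet>
                 evec_coord ys z k)) (\<Sum>k\<in>G. eval W k * c k k)"
    by (intro has_bochner_integral_sum has_bochner_integral_mult_right c)
  moreover have "(\<Sum>k\<in>G. eval W k * (evec_coord xs z k \<bullet>
                 evec_coord ys z k)) = (\<Sum>k\<in>F. elem_coord xs z k \<bullet> elem_coord ys z k)" for z
  proof -
    have "(\<Sum>k\<in>G. eval W k * (evec_coord xs z k \<bullet>
                 evec_coord ys z k)) = (\<Sum>k\<in>G. elem_coord xs z k \<bullet> elem_coord ys z k)"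
      using G eval_nonneg by (intro sum.cong refl) (auto simp: elem_coord_eq subset_iff simp flip: mult.assoc)
    also have "\<dots> = (\<Sum>k\<in>F. elem_coord xs z k \<bullet> elem_coord ys z k)"
    proof -
      have "elem_coord xs z i \<bullet> elem_coord ys z i = 0" if "i \<in> G - F \<or> i \<in> F - G" for i
      proof -
        have "i \<notin> elem_supp ys" using that F(2) by (auto simp: G_def)
        thus ?thesis by (simp add: elem_coord_outside)
      qed
      thus ?thesis using G F by (intro sum.mono_neutral_cong) auto
    qed
    finally show ?thesis .
  qed
  ultimately have 2: "has_bochner_integral PP (\<lambda>z. \<Sum>k\<in>F. elem_coord xs z k \<bullet> elem_coord ys z k) (\<Sum>k\<in>G. eval W k * c k k)"
    by simp
  show "integrable PP (\<lambda>z. \<Sum>k\<in>F. elem_coord xs z k \<bullet> elem_coord ys z k)"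
    using 2 by (rule integrable.intros)
  show "has_bochner_integral P (\<lambda>w. ito xs w \<bullet> ito ys w)
    (\<integral>z. (\<Sum>k\<in>F. elem_coord xs z k \<bullet> elem_coord ys z k) \<partial>PP)"
    using 1 has_bochner_integral_integral_eq[OF 2] by simp
qed

text \<open>Squared norm in the space of square-integrable functions of time and chance with values
  in the square-summable sequences.\<close>

definition sqN :: "(real \<times> 'w \<Rightarrow> nat \<Rightarrow> 'h::real_normed_vector) \<Rightarrow> ennreal" where
  "sqN f = (\<integral>\<^sup>+z. (\<Sum>k. sqn (f z k)) \<partial>PP)"

lemma elem_isometry_norm:
  fixes xs :: "('w, 'u, 'h::{real_inner,banach,second_countable_topology}) elem"
  assumes xs: "elementary W r xs"
  shows "msq P (\<lambda>w. ito xs w) = sqN (elem_coord xs)"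
    and "sqN (elem_coord xs) < \<infinity>"
proof -
  note iso = elem_isometry[OF xs xs finite_elem_supp[OF xs] order_refl]
  have "msq P (\<lambda>w. ito xs w) =
      (\<integral>\<^sup>+w. ennreal (ito xs w \<bullet> ito xs w) \<partial>P)"
    by (simp add: sqn_def power2_norm_eq_inner)
  also have "\<dots> = ennreal (\<integral>z. (\<Sum>k\<in>elem_supp xs. elem_coord xs z k \<bullet> elem_coord xs z k) \<partial>PP)"
    using iso(1) by (subst nn_integral_eq_integral) (auto simp: has_bochner_integral_iff)
  also have "\<dots> = (\<integral>\<^sup>+z. ennreal (\<Sum>k\<in>elem_supp xs. elem_coord xs z k \<bullet> elem_coord xs z k) \<partial>PP)"
    by (intro nn_integral_eq_integral[symmetric] iso(2) AE_I2 sum_nonneg) auto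
  also have "\<dots> = sqN (elem_coord xs)"
    unfolding sqN_def
  proof (intro nn_integral_cong)
    fix z
    have "(\<Sum>k. sqn (elem_coord xs z k)) = (\<Sum>k\<in>elem_supp xs. sqn (elem_coord xs z k))"
      using finite_elem_supp[OF xs] elem_coord_outside[of _ xs z] by (intro suminf_finite) auto
    thus "ennreal (\<Sum>k\<in>elem_supp xs. elem_coord xs z k \<bullet> elem_coord xs z k) = (\<Sum>k. sqn (elem_coord xs z k))"
      by (simp add: sum_ennreal sqn_def power2_norm_eq_inner)
  qed
  finally show 1: "msq P (\<lambda>w. ito xs w) = sqN (elem_coord xs)" .
  show "sqN (elem_coord xs) < \<infinity>"
    unfolding 1[symmetric] using iso(1)
    by (simp add: sqn_def power2_norm_eq_inner nn_integral_eq_integral has_bochner_integral_iff)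
qed

end

section \<open>Processes with values in the Hilbert-Schmidt operators\<close>

abbreviation hs_summable :: "('w, 'u::real_inner) noise \<Rightarrow> ('u \<Rightarrow> 'h::real_normed_vector) \<Rightarrow> bool" where
  "hs_summable W \<Phi> \<equiv> (\<lambda>k. (norm (\<Phi> (U0_basis W k)))\<^sup>2) summable_on U0_idx W"

text \<open>The hypothesis matters: for a non-summable family \<open>infsum\<close> defaults to 0,
  while the \<open>ennreal\<close> series is infinite.\<close>

lemma ennreal_suminf_coord:
  assumes "hs_summable W \<Phi>"
  shows "summable (\<lambda>k. (norm (coord W \<Phi> k))\<^sup>2)"
    and "ennreal ((L20_norm W \<Phi>)\<^sup>2) = (\<Sum>k. sqn (coord W \<Phi> k))"
proof -
  let ?f = "\<lambda>k. (norm (\<Phi> (U0_basis W k)))\<^sup>2" and ?g = "\<lambda>k. (norm (coord W \<Phi> k))\<^sup>2"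
  have "(?f has_sum infsum ?f (U0_idx W)) (U0_idx W)" using assms by (rule has_sum_infsum)
  also have "?this \<longleftrightarrow> (?g has_sum infsum ?f (U0_idx W)) UNIV"
    by (rule has_sum_cong_neutral) (auto simp: coord_def)
  finally have "?g sums infsum ?f (U0_idx W)" by (rule has_sum_imp_sums)
  hence s: "summable ?g" "suminf ?g = infsum ?f (U0_idx W)" by (auto simp: sums_iff)
  show "summable ?g" by fact
  have "(L20_norm W \<Phi>)\<^sup>2 = suminf ?g"
    by (simp add: L20_norm_def s infsum_nonneg)
  thus "ennreal ((L20_norm W \<Phi>)\<^sup>2) = (\<Sum>k. sqn (coord W \<Phi> k))"
    unfolding sqn_def using s(1) by (simp add: suminf_ennreal2)
qed

lemma hs_summable_diff:
  assumes "hs_summable W \<Phi>" "hs_summable W \<Phi>'"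
  shows "hs_summable W (\<lambda>u. \<Phi> u - \<Phi>' u)"
proof (rule summable_on_comparison_test)
  show "(\<lambda>k. 2 * (norm (\<Phi> (U0_basis W k)))\<^sup>2 + 2 * (norm (\<Phi>' (U0_basis W k)))\<^sup>2) summable_on U0_idx W"
    by (intro summable_on_add summable_on_cmult_right assms)
  show "(norm (\<Phi> u - \<Phi>' u))\<^sup>2 \<le> 2 * (norm (\<Phi> u))\<^sup>2 + 2 * (norm (\<Phi>' u))\<^sup>2" for u
    using norm_add_sq_le[of "\<Phi> u" "- \<Phi>' u"] by simp
qed auto

lemma L20_summable: "\<Phi> \<in> L20 W \<Longrightarrow> hs_summable W \<Phi>"
  by (simp add: L20_def)

lemma coord_diff: "coord W (\<lambda>u. \<Phi> u - \<Phi>' u) k = coord W \<Phi> k - coord W \<Phi>' k"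
  by (simp add: coord_def)

lemma L20_norm_diff:
  assumes "\<Phi> \<in> L20 W" "\<Phi>' \<in> L20 W"
  shows "ennreal ((L20_norm W (\<lambda>u. \<Phi> u - \<Phi>' u))\<^sup>2) = (\<Sum>k. sqn (coord W \<Phi> k - coord W \<Phi>' k))"
  using ennreal_suminf_coord(2)[OF hs_summable_diff[OF assms[THEN L20_summable]]] by (simp add: coord_diff)

lemma space_L20_borel: "space (L20_borel W) = L20 W"
  by (simp add: L20_borel_def space_measure_of_conv)

lemma sets_L20_borel: "sets (L20_borel W) = sigma_sets (L20 W) {G. L20_open W G}"
  unfolding L20_borel_def by (rule sets_measure_of) (auto simp: L20_open_def)

text \<open>A coordinate is 1-Lipschitz for the Hilbert-Schmidt distance, so preimages of open sets
  are \<open>L20_open\<close>.\<close>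

lemma coord_measurable_L20:
  fixes W :: "('w, 'u::real_inner) noise"
  shows "(\<lambda>\<Phi>. coord W \<Phi> k) \<in> L20_borel W \<rightarrow>\<^sub>M (borel :: 'h::real_inner measure)"
proof (cases "k \<in> U0_idx W")
  case False
  thus ?thesis by (simp add: coord_def)
next
  case True
  show ?thesis
  proof (rule borel_measurableI)
    fix S :: "'h set" assume S: "open S"
    have "L20_open W ((\<lambda>\<Phi>. coord W \<Phi> k) -` S \<inter> L20 W)"
      unfolding L20_open_def
    proof safe
      fix \<Phi> :: "'u \<Rightarrow> 'h" assume \<Phi>: "coord W \<Phi> k \<in> S" "\<Phi> \<in> L20 W"
      obtain r where r: "r > 0" "ball (coord W \<Phi> k) r \<subseteq> S" using S \<Phi> open_contains_ball by blast
      have "coord W \<Phi>' k \<in> S" if "\<Phi>' \<in> L20 W" "L20_norm W (\<lambda>u. \<Phi>' u - \<Phi> u) < r" for \<Phi>'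
      proof -
        have "sum (\<lambda>k. sqn (coord W \<Phi>' k - coord W \<Phi> k)) {k} \<le> (\<Sum>k. sqn (coord W \<Phi>' k - coord W \<Phi> k))"
          by (intro sum_le_suminf) auto
        hence "ennreal ((norm (coord W \<Phi>' k - coord W \<Phi> k))\<^sup>2) \<le> ennreal ((L20_norm W (\<lambda>u. \<Phi>' u - \<Phi> u))\<^sup>2)"
          using L20_norm_diff[OF that(1) \<Phi>(2)] by (simp add: sqn_def)
        hence "(norm (coord W \<Phi>' k - coord W \<Phi> k))\<^sup>2 \<le> (L20_norm W (\<lambda>u. \<Phi>' u - \<Phi> u))\<^sup>2" by simp
        hence "norm (coord W \<Phi>' k - coord W \<Phi> k) \<le> L20_norm W (\<lambda>u. \<Phi>' u - \<Phi> u)"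
          by (rule power2_le_imp_le) (simp add: L20_norm_def infsum_nonneg)
        hence "coord W \<Phi>' k \<in> ball (coord W \<Phi> k) r" using that by (simp add: dist_norm norm_minus_commute)
        thus ?thesis using r by blast
      qed
      thus "\<exists>r>0. \<forall>\<Phi>'\<in>L20 W. L20_norm W (\<lambda>u. \<Phi>' u - \<Phi> u) < r \<longrightarrow> \<Phi>' \<in> (\<lambda>\<Phi>. coord W \<Phi> k) -` S \<inter> L20 W"
        using r(1) by auto
    qed
    thus "(\<lambda>\<Phi>. coord W \<Phi> k) -` S \<inter> space (L20_borel W) \<in> sets (L20_borel W)"
      unfolding sets_L20_borel space_L20_borel by (intro sigma_sets.Basic) simp
  qed
qed

text \<open>The finitely supported sequences with values in a countable dense set are dense in the
  coordinate space, which makes the topology of \<open>L20\<close> second countable.\<close>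

lemma L20_open_basis:
  fixes W :: "('w, 'u::real_inner) noise" and G :: "('u \<Rightarrow> 'h::real_inner) set"
  assumes G: "L20_open W G" and \<Phi>: "\<Phi> \<in> G"
    and D: "\<And>X. open X \<Longrightarrow> X \<noteq> {} \<Longrightarrow> \<exists>d\<in>D. d \<in> (X :: 'h set)"
  defines "cs \<equiv> \<lambda>c k. if k \<in> U0_idx W \<and> k < length c then c ! k else 0"
  obtains c n where "c \<in> lists D" "(\<Sum>k. sqn (cs c k - coord W \<Phi> k)) < ennreal (1 / real (Suc n))"
    "{\<Phi>'\<in>L20 W. (\<Sum>k. sqn (cs c k - coord W \<Phi>' k)) < ennreal (1 / real (Suc n))} \<subseteq> G"
proof -
  obtain r where r: "r > 0" "\<And>\<Phi>'. \<Phi>' \<in> L20 W \<Longrightarrow> L20_norm W (\<lambda>u. \<Phi>' u - \<Phi> u) < r \<Longrightarrow> \<Phi>' \<in> G"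
    using G \<Phi> unfolding L20_open_def by blast
  have \<Phi>L: "\<Phi> \<in> L20 W" using G \<Phi> unfolding L20_open_def by blast
  \<comment> \<open>The sum \<open>2 * q + 2 * q\<close> in the triangle estimate below must stay
    under \<open>r\<^sup>2\<close>.\<close>
  obtain n where n: "1 / real (Suc n) < r\<^sup>2 / 4"
    using reals_Archimedean[of "r\<^sup>2 / 4"] r by (auto simp: inverse_eq_divide)
  define q where "q = 1 / real (Suc n)"
  have q: "q > 0" by (simp add: q_def)
  have summ: "summable (\<lambda>k. (norm (coord W \<Phi> k))\<^sup>2)"
    by (rule ennreal_suminf_coord[OF L20_summable[OF \<Phi>L]])
  then obtain N where N: "norm (\<Sum>i. (norm (coord W \<Phi> (i + N)))\<^sup>2) < q / 2"
    using suminf_exist_split[OF _ summ, of "q / 2"] q by auto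
  \<comment> \<open>Half of \<open>q\<close> is kept for the tail beyond \<open>N\<close> and half
    for the first \<open>N\<close> coordinates; \<open>N + 1\<close> avoids a division by 0.\<close>
  define \<delta> where "\<delta> = sqrt (q / (2 * (real N + 1)))"
  have \<delta>: "\<delta> > 0" "real N * \<delta>\<^sup>2 \<le> q / 2" using q by (auto simp: \<delta>_def field_simps)
  have "\<forall>k. \<exists>d\<in>D. d \<in> ball (coord W \<Phi> k) \<delta>" using D[OF open_ball] \<delta>(1) by auto
  then obtain d where d: "\<And>k. d k \<in> D" "\<And>k. d k \<in> ball (coord W \<Phi> k) \<delta>" by metis
  define c where "c = map d [0..<N]"
  have cs: "cs c k = (if k \<in> U0_idx W \<and> k < N then d k else 0)" for k by (simp add: cs_def c_def)
  have "(\<Sum>k. sqn (cs c k - coord W \<Phi> k)) =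
      (\<Sum>k. sqn (cs c (k + N) - coord W \<Phi> (k + N))) + (\<Sum>k<N. sqn (cs c k - coord W \<Phi> k))"
    by (intro suminf_offset) auto
  also have "(\<Sum>k. sqn (cs c (k + N) - coord W \<Phi> (k + N))) = ennreal (\<Sum>i. (norm (coord W \<Phi> (i + N)))\<^sup>2)"
    using summable_ignore_initial_segment[OF summ, of N] by (simp add: cs sqn_def suminf_ennreal2)
  also have "(\<Sum>k<N. sqn (cs c k - coord W \<Phi> k)) \<le> (\<Sum>k<N. ennreal (\<delta>\<^sup>2))"
  proof (intro sum_mono)
    fix k assume "k \<in> {..<N}"
    have "norm (cs c k - coord W \<Phi> k) \<le> \<delta>"
      using d(2)[of k] \<open>k \<in> {..<N}\<close> \<delta>(1) by (auto simp: cs coord_def dist_norm norm_minus_commute)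
    thus "sqn (cs c k - coord W \<Phi> k) \<le> ennreal (\<delta>\<^sup>2)"
      unfolding sqn_def by (intro ennreal_leI power_mono) auto
  qed
  also have "(\<Sum>k<N. ennreal (\<delta>\<^sup>2)) = ennreal (real N * \<delta>\<^sup>2)" by (simp add: ennreal_mult ennreal_of_nat_eq_real_of_nat)
  also have "ennreal (\<Sum>i. (norm (coord W \<Phi> (i + N)))\<^sup>2) + ennreal (real N * \<delta>\<^sup>2) =
      ennreal ((\<Sum>i. (norm (coord W \<Phi> (i + N)))\<^sup>2) + real N * \<delta>\<^sup>2)"
    using summable_ignore_initial_segment[OF summ, of N] by (intro ennreal_plus[symmetric] suminf_nonneg) auto
  also have "\<dots> < ennreal q"
    using N \<delta> q by (intro ennreal_lessI) auto
  finally have 1: "(\<Sum>k. sqn (cs c k - coord W \<Phi> k)) < ennreal q" by (simp add: add_left_mono)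
  have 2: "\<Phi>' \<in> G" if \<Phi>': "\<Phi>' \<in> L20 W" and lt: "(\<Sum>k. sqn (cs c k - coord W \<Phi>' k)) < ennreal q" for \<Phi>'
  proof (rule r(2)[OF \<Phi>'])
    have "ennreal ((L20_norm W (\<lambda>u. \<Phi>' u - \<Phi> u))\<^sup>2) = (\<Sum>k. sqn (coord W \<Phi>' k - coord W \<Phi> k))"
      by (rule L20_norm_diff[OF \<Phi>' \<Phi>L])
    also have "\<dots> \<le> (\<Sum>k. 2 * sqn (cs c k - coord W \<Phi>' k) + 2 * sqn (cs c k - coord W \<Phi> k))"
      using sqn_triangle[of "coord W \<Phi>' _" "coord W \<Phi> _" "cs c _"] sqn_minus_commute[of "cs c _" "coord W \<Phi>' _"]
      by (intro suminf_le) auto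
    also have "\<dots> = 2 * (\<Sum>k. sqn (cs c k - coord W \<Phi>' k)) + 2 * (\<Sum>k. sqn (cs c k - coord W \<Phi> k))"
      by (simp add: suminf_add[symmetric])
    also have "\<dots> < 2 * ennreal q + 2 * ennreal q"
      using 1 lt by (intro add_strict_mono ennreal_mult_strict_left_mono) auto
    also have "\<dots> = ennreal (4 * q)" using q by (simp add: ennreal_mult flip: distrib_right)
    finally have "(L20_norm W (\<lambda>u. \<Phi>' u - \<Phi> u))\<^sup>2 < r\<^sup>2"
      using n q by (simp add: ennreal_less_iff q_def)
    thus "L20_norm W (\<lambda>u. \<Phi>' u - \<Phi> u) < r" using r(1) by (rule power2_less_imp_less[OF _ less_imp_le])
  qed
  show thesis
    by (rule that[of c n]) (use d(1) 1 2 in \<open>auto simp: c_def q_def\<close>)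
qed

text \<open>Converse of \<open>coord_measurable_L20\<close>. By \<open>L20_open_basis\<close> an
  open set is a countable union of balls contained in it, and the preimage of such a ball is
  described by a series in the coordinates.\<close>

lemma measurable_L20_borel:
  fixes W :: "('w, 'u::real_inner) noise"
    and f :: "'b \<Rightarrow> 'u \<Rightarrow> 'h::{real_inner,second_countable_topology}"
  assumes f: "\<And>x. x \<in> space M \<Longrightarrow> f x \<in> L20 W"
    and [measurable]: "\<And>k. (\<lambda>x. coord W (f x) k) \<in> borel_measurable M"
  shows "f \<in> M \<rightarrow>\<^sub>M L20_borel W"
  unfolding L20_borel_def
proof (rule measurable_measure_of)
  show "{G. L20_open W G} \<subseteq> Pow (L20 W)" by (auto simp: L20_open_def)
  show "f \<in> space M \<rightarrow> L20 W" using f by auto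
  fix G :: "('u \<Rightarrow> 'h) set" assume "G \<in> {G. L20_open W G}"
  hence G: "L20_open W G" by simp
  obtain D :: "'h set" where D: "countable D" "\<And>X. open X \<Longrightarrow> X \<noteq> {} \<Longrightarrow> \<exists>d\<in>D. d \<in> X"
    by (erule countable_dense_setE)
  \<comment> \<open>The centre of a ball is only a finitely supported sequence; it never has to be
    realised by an operator.\<close>
  define cs where "cs c k = (if k \<in> U0_idx W \<and> k < length c then c ! k else 0)" for c :: "'h list" and k
  define V where "V p = {\<Phi>'\<in>L20 W. (\<Sum>k. sqn (cs (fst p) k - coord W \<Phi>' k)) < ennreal (1 / real (Suc (snd p)))}" for p
  define J where "J = {p \<in> lists D \<times> UNIV. V p \<subseteq> G}"
  have "countable J" unfolding J_def using D(1) by (intro countable_Collect countable_SIGMA countable_lists) auto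
  have "f -` G \<inter> space M = (\<Union>p\<in>J. {x \<in> space M. (\<Sum>k. sqn (cs (fst p) k - coord W (f x) k)) < ennreal (1 / real (Suc (snd p)))})"
    (is "_ = (\<Union>p\<in>J. ?A p)")
  proof (intro equalityI subsetI)
    fix x assume "x \<in> f -` G \<inter> space M"
    hence x: "x \<in> space M" "f x \<in> G" by auto
    obtain c n where "c \<in> lists D" "(\<Sum>k. sqn (cs c k - coord W (f x) k)) < ennreal (1 / real (Suc n))"
      "{\<Phi>'\<in>L20 W. (\<Sum>k. sqn (cs c k - coord W \<Phi>' k)) < ennreal (1 / real (Suc n))} \<subseteq> G"
      by (rule L20_open_basis[OF G x(2) D(2)]) (auto simp: cs_def[abs_def])
    hence "(c, n) \<in> J" "x \<in> ?A (c, n)" using x by (auto simp: J_def V_def)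
    thus "x \<in> (\<Union>p\<in>J. ?A p)" by blast
  next
    fix x assume "x \<in> (\<Union>p\<in>J. ?A p)"
    then obtain p where "p \<in> J" "x \<in> ?A p" by blast
    hence "x \<in> space M" "f x \<in> V p" "V p \<subseteq> G" using f by (auto simp: V_def J_def)
    thus "x \<in> f -` G \<inter> space M" by auto
  qed
  also have "\<dots> \<in> sets M" using \<open>countable J\<close> by (intro sets.countable_UN') auto
  finally show "f -` G \<inter> space M \<in> sets M" .
qed

context cyl_wiener
begin

section \<open>Predictable sets and the coordinate form of processes\<close>

abbreviation pred_sigma :: "real \<Rightarrow> (real \<times> 'w) measure" where
  "pred_sigma \<equiv> predictable_sigma W"

abbreviation strip :: "real \<Rightarrow> (real \<times> 'w) set" where
  "strip r \<equiv> {0..r} \<times> space P"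

lemma space_predictable: "space (pred_sigma r) = strip r"
  by (simp add: predictable_sigma_def space_measure_of_conv)

definition pred_gen :: "real \<Rightarrow> (real \<times> 'w) set set" where
  "pred_gen r = {{s<..t} \<times> B | s t B. 0 \<le> s \<and> s < t \<and> t \<le> r \<and> B \<in> sets (filt W s)} \<union>
      {{0} \<times> B | B. B \<in> sets (filt W 0)}"

lemma pred_gen_cases [consumes 1, case_names rect zero]:
  assumes "E \<in> pred_gen r"
  obtains s t B where "E = {s<..t} \<times> B" "0 \<le> s" "s < t" "t \<le> r" "B \<in> sets (filt W s)" "B \<in> sets P"
  | B where "E = {0} \<times> B" "B \<in> sets (filt W 0)" "B \<in> sets P"
proof -
  from assms consider s t B where "E = {s<..t} \<times> B" "0 \<le> s" "s < t" "t \<le> r" "B \<in> sets (filt W s)"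
    | B where "E = {0} \<times> B" "B \<in> sets (filt W 0)"
    unfolding pred_gen_def by blast
  thus thesis
  proof cases
    case 1
    show thesis by (rule that(1)[OF 1 filt_sets[OF 1(2,5)]])
  next
    case 2
    show thesis by (rule that(2)[OF 2 filt_sets[OF order_refl 2(2)]])
  qed
qed

lemma pred_gen_Pow: 
  assumes "0 \<le> r"
  shows "pred_gen r \<subseteq> Pow (strip r)"
proof safe
  fix E and a :: real and b assume "E \<in> pred_gen r" and ab: "(a, b) \<in> E"
  thus "a \<in> {0..r}" "b \<in> space P"
    using assms by (cases rule: pred_gen_cases; auto dest: sets.sets_into_space)+
qed

lemma sets_predictable: "0 \<le> r \<Longrightarrow> sets (pred_sigma r) = sigma_sets (strip r) (pred_gen r)"
  unfolding predictable_sigma_def pred_gen_def[symmetric] by (rule sets_measure_of) (rule pred_gen_Pow)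

lemma pred_gen_PP: "E \<in> pred_gen r \<Longrightarrow> E \<in> sets PP"
  by (cases rule: pred_gen_cases) auto

lemma predictable_PP:
  assumes r: "0 \<le> r" and E: "E \<in> sets (pred_sigma r)"
  shows "E \<in> sets PP"
  using E unfolding sets_predictable[OF r]
proof induction
  case (Basic a) thus ?case by (rule pred_gen_PP)
next
  case (Compl a)
  moreover have "strip r \<in> sets PP" by auto
  ultimately show ?case by (intro sets.Diff)
qed auto

lemma predictable_subset: "E \<in> sets (pred_sigma r) \<Longrightarrow> E \<subseteq> strip r"
  using sets.sets_into_space space_predictable by blast

lemma emeasure_PP_strip: "0 \<le> r \<Longrightarrow> emeasure PP (strip r) = ennreal r"
  by (subst emeasure_pair_measure_Times) (auto simp: emeasure_space_1)

text \<open>Extension by 0 carries predictable functions, whose domain depends on the horizon, to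
  the single measure space \<open>PP\<close>; this works because predictable sets are product
  measurable.\<close>

lemma predictable_extend_measurable:
  fixes g :: "real \<times> 'w \<Rightarrow> 'h::{real_normed_vector,second_countable_topology}"
  assumes r: "0 \<le> r" and g: "g \<in> borel_measurable (pred_sigma r)"
  shows "(\<lambda>z. indicat_real {0..r} (fst z) *\<^sub>R g z) \<in> borel_measurable PP"
proof -
  let ?\<Omega> = "strip r"
  have \<Omega>: "?\<Omega> \<in> sets PP" by auto
  have sp: "space (restrict_space PP ?\<Omega>) = ?\<Omega>"
    using sets.sets_into_space[OF \<Omega>] by (simp only: space_restrict_space Int_absorb2)
  have "g \<in> borel_measurable (restrict_space PP ?\<Omega>)"
  proof (rule measurableI)
    fix A :: "'h set" assume "A \<in> sets borel"
    hence "g -` A \<inter> ?\<Omega> \<in> sets (pred_sigma r)"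
      using measurable_sets[OF g] by (simp add: space_predictable)
    from predictable_PP[OF r this]
    show "g -` A \<inter> space (restrict_space PP ?\<Omega>) \<in> sets (restrict_space PP ?\<Omega>)"
      unfolding sp using \<Omega> by (subst sets_restrict_space_iff) simp_all
  qed simp
  hence "(\<lambda>z. indicat_real ?\<Omega> z *\<^sub>R g z) \<in> borel_measurable PP"
    using \<Omega> by (subst (asm) borel_measurable_restrict_space_iff) auto
  also have "?this \<longleftrightarrow> ?thesis"
    by (rule measurable_cong) (auto simp: indicator_def space_pair_measure)
  finally show ?thesis .
qed

text \<open>Cut off at the horizon, so that processes with different horizons, and elementary ones,
  can be compared on all of \<open>PP\<close>.\<close>

definition xcoord :: "real \<Rightarrow> (real \<Rightarrow> 'w \<Rightarrow> 'u \<Rightarrow> 'h::real_vector) \<Rightarrow> real \<times> 'w \<Rightarrow> nat \<Rightarrow> 'h" where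
  "xcoord r \<Phi> z k = indicat_real {0..r} (fst z) *\<^sub>R coord W (\<Phi> (fst z) (snd z)) k"

lemma elem_coord_strip:
  assumes "elementary W r xs"
  shows "indicat_real {0..r} (fst z) *\<^sub>R elem_coord xs z k = elem_coord xs z k"
proof (cases "fst z \<in> {0..r}")
  case False
  have "elem_process xs (fst z) (snd z) u = 0" for u
    using assms
  proof (induction xs)
    case (Cons x xs)
    thus ?case using False by (cases x rule: prod_cases4) (auto simp: elementary_tuple elem_process_tuple)
  qed simp
  thus ?thesis by (simp add: coord_def)
qed simp

lemma elem_process_summable_on:
  fixes xs :: "('w, 'u, 'h::real_inner) elem"
  assumes "elementary W r xs"
  shows "hs_summable W (elem_process xs \<tau> w)"
proof -
  have "(\<lambda>k. (norm (elem_process xs \<tau> w (U0_basis W k)))\<^sup>2) summable_on (U0_idx W \<inter> elem_supp xs)"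
    using finite_elem_supp[OF assms] by (intro summable_on_finite) auto
  also have "?this \<longleftrightarrow> ?thesis"
  proof (rule summable_on_cong_neutral)
    fix k assume "k \<in> U0_idx W - U0_idx W \<inter> elem_supp xs"
    hence "k \<in> U0_idx W" "k \<notin> elem_supp xs" by auto
    thus "(norm (elem_process xs \<tau> w (U0_basis W k)))\<^sup>2 = 0"
      using elem_coord_outside[of k xs "(\<tau>, w)"] by (simp add: coord_def)
  qed auto
  finally show ?thesis .
qed

text \<open>Tonelli: the definitions integrate over time inside the expectation, \<open>sqN\<close>
  over the product; \<open>f\<close> carries the cut-off to \<open>{0..r}\<close> itself.\<close>

lemma nn_integral_strip:
  fixes f :: "real \<times> 'w \<Rightarrow> nat \<Rightarrow> 'h::{real_normed_vector,second_countable_topology}"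
  assumes [measurable]: "\<And>k. (\<lambda>z. f z k) \<in> borel_measurable PP"
    and f: "\<And>z k. z \<in> space PP \<Longrightarrow> indicat_real {0..r} (fst z) *\<^sub>R f z k = f z k"
    and g: "\<And>\<tau> w. \<tau> \<in> {0..r} \<Longrightarrow> w \<in> space P \<Longrightarrow> g \<tau> w = (\<Sum>k. sqn (f (\<tau>, w) k))"
  shows "(\<integral>\<^sup>+w. (\<integral>\<^sup>+\<tau>\<in>{0..r}. g \<tau> w \<partial>lborel) \<partial>P) = sqN f"
proof -
  have "sqN f = (\<integral>\<^sup>+w. (\<integral>\<^sup>+\<tau>. (\<Sum>k. sqn (f (\<tau>, w) k)) \<partial>lborel) \<partial>P)"
    unfolding sqN_def by (subst PP.nn_integral_snd[symmetric]) auto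
  also have "\<dots> = (\<integral>\<^sup>+w. (\<integral>\<^sup>+\<tau>\<in>{0..r}. g \<tau> w \<partial>lborel) \<partial>P)"
  proof (intro nn_integral_cong)
    fix \<tau> w assume "w \<in> space P" "\<tau> \<in> space (lborel :: real measure)"
    hence "(\<tau>, w) \<in> space PP" by (simp add: space_pair_measure)
    from f[OF this] have "f (\<tau>, w) k = 0" if "\<tau> \<notin> {0..r}" for k using that by (metis fst_conv indicator_simps(2) scaleR_zero_left)
    thus "(\<Sum>k. sqn (f (\<tau>, w) k)) = g \<tau> w * indicator {0..r} \<tau>"
      using g[OF _ \<open>w \<in> _\<close>, of \<tau>] by (cases "\<tau> \<in> {0..r}") auto
  qed
  finally show ?thesis ..
qed

text \<open>Replaces measurability for the Borel sets of \<open>L20\<close> by that of each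
  coordinate, in both directions; from here on the topology of \<open>L20\<close> stays
  hidden.\<close>

lemma N2_iff:
  fixes \<Phi> :: "real \<Rightarrow> 'w \<Rightarrow> 'u \<Rightarrow> 'h::{real_inner,second_countable_topology}"
  assumes r: "0 \<le> r"
  shows "\<Phi> \<in> N2 W r \<longleftrightarrow> (\<forall>\<tau>\<in>{0..r}. \<forall>w\<in>space P. \<Phi> \<tau> w \<in> L20 W) \<and>
    (\<forall>k. (\<lambda>z. coord W (\<Phi> (fst z) (snd z)) k) \<in> borel_measurable (pred_sigma r)) \<and>
    sqN (xcoord r \<Phi>) < \<infinity>"
proof -
  have 1: "(\<lambda>(\<tau>, w). \<Phi> \<tau> w) \<in> pred_sigma r \<rightarrow>\<^sub>M L20_borel W \<longleftrightarrow>
    (\<forall>\<tau>\<in>{0..r}. \<forall>w\<in>space P. \<Phi> \<tau> w \<in> L20 W) \<and>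
    (\<forall>k. (\<lambda>z. coord W (\<Phi> (fst z) (snd z)) k) \<in> borel_measurable (pred_sigma r))" (is "?L \<longleftrightarrow> ?R1 \<and> ?R2")
  proof safe
    assume L: ?L
    { fix \<tau> w assume "\<tau> \<in> {0..r}" "w \<in> space P"
      thus "\<Phi> \<tau> w \<in> L20 W" using measurable_space[OF L, of "(\<tau>, w)"] by (simp add: space_predictable space_L20_borel) }
    show "(\<lambda>z. coord W (\<Phi> (fst z) (snd z)) k) \<in> borel_measurable (pred_sigma r)" for k
      using measurable_compose[OF L coord_measurable_L20[of W k]] by (simp add: case_prod_beta')
  next
    assume "?R1" "?R2"
    thus ?L by (intro measurable_L20_borel) (auto simp: space_predictable case_prod_beta')
  qed
  have 2: "(\<integral>\<^sup>+w. (\<integral>\<^sup>+\<tau>\<in>{0..r}. ennreal ((L20_norm W (\<Phi> \<tau> w))\<^sup>2) \<partial>lborel) \<partial>P) = sqN (xcoord r \<Phi>)"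
    if "?R1" "?R2"
  proof (rule nn_integral_strip)
    show "(\<lambda>z. xcoord r \<Phi> z k) \<in> borel_measurable PP" for k
      unfolding xcoord_def using that(2) by (intro predictable_extend_measurable[OF r]) auto
    fix \<tau> w assume "\<tau> \<in> {0..r}" "w \<in> space P"
    thus "ennreal ((L20_norm W (\<Phi> \<tau> w))\<^sup>2) = (\<Sum>k. sqn (xcoord r \<Phi> (\<tau>, w) k))"
      using that(1) ennreal_suminf_coord(2)[of "\<Phi> \<tau> w" W] L20_summable[of "\<Phi> \<tau> w" W] by (auto simp: xcoord_def)
  qed (auto simp: xcoord_def indicator_def)
  show ?thesis unfolding N2_def using 1 2 by auto
qed

lemma
  fixes \<Phi> :: "real \<Rightarrow> 'w \<Rightarrow> 'u \<Rightarrow> 'h::{real_inner,second_countable_topology}"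
  assumes r: "0 \<le> r" and \<Phi>: "\<Phi> \<in> N2 W r"
  shows N2_L20: "\<tau> \<in> {0..r} \<Longrightarrow> w \<in> space P \<Longrightarrow> \<Phi> \<tau> w \<in> L20 W"
    and N2_sqN: "sqN (xcoord r \<Phi>) < \<infinity>"
    and N2_coord_predictable: "(\<lambda>z. coord W (\<Phi> (fst z) (snd z)) k) \<in> borel_measurable (pred_sigma r)"
    and xcoord_measurable: "(\<lambda>z. xcoord r \<Phi> z k) \<in> borel_measurable PP"
  using \<Phi> by (auto simp: N2_iff[OF r] xcoord_def intro!: predictable_extend_measurable[OF r])

lemma elem_dist_sqN:
  fixes \<Phi> :: "real \<Rightarrow> 'w \<Rightarrow> 'u \<Rightarrow> 'h::{real_inner,second_countable_topology}"
  assumes r: "0 \<le> r" and \<Phi>: "\<Phi> \<in> N2 W r" and xs: "elementary W r xs"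
  shows "(\<integral>\<^sup>+w. (\<integral>\<^sup>+\<tau>\<in>{0..r}. ennreal ((L20_norm W (\<lambda>u. elem_process xs \<tau> w u - \<Phi> \<tau> w u))\<^sup>2)
              \<partial>lborel) \<partial>P) = sqN (\<lambda>z k. elem_coord xs z k - xcoord r \<Phi> z k)"
proof (rule nn_integral_strip)
  show "(\<lambda>z. elem_coord xs z k - xcoord r \<Phi> z k) \<in> borel_measurable PP" for k
    by (intro borel_measurable_diff elem_coord_measurable[OF xs] xcoord_measurable r \<Phi>)
  show "indicat_real {0..r} (fst z) *\<^sub>R (elem_coord xs z k - xcoord r \<Phi> z k) = elem_coord xs z k - xcoord r \<Phi> z k" for z k
    unfolding scaleR_diff_right elem_coord_strip[OF xs] by (simp add: xcoord_def indicator_def)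
  fix \<tau> w assume \<tau>: "\<tau> \<in> {0..r}" and "w \<in> space P"
  hence "\<Phi> \<tau> w \<in> L20 W" by (intro N2_L20[OF r \<Phi>])
  from ennreal_suminf_coord(2)[OF hs_summable_diff[OF elem_process_summable_on[OF xs, of \<tau> w] L20_summable[OF this]]] \<tau>
  show "ennreal ((L20_norm W (\<lambda>u. elem_process xs \<tau> w u - \<Phi> \<tau> w u))\<^sup>2) =
       (\<Sum>k. sqn (elem_coord xs (\<tau>, w) k - xcoord r \<Phi> (\<tau>, w) k))"
    by (simp add: coord_diff xcoord_def)
qed

section \<open>Existence of the stochastic integral\<close>

abbreviation coord_measurable :: "(real \<times> 'w \<Rightarrow> nat \<Rightarrow> 'h::real_normed_vector) \<Rightarrow> bool" where
  "coord_measurable f \<equiv> \<forall>k. (\<lambda>z. f z k) \<in> borel_measurable PP"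

lemma sqN_triangle:
  fixes f g h :: "real \<times> 'w \<Rightarrow> nat \<Rightarrow> 'h::{real_normed_vector,second_countable_topology}"
  assumes "coord_measurable f" "coord_measurable g" "coord_measurable h"
  shows "sqN (\<lambda>z k. f z k - h z k) \<le> 2 * sqN (\<lambda>z k. f z k - g z k) + 2 * sqN (\<lambda>z k. g z k - h z k)"
proof -
  have [measurable]: "(\<lambda>z. f z k) \<in> borel_measurable PP" "(\<lambda>z. g z k) \<in> borel_measurable PP"
    "(\<lambda>z. h z k) \<in> borel_measurable PP" for k using assms by auto
  have "sqN (\<lambda>z k. f z k - h z k) \<le> (\<integral>\<^sup>+z. 2 * (\<Sum>k. sqn (f z k - g z k)) + 2 * (\<Sum>k. sqn (g z k - h z k)) \<partial>PP)"
    unfolding sqN_def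
  proof (intro nn_integral_mono)
    fix z
    have "(\<Sum>k. sqn (f z k - h z k)) \<le> (\<Sum>k. 2 * sqn (f z k - g z k) + 2 * sqn (g z k - h z k))"
      by (intro suminf_le sqn_triangle) auto
    also have "\<dots> = 2 * (\<Sum>k. sqn (f z k - g z k)) + 2 * (\<Sum>k. sqn (g z k - h z k))"
      by (simp add: suminf_add[symmetric])
    finally show "(\<Sum>k. sqn (f z k - h z k)) \<le> 2 * (\<Sum>k. sqn (f z k - g z k)) + 2 * (\<Sum>k. sqn (g z k - h z k))" .
  qed
  also have "\<dots> = 2 * sqN (\<lambda>z k. f z k - g z k) + 2 * sqN (\<lambda>z k. g z k - h z k)"
    unfolding sqN_def by (simp add: nn_integral_add nn_integral_cmult)
  finally show ?thesis .
qed

lemma sqN_minus_commute: "sqN (\<lambda>z k. f z k - g z k) = sqN (\<lambda>z k. g z k - f z k)"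
  unfolding sqN_def by (simp only: sqn_minus_commute)

text \<open>Membership in the \<open>sqN\<close>-closure of the elementary processes, stated for
  arbitrary coordinate sequences so that one coordinate can be treated at a time.\<close>

definition approximable :: "real \<Rightarrow> (real \<times> 'w \<Rightarrow> nat \<Rightarrow> 'h::real_inner) \<Rightarrow> bool" where
  "approximable r f \<longleftrightarrow> coord_measurable f \<and>
     (\<forall>e>0. \<exists>xs. elementary W r xs \<and> sqN (\<lambda>z k. elem_coord xs z k - f z k) < e)"

lemma approximable_closed:
  fixes f :: "real \<times> 'w \<Rightarrow> nat \<Rightarrow> 'h::{real_inner,second_countable_topology}"
  assumes f: "coord_measurable f" and lim: "\<And>e. 0 < e \<Longrightarrow> \<exists>g. approximable r g \<and> sqN (\<lambda>z k. g z k - f z k) < e"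
  shows "approximable r f"
  unfolding approximable_def
proof (intro conjI allI impI f)
  fix k show "(\<lambda>z. f z k) \<in> borel_measurable PP" using f by simp
next
  fix e :: ennreal assume "0 < e"
  from ennreal_split4[OF this]
  obtain d where d: "0 < d" "\<And>a b. a < d \<Longrightarrow> b < d \<Longrightarrow> 2 * a + 2 * b < e" by blast
  obtain g where g: "approximable r g" "sqN (\<lambda>z k. g z k - f z k) < d" using lim[OF d(1)] by blast
  then obtain xs where xs: "elementary W r xs" "sqN (\<lambda>z k. elem_coord xs z k - g z k) < d"
    using d(1) unfolding approximable_def by blast
  have "sqN (\<lambda>z k. elem_coord xs z k - f z k) \<le> 2 * sqN (\<lambda>z k. elem_coord xs z k - g z k) + 2 * sqN (\<lambda>z k. g z k - f z k)"
    using elem_coord_measurable[OF xs(1)] g(1) f by (intro sqN_triangle) (auto simp: approximable_def)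
  also have "\<dots> < e" by (intro d xs g)
  finally show "\<exists>xs. elementary W r xs \<and> sqN (\<lambda>z k. elem_coord xs z k - f z k) < e" using xs(1) by blast
qed

lemma approximable_tendsto:
  fixes f :: "real \<times> 'w \<Rightarrow> nat \<Rightarrow> 'h::{real_inner,second_countable_topology}"
  assumes "coord_measurable f" "\<And>n. approximable r (g n)"
    and "(\<lambda>n. sqN (\<lambda>z k. g n z k - f z k)) \<longlonglongrightarrow> 0"
  shows "approximable r f"
proof (rule approximable_closed[OF assms(1)])
  fix e :: ennreal assume "0 < e"
  with assms(3) have "\<forall>\<^sub>F n in sequentially. sqN (\<lambda>z k. g n z k - f z k) < e" by (rule order_tendstoD)
  then obtain n where "sqN (\<lambda>z k. g n z k - f z k) < e" by (auto simp: eventually_sequentially)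
  thus "\<exists>g. approximable r g \<and> sqN (\<lambda>z k. g z k - f z k) < e" using assms(2) by blast
qed

lemma approximable_elem:
  fixes xs :: "('w, 'u, 'h::{real_inner,second_countable_topology}) elem"
  assumes "elementary W r xs"
  shows "approximable r (elem_coord xs)"
  unfolding approximable_def
proof (intro conjI allI impI)
  fix k show "(\<lambda>z. elem_coord xs z k) \<in> borel_measurable PP" by (rule elem_coord_measurable[OF assms])
next
  fix e :: ennreal assume "0 < e"
  thus "\<exists>ys. elementary W r ys \<and> sqN (\<lambda>z k. elem_coord ys z k - elem_coord xs z k) < e"
    using assms by (intro exI[of _ xs]) (simp add: sqN_def)
qed

lemma elem_coord_append: "elem_coord (xs @ ys) z k = elem_coord xs z k + elem_coord ys z k"
  by (simp add: coord_def elem_process_append)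

lemma elem_coord_diff: "elem_coord (elem_diff xs ys) z k = elem_coord xs z k - elem_coord ys z k"
  by (simp add: coord_def elem_process_elem_diff)

lemma approximable_add:
  fixes f g :: "real \<times> 'w \<Rightarrow> nat \<Rightarrow> 'h::{real_inner,second_countable_topology}"
  assumes f: "approximable r f" and g: "approximable r g"
  shows "approximable r (\<lambda>z k. f z k + g z k)"
  unfolding approximable_def
proof (intro conjI allI impI)
  have mf: "coord_measurable f" and mg: "coord_measurable g" using f g by (simp_all add: approximable_def)
  show "(\<lambda>z. f z k + g z k) \<in> borel_measurable PP" for k using mf mg by (intro borel_measurable_add) auto
  fix e :: ennreal assume "0 < e"
  from ennreal_split4[OF this]
  obtain d where d: "0 < d" "\<And>a b. a < d \<Longrightarrow> b < d \<Longrightarrow> 2 * a + 2 * b < e" by blast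
  obtain xs ys where xs: "elementary W r xs" "sqN (\<lambda>z k. elem_coord xs z k - f z k) < d"
    and ys: "elementary W r ys" "sqN (\<lambda>z k. elem_coord ys z k - g z k) < d"
    using f g d(1) unfolding approximable_def by blast
  have "sqN (\<lambda>z k. elem_coord (xs @ ys) z k - (f z k + g z k)) =
     sqN (\<lambda>z k. (elem_coord xs z k - f z k) - (g z k - elem_coord ys z k))"
    by (simp add: elem_coord_append algebra_simps)
  also have "\<dots> \<le> 2 * sqN (\<lambda>z k. (elem_coord xs z k - f z k) - 0) + 2 * sqN (\<lambda>z k. 0 - (g z k - elem_coord ys z k))"
    using elem_coord_measurable[OF xs(1)] elem_coord_measurable[OF ys(1)] mf mg by (intro sqN_triangle) (auto intro!: borel_measurable_diff)
  also have "\<dots> < e" using d(2)[OF xs(2) ys(2)] by simp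
  finally show "\<exists>xs. elementary W r xs \<and> sqN (\<lambda>z k. elem_coord xs z k - (f z k + g z k)) < e"
    using xs ys elementary_append by blast
qed

lemma elem_coord_Nil [simp]: "elem_coord [] z k = 0"
  by (simp add: coord_def)

lemma approximable_0: "approximable r (\<lambda>z k. 0 :: 'h::{real_inner,second_countable_topology})"
  using approximable_elem[of r "[] :: ('w, 'u, 'h) elem"] by simp

lemma approximable_sum:
  fixes f :: "'i \<Rightarrow> real \<times> 'w \<Rightarrow> nat \<Rightarrow> 'h::{real_inner,second_countable_topology}"
  assumes "finite I" "\<And>i. i \<in> I \<Longrightarrow> approximable r (f i)"
  shows "approximable r (\<lambda>z k. \<Sum>i\<in>I. f i z k)"
  using assms by (induction rule: finite_induct) (simp_all add: approximable_0 approximable_add)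

lemma approximable_null:
  fixes f g :: "real \<times> 'w \<Rightarrow> nat \<Rightarrow> 'h::{real_inner,second_countable_topology}"
  assumes "coord_measurable f" "approximable r g" "sqN (\<lambda>z k. g z k - f z k) = 0"
  shows "approximable r f"
  by (rule approximable_closed) (use assms in auto)

section \<open>Density of the elementary processes, one coordinate at a time\<close>

definition single :: "nat \<Rightarrow> 'h \<Rightarrow> (real \<times> 'w) set \<Rightarrow> real \<times> 'w \<Rightarrow> nat \<Rightarrow> 'h::real_vector" where
  "single k h E z j = (if j = k then indicat_real E z *\<^sub>R h else 0)"

lemma single_measurable:
  "E \<in> sets PP \<Longrightarrow> coord_measurable (single k (h :: 'h::{real_inner,second_countable_topology}) E)"
  by (auto simp: single_def)

lemma sqN_single_coordinate:
  fixes g :: "real \<times> 'w \<Rightarrow> 'h::real_normed_vector"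
  shows "sqN (\<lambda>z j. if j = k then g z else 0) = msq PP g"
  unfolding sqN_def
proof (intro nn_integral_cong)
  fix z
  have "(\<Sum>j. sqn (if j = k then g z else 0)) = (\<Sum>j\<in>{k}. sqn (if j = k then g z else 0))"
    by (intro suminf_finite) auto
  thus "(\<Sum>j. sqn (if j = k then g z else 0)) = sqn (g z)" by simp
qed

lemma sqN_single:
  assumes "E \<in> sets PP"
  shows "sqN (single k (h :: 'h::real_inner) E) = sqn h * emeasure PP E"
proof -
  have "sqN (single k h E) = (\<integral>\<^sup>+z. sqn h * indicator E z \<partial>PP)"
    unfolding single_def[abs_def] sqN_single_coordinate by (intro nn_integral_cong) (simp add: sqn_indicator mult.commute)
  also have "\<dots> = sqn h * emeasure PP E" using assms by (simp add: nn_integral_cmult_indicator)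
  finally show ?thesis .
qed

lemma approximable_rectangle:
  fixes h :: "'h::{real_inner,second_countable_topology}"
  assumes k: "k \<in> U0_idx W" and st: "0 \<le> s" "s < t" "t \<le> r" and B: "B \<in> sets (filt W s)"
  shows "approximable r (single k h ({s<..t} \<times> B))"
proof -
  define c where "c = sqrt (eval W k)"
  have c: "c > 0" and kI: "k \<in> idx W" using k by (auto simp: c_def U0_idx_def)
  \<comment> \<open>A rank-one operator along \<open>evec W k\<close>; division by \<open>c\<close>
    compensates the factor \<open>sqrt (eval W k)\<close> of \<open>U0_basis\<close>.\<close>
  define L where "L = Blinfun (\<lambda>u. (u \<bullet> evec W k) *\<^sub>R ((1 / c) *\<^sub>R h))"
  have L: "blinfun_apply L u = (u \<bullet> evec W k) *\<^sub>R ((1 / c) *\<^sub>R h)" for u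
    unfolding L_def by (subst bounded_linear_Blinfun_apply)
      (intro bounded_linear_scaleR_const bounded_linear_inner_left, rule refl)
  have Le: "L (evec W j) = (if j = k then (1 / c) *\<^sub>R h else 0)" if "j \<in> idx W" for j
    using evec_inner[OF that kI] by (simp add: L)
  have "{j \<in> idx W. L (evec W j) \<noteq> 0} \<subseteq> {k}" using Le by (auto split: if_splits)
  hence el: "elementary W r [(s, t, B, L)]" using st B finite_subset by (auto simp: elementary_tuple)
  have "elem_coord [(s, t, B, L)] z j = single k h ({s<..t} \<times> B) z j" for z j
  proof (cases "j \<in> idx W")
    case True
    thus ?thesis using Le[OF True] c by (auto simp: elem_coord_eq elem_process_tuple single_def c_def indicator_def mem_Times_iff)
  next
    case False
    thus ?thesis using kI by (auto simp: coord_def U0_idx_def single_def)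
  qed
  hence "elem_coord [(s, t, B, L)] = single k h ({s<..t} \<times> B)" by blast
  thus ?thesis using approximable_elem[OF el] by simp
qed

lemma emeasure_PP_slice: "B \<in> sets P \<Longrightarrow> emeasure PP ({0::real} \<times> B) = 0"
  by (subst emeasure_pair_measure_Times) auto

lemma approximable_gen:
  fixes h :: "'h::{real_inner,second_countable_topology}"
  assumes k: "k \<in> U0_idx W" and E: "E \<in> pred_gen r"
  shows "approximable r (single k h E)"
  using E
proof (cases rule: pred_gen_cases)
  case (rect s t B)
  thus ?thesis using approximable_rectangle[OF k] by blast
next
  case (zero B)
  \<comment> \<open>Sets at time 0 are \<open>PP\<close>-null, so the zero process already
    approximates.\<close>
  have "sqN (\<lambda>z j. 0 - single k h E z j) = sqN (single k h E)" unfolding sqN_def by simp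
  also have "\<dots> = 0" using zero by (simp add: sqN_single emeasure_PP_slice)
  finally show ?thesis
    by (intro approximable_null[OF single_measurable approximable_0] pred_gen_PP[OF E])
qed

lemma sets_filt_space: "0 \<le> t \<Longrightarrow> space P \<in> sets (filt W t)"
  using sets.top[of "filt W t"] filt_subalgebra[of t] by (metis subalgebra_def)

text \<open>For positive \<open>r\<close> the strip is not a generator, yet complements are taken in
  it; it is the union of one generator at time 0 and one after it.\<close>

lemma approximable_strip:
  fixes h :: "'h::{real_inner,second_countable_topology}"
  assumes k: "k \<in> U0_idx W" and r: "0 \<le> r"
  shows "approximable r (single k h (strip r))"
proof -
  let ?\<Omega> = "space P"
  have 1: "approximable r (single k h ({0<..r} \<times> ?\<Omega>))"
  proof (cases "r = 0")
    case True
    thus ?thesis using approximable_0 by (simp add: single_def[abs_def] cong: if_cong)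
  next
    case False
    thus ?thesis using r by (intro approximable_gen[OF k]) (auto simp: pred_gen_def intro!: exI sets_filt_space)
  qed
  have 2: "approximable r (single k h ({0} \<times> ?\<Omega>))"
    by (intro approximable_gen[OF k]) (auto simp: pred_gen_def intro!: exI sets_filt_space)
  have "single k h ({0..r} \<times> ?\<Omega>) = (\<lambda>z j. single k h ({0<..r} \<times> ?\<Omega>) z j + single k h ({0} \<times> ?\<Omega>) z j)"
    using r by (auto simp: single_def fun_eq_iff indicator_def)
  thus ?thesis using approximable_add[OF 1 2] by simp
qed

text \<open>Intersecting two rectangles moves the left end to the later one, where both events are
  known. Stability is what the Dynkin induction on predictable sets requires.\<close>

lemma Int_stable_pred_gen: "Int_stable (pred_gen r)"
proof (rule Int_stableI)
  fix E E' assume E: "E \<in> pred_gen r" and E': "E' \<in> pred_gen r"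
  have empty: "{} \<in> pred_gen r" unfolding pred_gen_def by auto
  show "E \<inter> E' \<in> pred_gen r"
    using E
  proof (cases rule: pred_gen_cases)
    case (rect s t B)
    note 1 = this
    show ?thesis
      using E'
    proof (cases rule: pred_gen_cases)
      case (rect s' t' B')
      have eq: "E \<inter> E' = {max s s'<..min t t'} \<times> (B \<inter> B')" using 1 rect by auto
      show ?thesis
      proof (cases "max s s' < min t t'")
        case True
        have "B \<inter> B' \<in> sets (filt W (max s s'))"
          using filt_mono[of s "max s s'" B] filt_mono[of s' "max s s'" B'] 1 rect by auto
        hence "\<exists>a b C. E \<inter> E' = {a<..b} \<times> C \<and> 0 \<le> a \<and> a < b \<and> b \<le> r \<and> C \<in> sets (filt W a)"
          using eq True 1 rect by (intro exI[of _ "max s s'"] exI[of _ "min t t'"] exI[of _ "B \<inter> B'"]) auto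
        thus ?thesis unfolding pred_gen_def by blast
      next
        case False
        hence "E \<inter> E' = {}" using eq by auto
        thus ?thesis using empty by simp
      qed
    next
      case (zero B')
      hence "E \<inter> E' = {}" using 1 by auto
      thus ?thesis using empty by simp
    qed
  next
    case (zero B)
    note 1 = this
    show ?thesis
      using E'
    proof (cases rule: pred_gen_cases)
      case (rect s' t' B')
      hence "E \<inter> E' = {}" using 1 by auto
      thus ?thesis using empty by simp
    next
      case (zero B')
      hence "E \<inter> E' = {0} \<times> (B \<inter> B')" "B \<inter> B' \<in> sets (filt W 0)" using 1 by auto
      thus ?thesis unfolding pred_gen_def by blast
    qed
  qed
qed

lemma approximable_predictable_set:
  fixes h :: "'h::{real_inner,second_countable_topology}"
  assumes k: "k \<in> U0_idx W" and r: "0 \<le> r" and E: "E \<in> sets (pred_sigma r)"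
  shows "approximable r (single k h E)"
  using E unfolding sets_predictable[OF r]
\<comment> \<open>\<open>h\<close> is generalised because the complement step uses the induction
  hypothesis for \<open>- h\<close>.\<close>
proof (induction arbitrary: h rule: sigma_sets_induct_disjoint[OF Int_stable_pred_gen pred_gen_Pow[OF r], consumes 1,
      case_names basic empty compl union])
  case (basic A)
  thus ?case by (intro approximable_gen[OF k])
next
  case empty
  show ?case using approximable_0 by (simp add: single_def[abs_def] cong: if_cong)
next
  case (compl A)
  have "A \<subseteq> strip r"
    using compl(1) predictable_subset[of A r] by (simp add: sets_predictable[OF r])
  hence "single k h (strip r - A) =
      (\<lambda>z j. single k h (strip r) z j + single k (- h) A z j)"
    by (auto simp: single_def fun_eq_iff indicator_def)
  thus ?case using approximable_add[OF approximable_strip[OF k r] compl(2)] by simp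
next
  case (union A)
  have AP: "A i \<in> sets PP" for i using union(2) predictable_PP[OF r] by (auto simp: sets_predictable[OF r])
  have sub: "(\<Union>i. A i) \<subseteq> strip r"
    using union(2) predictable_subset[of "A _" r] by (auto simp: sets_predictable[OF r])
  define R where "R n = (\<Union>i. A i) - (\<Union>i<n. A i)" for n
  have RP: "R n \<in> sets PP" for n using AP by (auto simp: R_def)
  have "single k h (\<Union>i<n. A i) = (\<lambda>z j. \<Sum>i<n. single k h (A i) z j)" for n
  proof (intro ext)
    fix z j
    have "indicat_real (\<Union>i<n. A i) z = (\<Sum>i<n. indicat_real (A i) z)"
      by (rule indicator_UN_disjoint) (use union(1) in \<open>auto simp: disjoint_family_on_def\<close>)
    thus "single k h (\<Union>i<n. A i) z j = (\<Sum>i<n. single k h (A i) z j)"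
      by (simp add: single_def scaleR_sum_left)
  qed
  hence ap: "approximable r (single k h (\<Union>i<n. A i))" for n
    using union(3) by (simp add: approximable_sum)
  have "sqN (\<lambda>z j. single k h (\<Union>i<n. A i) z j - single k h (\<Union>i. A i) z j) = sqn h * emeasure PP (R n)" for n
  proof -
    have "sqN (\<lambda>z j. single k h (\<Union>i<n. A i) z j - single k h (\<Union>i. A i) z j) = sqN (single k (- h) (R n))"
      by (intro arg_cong[where f=sqN] ext) (auto simp: single_def R_def indicator_def)
    thus ?thesis by (simp add: sqN_single[OF RP])
  qed
  \<comment> \<open>Continuity from above needs finite measure; all \<open>R n\<close> lie in the
    strip, whose measure is \<open>r\<close>.\<close>
  moreover have "(\<lambda>n. sqn h * emeasure PP (R n)) \<longlonglongrightarrow> sqn h * emeasure PP (\<Inter>n. R n)"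
  proof (intro ennreal_tendsto_cmult Lim_emeasure_decseq)
    show "emeasure PP (R n) \<noteq> \<infinity>" for n
    proof -
      have "emeasure PP (R n) \<le> emeasure PP (strip r)"
        using sub by (intro emeasure_mono) (auto simp: R_def)
      also have "\<dots> = ennreal r" by (rule emeasure_PP_strip[OF r])
      finally show ?thesis by (auto simp: top_unique)
    qed
  qed (use RP in \<open>auto simp: decseq_def R_def sqn_def\<close>)
  moreover have "(\<Inter>n. R n) = {}" by (auto simp: R_def)
  ultimately have "(\<lambda>n. sqN (\<lambda>z j. single k h (\<Union>i<n. A i) z j - single k h (\<Union>i. A i) z j)) \<longlonglongrightarrow> 0" by simp
  thus ?case using AP by (intro approximable_tendsto[OF single_measurable ap]) auto
qed

text \<open>Simple functions for the predictable sigma-algebra are finite sums of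
  \<open>single\<close> terms over their level sets, and \<open>L2_simple_approx\<close> makes them
  dense on the strip.\<close>

lemma approximable_predictable_fun:
  fixes g :: "real \<times> 'w \<Rightarrow> 'h::{real_inner,banach,second_countable_topology}"
  assumes k: "k \<in> U0_idx W" and r: "0 \<le> r" and g: "g \<in> borel_measurable (pred_sigma r)"
    and fin: "msq PP (\<lambda>z. indicat_real {0..r} (fst z) *\<^sub>R g z) < \<infinity>"
  shows "approximable r (\<lambda>z j. if j = k then indicat_real {0..r} (fst z) *\<^sub>R g z else 0)"
proof -
  let ?g = "\<lambda>z j. if j = k then indicat_real {0..r} (fst z) *\<^sub>R g z else 0"
  let ?\<Omega> = "strip r"
  let ?M = "restrict_space PP ?\<Omega>"
  have \<Omega>: "?\<Omega> \<in> sets PP" by auto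
  have strip: "msq ?M f = msq PP (\<lambda>z. indicat_real {0..r} (fst z) *\<^sub>R f z)" for f :: "real \<times> 'w \<Rightarrow> 'h"
  proof -
    have "msq ?M f = (\<integral>\<^sup>+z. sqn (f z) * indicator ?\<Omega> z \<partial>PP)"
      using \<Omega> by (intro nn_integral_restrict_space) auto
    also have "\<dots> = msq PP (\<lambda>z. indicat_real {0..r} (fst z) *\<^sub>R f z)"
      by (intro nn_integral_cong) (auto simp: indicator_def space_pair_measure)
    finally show ?thesis .
  qed
  have sp: "space (pred_sigma r) = space ?M"
    using sets.sets_into_space[OF \<Omega>] by (simp only: space_restrict_space Int_absorb2 space_predictable)
  have se: "sets (pred_sigma r) \<subseteq> sets ?M"
  proof
    fix E assume "E \<in> sets (pred_sigma r)"
    thus "E \<in> sets ?M" using predictable_PP[OF r] predictable_subset \<Omega>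
      by (subst sets_restrict_space_iff) auto
  qed
  obtain F where F: "\<And>i. simple_function (pred_sigma r) (F i)" "(\<lambda>i. \<integral>\<^sup>+z. sqn (g z - F i z) \<partial>?M) \<longlonglongrightarrow> 0"
    by (rule L2_simple_approx[OF g sp se]) (use fin strip in auto)
  have ap: "approximable r (\<lambda>z j. if j = k then indicat_real {0..r} (fst z) *\<^sub>R F i z else 0)" (is "approximable r (?f i)") for i
  proof -
    define E where "E y = F i -` {y} \<inter> ?\<Omega>" for y
    have fin: "finite (F i ` ?\<Omega>)" and E: "\<And>y. y \<in> F i ` ?\<Omega> \<Longrightarrow> E y \<in> sets (pred_sigma r)"
      using F(1)[of i] by (auto simp: simple_function_def E_def space_predictable)
    have EP: "y \<in> F i ` ?\<Omega> \<Longrightarrow> E y \<in> sets PP" for y using E predictable_PP[OF r] by blast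
    define G where "G = (\<lambda>z j. \<Sum>y\<in>F i ` ?\<Omega>. single k y (E y) z j)"
    have G: "approximable r G"
      unfolding G_def by (intro approximable_sum fin approximable_predictable_set[OF k r] E)
    \<comment> \<open>Only on \<open>space PP\<close>: a point with time in \<open>{0..r}\<close>
      but \<open>snd z\<close> outside \<open>space P\<close> is not in the strip, while
      \<open>?f\<close> need not vanish there.\<close>
    have eq: "G z j = ?f i z j" if "z \<in> space PP" for z j
    proof (cases "z \<in> ?\<Omega>")
      case True
      have "(\<Sum>y\<in>F i ` ?\<Omega>. indicat_real (E y) z *\<^sub>R y) = (\<Sum>y\<in>F i ` ?\<Omega>. if y = F i z then y else 0)"
        using True by (intro sum.cong refl) (auto simp: E_def indicator_def)
      also have "\<dots> = F i z" using fin True by (simp add: sum.delta')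
      finally show ?thesis using True by (auto simp: G_def single_def)
    next
      case False
      hence "fst z \<notin> {0..r}" using that by (cases z) (auto simp: space_pair_measure)
      thus ?thesis using False by (auto simp: G_def single_def E_def intro!: sum.neutral)
    qed
    show ?thesis
    proof (rule approximable_null[OF _ G])
      have "(\<lambda>z. G z j) \<in> borel_measurable PP" for j using G by (simp add: approximable_def)
      also have "(\<lambda>z. G z j) \<in> borel_measurable PP \<longleftrightarrow> (\<lambda>z. ?f i z j) \<in> borel_measurable PP" for j
        by (intro measurable_cong eq)
      finally show "coord_measurable (?f i)" by blast
      have "sqN (\<lambda>z j. G z j - ?f i z j) = sqN (\<lambda>z j. 0 :: 'h)"
        unfolding sqN_def by (intro nn_integral_cong) (simp add: eq)
      thus "sqN (\<lambda>z j. G z j - ?f i z j) = 0" by (simp add: sqN_def)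
    qed
  qed
  have dist: "sqN (\<lambda>z j. ?f i z j - ?g z j) = msq ?M (\<lambda>z. g z - F i z)" for i
  proof -
    have "sqN (\<lambda>z j. ?f i z j - ?g z j) =
       sqN (\<lambda>z j. if j = k then indicat_real {0..r} (fst z) *\<^sub>R (F i z - g z) else 0)"
      by (intro arg_cong[where f=sqN] ext) (auto simp: scaleR_diff_right)
    also have "\<dots> = msq ?M (\<lambda>z. F i z - g z)" by (simp add: sqN_single_coordinate strip)
    finally show ?thesis by (simp add: sqn_minus_commute)
  qed
  have meas: "coord_measurable ?g"
    using predictable_extend_measurable[OF r g] by auto
  show ?thesis by (rule approximable_tendsto[where g="?f", OF meas ap]) (simp only: dist F(2))
qed

lemma sqN_suminf:
  fixes f :: "real \<times> 'w \<Rightarrow> nat \<Rightarrow> 'h::{real_normed_vector,second_countable_topology}"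
  assumes "coord_measurable f"
  shows "sqN f = (\<Sum>k. \<integral>\<^sup>+z. sqn (f z k) \<partial>PP)"
proof -
  have [measurable]: "(\<lambda>z. f z k) \<in> borel_measurable PP" for k using assms by simp
  show ?thesis unfolding sqN_def by (intro nn_integral_suminf) measurable
qed

lemma coordinate_le_sqN:
  fixes f :: "real \<times> 'w \<Rightarrow> nat \<Rightarrow> 'h::{real_normed_vector,second_countable_topology}"
  shows "msq PP (\<lambda>z. f z k) \<le> sqN f"
  unfolding sqN_def
proof (intro nn_integral_mono)
  fix z show "sqn (f z k) \<le> (\<Sum>k. sqn (f z k))"
    using sum_le_suminf[of "\<lambda>k. sqn (f z k)" "{k}"] by simp
qed

text \<open>Each coordinate is approximable alone; finitely many are added, and the remaining error
  is the tail of the convergent series for \<open>sqN\<close>.\<close>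

lemma approximable_N2:
  fixes \<Phi> :: "real \<Rightarrow> 'w \<Rightarrow> 'u \<Rightarrow> 'h::{real_inner,banach,second_countable_topology}"
  assumes r: "0 \<le> r" and \<Phi>: "\<Phi> \<in> N2 W r"
  shows "approximable r (xcoord r \<Phi>)"
proof -
  let ?f = "xcoord r \<Phi>"
  have mf: "coord_measurable ?f" using xcoord_measurable[OF r \<Phi>] by simp
  have 1: "approximable r (\<lambda>z j. if j = k then ?f z k else 0)" for k
  proof (cases "k \<in> U0_idx W")
    case True
    have "msq PP (\<lambda>z. ?f z k) < \<infinity>" using coordinate_le_sqN[of ?f k] N2_sqN[OF r \<Phi>] by (rule order.strict_trans1)
    thus ?thesis unfolding xcoord_def
      by (intro approximable_predictable_fun[OF True r N2_coord_predictable[OF r \<Phi>]])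
  next
    case False
    hence "(\<lambda>z j. if j = k then ?f z k else 0) = (\<lambda>z j. 0)" by (auto simp: xcoord_def coord_def fun_eq_iff)
    thus ?thesis using approximable_0 by simp
  qed
  define g where "g n z j = (\<Sum>k<n. if j = k then ?f z k else 0)" for n :: nat and z j
  have g: "g n z j = (if j < n then ?f z j else 0)" for n z j by (simp add: g_def)
  have "approximable r (g n)" for n
    unfolding g_def[abs_def] by (intro approximable_sum 1) auto
  moreover have "(\<lambda>n. sqN (\<lambda>z j. g n z j - ?f z j)) \<longlonglongrightarrow> 0"
  proof -
    define a where "a k = msq PP (\<lambda>z. ?f z k)" for k
    have af: "(\<Sum>k. a k) < \<infinity>" using sqN_suminf[OF mf] N2_sqN[OF r \<Phi>] by (simp add: a_def)
    have tail: "sqN (\<lambda>z j. g n z j - ?f z j) = (\<Sum>k. a (k + n))" for n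
    proof -
      have "sqN (\<lambda>z j. g n z j - ?f z j) = (\<Sum>k. \<integral>\<^sup>+z. sqn (g n z k - ?f z k) \<partial>PP)"
      proof (intro sqN_suminf allI)
        fix k
        have "(\<lambda>z. g n z k) \<in> borel_measurable PP" using mf by (cases "k < n") (auto simp: g)
        thus "(\<lambda>z. g n z k - ?f z k) \<in> borel_measurable PP" using mf by (intro borel_measurable_diff) auto
      qed
      also have "\<dots> = (\<Sum>k. \<integral>\<^sup>+z. sqn (g n z (k + n) - ?f z (k + n)) \<partial>PP) + (\<Sum>k<n. \<integral>\<^sup>+z. sqn (g n z k - ?f z k) \<partial>PP)"
        by (intro suminf_offset) auto
      also have "\<dots> = (\<Sum>k. a (k + n))" by (simp add: g a_def)
      finally show ?thesis .
    qed
    obtain b where b: "\<And>k. a k = ennreal (b k)" "\<And>k. 0 \<le> b k"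
    proof -
      have "a k < \<infinity>" for k using sum_le_suminf[of a "{k}"] af by (auto simp: less_top intro: order.strict_trans1)
      thus thesis by (intro that[of "\<lambda>k. enn2real (a k)"]) (auto simp: less_top)
    qed
    have sb: "summable b" using af b by (intro summable_suminf_not_top) auto
    have "(\<Sum>k. a (k + n)) = ennreal (\<Sum>k. b (k + n))" for n
      using b summable_ignore_initial_segment[OF sb, of n] by (simp add: suminf_ennreal2)
    moreover have "(\<lambda>n. ennreal (\<Sum>k. b (k + n))) \<longlonglongrightarrow> ennreal 0"
      by (intro tendsto_ennrealI suminf_exist_split2 sb)
    ultimately show ?thesis by (simp add: tail)
  qed
  ultimately show ?thesis by (rule approximable_tendsto[OF mf])
qed

theorem stoch_int_exists:
  fixes \<Phi> :: "real \<Rightarrow> 'w \<Rightarrow> 'u \<Rightarrow> 'h::{real_inner,banach,second_countable_topology}"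
  assumes r: "0 \<le> r" and \<Phi>: "\<Phi> \<in> N2 W r"
  shows "is_stoch_int W r \<Phi> (stoch_int W r \<Phi>)"
proof -
  let ?f = "xcoord r \<Phi>"
  have mf: "coord_measurable ?f" using xcoord_measurable[OF r \<Phi>] by simp
  \<comment> \<open>The rate \<open>1 / 4 ^ n\<close> is the one that \<open>L2_complete\<close>
    expects; two such errors, each weighted by 2, give its constant 4.\<close>
  have "\<forall>n::nat. \<exists>xs. elementary W r xs \<and> sqN (\<lambda>z k. elem_coord xs z k - ?f z k) < ennreal (1 / 4 ^ n)"
    using approximable_N2[OF r \<Phi>] unfolding approximable_def by simp
  from choice[OF this] obtain xs where xs: "\<And>n. elementary W r (xs n)"
    "\<And>n. sqN (\<lambda>z k. elem_coord (xs n) z k - ?f z k) < ennreal (1 / 4 ^ n)" by blast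
  have "msq P (\<lambda>w. ito (xs m) w - ito (xs n) w) \<le> ennreal (4 / 4 ^ m)" if "m \<le> n" for m n
  proof -
    have "msq P (\<lambda>w. ito (xs m) w - ito (xs n) w) =
        sqN (elem_coord (elem_diff (xs m) (xs n)))"
      using elem_isometry_norm(1)[OF elementary_elem_diff[OF xs(1)[of m] xs(1)[of n]]]
      by (simp add: elem_integral_elem_diff[OF xs(1)])
    also have "\<dots> = sqN (\<lambda>z k. elem_coord (xs m) z k - elem_coord (xs n) z k)"
      by (intro arg_cong[where f=sqN] ext elem_coord_diff)
    also have "\<dots> \<le> 2 * sqN (\<lambda>z k. elem_coord (xs m) z k - ?f z k) + 2 * sqN (\<lambda>z k. ?f z k - elem_coord (xs n) z k)"
      using mf elem_coord_measurable[OF xs(1)] by (intro sqN_triangle) auto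
    also have "\<dots> \<le> 2 * ennreal (1 / 4 ^ m) + 2 * ennreal (1 / 4 ^ m)"
    proof (intro add_mono mult_left_mono)
      show "sqN (\<lambda>z k. elem_coord (xs m) z k - ?f z k) \<le> ennreal (1 / 4 ^ m)" using xs(2) by (rule less_imp_le)
      have "sqN (\<lambda>z k. ?f z k - elem_coord (xs n) z k) \<le> ennreal (1 / 4 ^ n)"
        using xs(2)[of n] sqN_minus_commute[of ?f] by simp
      also have "\<dots> \<le> ennreal (1 / 4 ^ m)" using that by (intro ennreal_leI) (simp add: field_simps)
      finally show "sqN (\<lambda>z k. ?f z k - elem_coord (xs n) z k) \<le> ennreal (1 / 4 ^ m)" .
    qed auto
    also have "\<dots> = 4 * ennreal (1 / 4 ^ m)" by (simp flip: distrib_right)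
    also have "\<dots> = ennreal (4 / 4 ^ m)" using ennreal_mult[of 4 "1 / 4 ^ m"] by simp
    finally show ?thesis .
  qed
  then obtain Y where Y: "Y \<in> borel_measurable P"
    "\<And>n. msq P (\<lambda>w. ito (xs n) w - Y w) \<le> ennreal (4 / 4 ^ n)"
    using L2_complete[of "\<lambda>n. ito (xs n)" "P" 4] elem_integral_measurable[OF xs(1)] by auto
  have geo: "(\<lambda>n. ennreal (c / 4 ^ n)) \<longlonglongrightarrow> 0" for c
  proof -
    have "(\<lambda>n. c * (1/4) ^ n :: real) \<longlonglongrightarrow> c * 0" by (intro tendsto_intros LIMSEQ_power_zero) auto
    hence "(\<lambda>n. ennreal (c * (1/4) ^ n)) \<longlonglongrightarrow> ennreal 0" by (intro tendsto_ennrealI) auto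
    thus ?thesis by (simp only: power_one_over times_divide_eq_right mult_1_right ennreal_0)
  qed
  have "(\<lambda>n. sqN (\<lambda>z k. elem_coord (xs n) z k - ?f z k)) \<longlonglongrightarrow> 0"
    by (rule tendsto_sandwich[OF _ _ tendsto_const geo[of 1]]) (simp_all add: xs(2) less_imp_le)
  moreover have "(\<lambda>n. \<integral>\<^sup>+w. sqn (ito (xs n) w - Y w) \<partial>P) \<longlonglongrightarrow> 0"
    by (rule tendsto_sandwich[OF _ _ tendsto_const geo[of 4]]) (use Y(2) in auto)
  ultimately have "is_stoch_int W r \<Phi> Y"
    unfolding is_stoch_int_def using \<Phi> Y(1) xs(1)
    by (intro conjI exI[of _ xs] allI) (simp_all add: elem_dist_sqN[OF r \<Phi> xs(1)] sqn_def)
  thus ?thesis unfolding stoch_int_def by (rule someI[of "is_stoch_int W r \<Phi>"])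
qed

end

section \<open>The Volterra kernel and the weak resolvent equation\<close>

text \<open>Carries almost-everywhere statements about the kernel to a reflected argument
  \<open>t - \<tau>\<close>. \<open>P\<close> is arbitrary, possibly not measurable, hence the
  detour through a measurable null set.\<close>

lemma AE_lborel_affine:
  fixes P :: "real \<Rightarrow> bool"
  assumes "AE x in lborel. P x" "c \<noteq> 0"
  shows "AE x in lborel. P (t + c * x)"
proof -
  obtain N where N: "N \<in> null_sets lborel" "\<And>x. x \<in> space lborel - N \<Longrightarrow> P x"
    using assms(1) by (rule AE_E3) blast
  have "AE x in lborel. x \<notin> N" by (rule AE_not_in[OF N(1)])
  moreover have "Measurable.pred borel (\<lambda>x. x \<notin> N)" using N(1) by (auto simp: null_sets_def)
  ultimately have "AE x in lborel. t + c * x \<notin> N" using assms(2) by (intro AE_borel_affine)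
  thus ?thesis by eventually_elim (use N(2) in simp)
qed

lemma (in complete_measure) measurable_AE_eq:
  assumes f: "f \<in> M \<rightarrow>\<^sub>M N" and ae: "AE x in M. f x = g x" and g: "g \<in> space M \<rightarrow> space N"
  shows "g \<in> M \<rightarrow>\<^sub>M N"
proof (rule measurableI)
  fix A assume "A \<in> sets N"
  hence fA: "f -` A \<inter> space M \<in> sets M" by (rule measurable_sets[OF f])
  have "AE x in M. x \<in> f -` A \<inter> space M \<longleftrightarrow> x \<in> g -` A \<inter> space M"
    using ae by eventually_elim auto
  thus "g -` A \<inter> space M \<in> sets M" by (rule in_sets_AE[OF _ fA Int_lower2])
qed (use g in auto)

text \<open>\<open>g\<close> will be an integrand containing the given kernel, and completeness
  makes it Lebesgue measurable; \<open>f\<close> is the Borel version on which Fubini is carried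
  out.\<close>

lemma lebesgue_integral_cong_lborel:
  fixes f g :: "real \<Rightarrow> 'a::{banach,second_countable_topology}"
  assumes f: "f \<in> borel_measurable lborel" and ae: "AE x in lborel. g x = f x"
  shows "integrable lebesgue g \<longleftrightarrow> integrable lborel f" "integral\<^sup>L lebesgue g = integral\<^sup>L lborel f"
proof -
  have f': "f \<in> borel_measurable lebesgue" using f by (rule measurable_completion)
  have ae': "AE x in lebesgue. f x = g x" using AE_completion[OF ae] by eventually_elim simp
  have g: "g \<in> borel_measurable lebesgue"
    by (rule completion.measurable_AE_eq[OF f' ae']) auto
  show "integrable lebesgue g \<longleftrightarrow> integrable lborel f"
    using integrable_cong_AE[OF f' g ae'] integrable_completion[OF f] by simp
  show "integral\<^sup>L lebesgue g = integral\<^sup>L lborel f"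
    using integral_cong_AE[OF f' g ae'] integral_completion[OF f] by simp
qed

text \<open>The kernel is only Lebesgue measurable; a Borel version makes the Fubini arguments possible.\<close>

lemma borel_version_absolutely_integrable:
  fixes a :: "real \<Rightarrow> real"
  assumes "a absolutely_integrable_on {0..t}"
  obtains b where "integrable lborel b" "AE s in lborel. s \<in> {0..t} \<longrightarrow> b s = a s"
proof -
  let ?g = "\<lambda>s. indicat_real {0..t} s *\<^sub>R a s"
  have g: "integrable lebesgue ?g" using assms by (simp add: set_integrable_def)
  obtain b where b: "b \<in> borel_measurable lborel" "AE s in lborel. ?g s = b s"
    using completion_ex_borel_measurable_real[of ?g lborel] g by blast
  have "integrable lborel b" using lebesgue_integral_cong_lborel(1)[OF b] g by simp
  moreover have "AE s in lborel. s \<in> {0..t} \<longrightarrow> b s = a s"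
    using b(2) by eventually_elim (auto simp: indicator_def)
  ultimately show thesis by (rule that)
qed

text \<open>Cauchy-Schwarz with the weight divided evenly, \<open>sqrt \<bar>b \<tau>\<bar>\<close>
  to each factor: the kernel will be integrable but not necessarily square-integrable.\<close>

lemma sqn_kernel_integral:
  fixes b j :: "real \<Rightarrow> real"
  assumes [measurable]: "b \<in> borel_measurable lborel" "j \<in> borel_measurable lborel"
  shows "sqn (\<integral>\<tau>. b \<tau> * j \<tau> \<partial>lborel) \<le>
    (\<integral>\<^sup>+\<tau>. ennreal \<bar>b \<tau>\<bar> \<partial>lborel) * (\<integral>\<^sup>+\<tau>. ennreal \<bar>b \<tau>\<bar> * sqn (j \<tau>) \<partial>lborel)"
proof (cases "integrable lborel (\<lambda>\<tau>. b \<tau> * j \<tau>)")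
  case True
  have "sqn (\<integral>\<tau>. b \<tau> * j \<tau> \<partial>lborel) = (ennreal (norm (\<integral>\<tau>. b \<tau> * j \<tau> \<partial>lborel)))\<^sup>2"
    by (simp add: sqn_def ennreal_power)
  also have "\<dots> \<le> (\<integral>\<^sup>+\<tau>. ennreal (norm (b \<tau> * j \<tau>)) \<partial>lborel)\<^sup>2"
    by (intro power_mono integral_norm_bound_ennreal True) auto
  also have "(\<integral>\<^sup>+\<tau>. ennreal (norm (b \<tau> * j \<tau>)) \<partial>lborel) =
      (\<integral>\<^sup>+\<tau>. ennreal (sqrt \<bar>b \<tau>\<bar>) * ennreal (sqrt \<bar>b \<tau>\<bar> * \<bar>j \<tau>\<bar>) \<partial>lborel)"
    by (intro nn_integral_cong) (simp add: abs_mult flip: ennreal_mult mult.assoc)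
  also have "\<dots>\<^sup>2 \<le> (\<integral>\<^sup>+\<tau>. (ennreal (sqrt \<bar>b \<tau>\<bar>))\<^sup>2 \<partial>lborel) * (\<integral>\<^sup>+\<tau>. (ennreal (sqrt \<bar>b \<tau>\<bar> * \<bar>j \<tau>\<bar>))\<^sup>2 \<partial>lborel)"
    by (rule Cauchy_Schwarz_nn_integral) measurable
  also have "(\<integral>\<^sup>+\<tau>. (ennreal (sqrt \<bar>b \<tau>\<bar>))\<^sup>2 \<partial>lborel) = (\<integral>\<^sup>+\<tau>. ennreal \<bar>b \<tau>\<bar> \<partial>lborel)"
    by (intro nn_integral_cong) (simp add: ennreal_power)
  also have "(\<integral>\<^sup>+\<tau>. (ennreal (sqrt \<bar>b \<tau>\<bar> * \<bar>j \<tau>\<bar>))\<^sup>2 \<partial>lborel) = (\<integral>\<^sup>+\<tau>. ennreal \<bar>b \<tau>\<bar> * sqn (j \<tau>) \<partial>lborel)"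
    by (intro nn_integral_cong) (simp add: ennreal_power power_mult_distrib sqn_def ennreal_mult)
  finally show ?thesis .
next
  \<comment> \<open>A non-integrable product has integral 0 by convention.\<close>
  case False
  thus ?thesis by (simp add: not_integrable_integral_eq)
qed

text \<open>Applied with \<open>M\<close> the probability space and \<open>J\<close> the convolution
  tested against \<open>\<eta>\<close>, and again with \<open>M\<close> the product
  \<open>PP\<close> and \<open>J\<close> a tested coordinate of its integrand. The moment bound is
  asked only where \<open>b\<close> is nonzero, because the kernel will be cut off to
  \<open>{0..t}\<close>.\<close>

context
  fixes M :: "'m measure" and b :: "real \<Rightarrow> real" and J :: "real \<times> 'm \<Rightarrow> real" and C :: real
  assumes M: "sigma_finite_measure M"
    and b: "integrable lborel b" and J[measurable]: "J \<in> borel_measurable (lborel \<Otimes>\<^sub>M M)"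
    and bd: "\<And>\<tau>. b \<tau> \<noteq> 0 \<Longrightarrow> msq M (\<lambda>w. J (\<tau>, w)) \<le> ennreal C"
begin

interpretation M: sigma_finite_measure M by (rule M)

interpretation MM: pair_sigma_finite lborel M ..

lemma kernel_measurable: "b \<in> borel_measurable lborel"
  using b by auto

text \<open>\<open>\<bar>x * y\<bar> \<le> x\<^sup>2 + y\<^sup>2\<close> and the bound
  \<open>C\<close>, uniform in time, dominate the inner integral by a constant multiple of
  \<open>\<bar>b \<tau>\<bar>\<close>, so an integrable kernel is enough.\<close>

lemma
  fixes V :: "'m \<Rightarrow> real"
  assumes V[measurable]: "V \<in> borel_measurable M" and V2: "msq M V < \<infinity>"
  shows integrable_kernel_product: "integrable (lborel \<Otimes>\<^sub>M M) (\<lambda>(\<tau>, w). b \<tau> * (J (\<tau>, w) * V w))"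
    and kernel_fubini: "(\<integral>w. (\<integral>\<tau>. b \<tau> * J (\<tau>, w) \<partial>lborel) * V w \<partial>M) = (\<integral>\<tau>. b \<tau> * (\<integral>w. J (\<tau>, w) * V w \<partial>M) \<partial>lborel)"
    and integrable_kernel_fubini: "integrable lborel (\<lambda>\<tau>. b \<tau> * (\<integral>w. J (\<tau>, w) * V w \<partial>M))"
proof -
  note [measurable] = kernel_measurable
  let ?f = "\<lambda>(\<tau>, w). b \<tau> * (J (\<tau>, w) * V w)"
  show int: "integrable (lborel \<Otimes>\<^sub>M M) ?f"
  proof (rule integrableI_bounded)
    show "?f \<in> borel_measurable (lborel \<Otimes>\<^sub>M M)" by measurable
    have "(\<integral>\<^sup>+z. ennreal (norm (?f z)) \<partial>(lborel \<Otimes>\<^sub>M M)) = (\<integral>\<^sup>+\<tau>. (\<integral>\<^sup>+w. ennreal (norm (?f (\<tau>, w))) \<partial>M) \<partial>lborel)"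
      by (rule M.nn_integral_fst[symmetric]) measurable
    also have "\<dots> \<le> (\<integral>\<^sup>+\<tau>. ennreal \<bar>b \<tau>\<bar> * (ennreal C + msq M V) \<partial>lborel)"
    proof (intro nn_integral_mono)
      fix \<tau>
      show "(\<integral>\<^sup>+w. ennreal (norm (?f (\<tau>, w))) \<partial>M) \<le> ennreal \<bar>b \<tau>\<bar> * (ennreal C + msq M V)"
      proof (cases "b \<tau> = 0")
        case False
        have "(\<integral>\<^sup>+w. ennreal (norm (?f (\<tau>, w))) \<partial>M) \<le> (\<integral>\<^sup>+w. ennreal \<bar>b \<tau>\<bar> * (sqn (J (\<tau>, w)) + sqn (V w)) \<partial>M)"
        proof (intro nn_integral_mono)
          fix w
          have "\<bar>J (\<tau>, w) * V w\<bar> \<le> (J (\<tau>, w))\<^sup>2 + (V w)\<^sup>2"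
            using sum_squares_bound[of "J (\<tau>, w)" "V w"] sum_squares_bound[of "- J (\<tau>, w)" "V w"]
              zero_le_power2[of "J (\<tau>, w)"] zero_le_power2[of "V w"] by (simp add: abs_le_iff)
          hence "ennreal (norm (?f (\<tau>, w))) \<le> ennreal (\<bar>b \<tau>\<bar> * ((J (\<tau>, w))\<^sup>2 + (V w)\<^sup>2))"
            by (intro ennreal_leI) (simp add: abs_mult[of "b \<tau>"] mult_left_mono)
          thus "ennreal (norm (?f (\<tau>, w))) \<le> ennreal \<bar>b \<tau>\<bar> * (sqn (J (\<tau>, w)) + sqn (V w))"
            by (simp add: sqn_def ennreal_mult ennreal_plus)
        qed
        also have "\<dots> = ennreal \<bar>b \<tau>\<bar> * (msq M (\<lambda>w. J (\<tau>, w)) + msq M V)"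
          by (simp add: nn_integral_cmult nn_integral_add)
        also have "\<dots> \<le> ennreal \<bar>b \<tau>\<bar> * (ennreal C + msq M V)"
          by (intro mult_left_mono add_mono bd False) auto
        finally show ?thesis .
      qed simp
    qed
    also have "\<dots> = (\<integral>\<^sup>+\<tau>. ennreal \<bar>b \<tau>\<bar> \<partial>lborel) * (ennreal C + msq M V)"
      by (rule nn_integral_multc) auto
    also have "\<dots> < \<infinity>" using b V2 by (simp add: integrable_iff_bounded ennreal_mult_less_top less_top)
    finally show "(\<integral>\<^sup>+z. ennreal (norm (?f z)) \<partial>(lborel \<Otimes>\<^sub>M M)) < \<infinity>" .
  qed
  have "(\<integral>w. (\<integral>\<tau>. b \<tau> * (J (\<tau>, w) * V w) \<partial>lborel) \<partial>M) = (\<integral>\<tau>. (\<integral>w. b \<tau> * (J (\<tau>, w) * V w) \<partial>M) \<partial>lborel)"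
    by (rule MM.Fubini_integral[OF int])
  thus "(\<integral>w. (\<integral>\<tau>. b \<tau> * J (\<tau>, w) \<partial>lborel) * V w \<partial>M) = (\<integral>\<tau>. b \<tau> * (\<integral>w. J (\<tau>, w) * V w \<partial>M) \<partial>lborel)"
    by (simp flip: mult.assoc) (simp add: mult.assoc)
  show "integrable lborel (\<lambda>\<tau>. b \<tau> * (\<integral>w. J (\<tau>, w) * V w \<partial>M))"
    using MM.integrable_fst[OF int] by simp
qed

text \<open>\<open>sqn_kernel_integral\<close> for each \<open>w\<close>, then Tonelli: the second
  moment is at most the square of the \<open>L1\<close> norm of the kernel times
  \<open>C\<close>.\<close>

lemma kernel_integral_L2:
  shows "msq M (\<lambda>w. \<integral>\<tau>. b \<tau> * J (\<tau>, w) \<partial>lborel) < \<infinity>"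
proof -
  note [measurable] = kernel_measurable
  let ?B = "\<integral>\<^sup>+\<tau>. ennreal \<bar>b \<tau>\<bar> \<partial>lborel"
  have B: "?B < \<infinity>" using b by (simp add: integrable_iff_bounded)
  have "msq M (\<lambda>w. \<integral>\<tau>. b \<tau> * J (\<tau>, w) \<partial>lborel) \<le> (\<integral>\<^sup>+w. ?B * (\<integral>\<^sup>+\<tau>. ennreal \<bar>b \<tau>\<bar> * sqn (J (\<tau>, w)) \<partial>lborel) \<partial>M)"
    by (intro nn_integral_mono sqn_kernel_integral) measurable
  also have "\<dots> = ?B * (\<integral>\<^sup>+w. (\<integral>\<^sup>+\<tau>. ennreal \<bar>b \<tau>\<bar> * sqn (J (\<tau>, w)) \<partial>lborel) \<partial>M)"
    by (rule nn_integral_cmult) measurable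
  also have "(\<integral>\<^sup>+w. (\<integral>\<^sup>+\<tau>. ennreal \<bar>b \<tau>\<bar> * sqn (J (\<tau>, w)) \<partial>lborel) \<partial>M) =
     (\<integral>\<^sup>+\<tau>. (\<integral>\<^sup>+w. ennreal \<bar>b \<tau>\<bar> * sqn (J (\<tau>, w)) \<partial>M) \<partial>lborel)"
    by (rule MM.Fubini') measurable
  also have "\<dots> \<le> (\<integral>\<^sup>+\<tau>. ennreal \<bar>b \<tau>\<bar> * ennreal C \<partial>lborel)"
  proof (intro nn_integral_mono)
    fix \<tau>
    have "(\<integral>\<^sup>+w. ennreal \<bar>b \<tau>\<bar> * sqn (J (\<tau>, w)) \<partial>M) = ennreal \<bar>b \<tau>\<bar> * msq M (\<lambda>w. J (\<tau>, w))"
      by (rule nn_integral_cmult) measurable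
    also have "\<dots> \<le> ennreal \<bar>b \<tau>\<bar> * ennreal C"
      using bd[of \<tau>] by (cases "b \<tau> = 0") (auto intro: mult_left_mono)
    finally show "(\<integral>\<^sup>+w. ennreal \<bar>b \<tau>\<bar> * sqn (J (\<tau>, w)) \<partial>M) \<le> ennreal \<bar>b \<tau>\<bar> * ennreal C" .
  qed
  also have "\<dots> = ?B * ennreal C" by (rule nn_integral_multc) measurable
  finally have "msq M (\<lambda>w. \<integral>\<tau>. b \<tau> * J (\<tau>, w) \<partial>lborel) \<le> ?B * (?B * ennreal C)"
    by (simp add: mult_left_mono)
  also have "\<dots> < \<infinity>" using B by (simp add: ennreal_mult_less_top)
  finally show ?thesis .
qed

end

text \<open>Testing the resolvent equation against \<open>\<xi> \<in> D(A\<^sup>*)\<close> removes \<open>A\<close>, so that it extends from \<open>D\<close> to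
  all of the space by density.\<close>

lemma weak_resolvent_equation:
  fixes D :: "'h::{real_inner,banach,second_countable_topology} set"
  assumes D: "closure D = UNIV" and S: "is_resolvent a D A S"
    and b: "integrable lborel b" and ab: "AE s in lborel. s \<in> {0..t} \<longrightarrow> b s = a s"
    and adj: "\<And>x. x \<in> D \<Longrightarrow> A x \<bullet> \<xi> = x \<bullet> \<eta>" and r: "0 \<le> r" "r \<le> t"
  shows "S (t - r) x \<bullet> \<xi> - x \<bullet> \<xi> =
    (\<integral>\<tau>. indicat_real {0..t} \<tau> * b (t - \<tau>) * (if r \<le> \<tau> then S (max 0 (\<tau> - r)) x \<bullet> \<eta> else 0) \<partial>lborel)"
proof -
  have cont: "\<And>x. continuous_on {0..} (\<lambda>t. S t x)" and SD: "\<And>s x. 0 \<le> s \<Longrightarrow> x \<in> D \<Longrightarrow> S s x \<in> D \<and> A (S s x) = S s (A x)"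
    and eq: "\<And>x s. x \<in> D \<Longrightarrow> 0 \<le> s \<Longrightarrow> S s x = x + (LINT \<tau>:{0..s}|lebesgue. a (s - \<tau>) *\<^sub>R A (S \<tau> x))"
    using S unfolding is_resolvent_def by blast+
  obtain K where K: "0 \<le> K" "\<And>s. s \<in> {0..t} \<Longrightarrow> norm (S s) \<le> K"
    using strongly_continuous_bounded[OF cont, of t] by blast
  have [measurable]: "b \<in> borel_measurable borel" using b by auto
  have joint: "(\<lambda>p. S (max 0 (fst p)) (snd p)) \<in> borel_measurable (borel \<Otimes>\<^sub>M borel)"
    using borel_measurable_continuous_onI[OF strongly_continuous_jointly[OF cont]]
    by (simp add: borel_prod case_prod_beta')
  have meas: "(\<lambda>s. S (max 0 (f s)) x) \<in> borel_measurable borel" if "f \<in> borel_measurable borel" for f :: "real \<Rightarrow> real" and x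
    using measurable_compose[OF measurable_Pair[OF that measurable_const[of x]] joint] by simp
  let ?k = "\<lambda>\<tau>. indicat_real {0..t} \<tau> * b (t - \<tau>)"
  let ?m = "\<lambda>\<tau> x. if r \<le> \<tau> then S (max 0 (\<tau> - r)) x \<bullet> \<eta> else 0"
  have [measurable]: "(\<lambda>\<tau>. S (max 0 (\<tau> - r)) x) \<in> borel_measurable lborel"
      "(\<lambda>\<tau>. S (max 0 \<tau>) x) \<in> borel_measurable lborel" for x
    using meas[of "\<lambda>\<tau>. \<tau> - r" x] meas[of "\<lambda>\<tau>. \<tau>" x] by simp_all
  have bt: "integrable lborel (\<lambda>\<tau>. b (t - \<tau>))"
    using lborel_integrable_real_affine[OF b, of "-1" t] by simp
  have k: "integrable lborel ?k" using integrable_real_mult_indicator[OF _ bt, of "{0..t}"] by (simp add: mult.commute)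
  have mb: "\<bar>?m \<tau> x\<bar> \<le> K * norm x * norm \<eta>" if "\<tau> \<le> t" for \<tau> x
  proof (cases "r \<le> \<tau>")
    case True
    have "\<bar>S (\<tau> - r) x \<bullet> \<eta>\<bar> \<le> norm (S (\<tau> - r) x) * norm \<eta>" by (rule Cauchy_Schwarz_ineq2)
    also have "\<dots> \<le> (norm (S (\<tau> - r)) * norm x) * norm \<eta>" by (intro mult_right_mono norm_blinfun) auto
    also have "\<dots> \<le> (K * norm x) * norm \<eta>" using that True r by (intro mult_right_mono K) auto
    finally show ?thesis using True by simp
  qed (use K in simp)
  have D_case: "S (t - r) x \<bullet> \<xi> - x \<bullet> \<xi> = (\<integral>\<tau>. ?k \<tau> * ?m \<tau> x \<partial>lborel)" if x: "x \<in> D" for x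
  proof -
    define u where "u = t - r"
    have u: "0 \<le> u" "u \<le> t" using r by (auto simp: u_def)
    \<comment> \<open>\<open>A (S \<sigma> x)\<close> is rewritten as
      \<open>S \<sigma> (A x)\<close>, which is continuous in \<open>\<sigma>\<close>; this makes
      the integrand Borel and dominated by the kernel.\<close>
    let ?g = "\<lambda>\<sigma>. (indicat_real {0..u} \<sigma> * b (u - \<sigma>)) *\<^sub>R S (max 0 \<sigma>) (A x)"
    have "AE \<sigma> in lborel. u + (-1) * \<sigma> \<in> {0..t} \<longrightarrow> b (u + (-1) * \<sigma>) = a (u + (-1) * \<sigma>)"
      by (rule AE_lborel_affine[OF ab]) simp
    hence ae: "AE \<sigma> in lborel. indicat_real {0..u} \<sigma> *\<^sub>R (a (u - \<sigma>) *\<^sub>R A (S \<sigma> x)) = ?g \<sigma>"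
      by eventually_elim (use u x SD in \<open>auto simp: indicator_def\<close>)
    have gm: "?g \<in> borel_measurable lborel" by measurable
    have gi: "integrable lborel ?g"
    proof (rule Bochner_Integration.integrable_bound)
      have "integrable lborel (\<lambda>\<sigma>. b (u - \<sigma>))" using lborel_integrable_real_affine[OF b, of "-1" u] by simp
      thus "integrable lborel (\<lambda>\<sigma>. b (u - \<sigma>) * (K * norm (A x)))" by (rule integrable_mult_left)
      show "AE \<sigma> in lborel. norm (?g \<sigma>) \<le> norm (b (u - \<sigma>) * (K * norm (A x)))"
      proof (rule AE_I2)
        fix \<sigma>
        show "norm (?g \<sigma>) \<le> norm (b (u - \<sigma>) * (K * norm (A x)))"
        proof (cases "\<sigma> \<in> {0..u}")
          case True
          have "norm (S \<sigma> (A x)) \<le> norm (S \<sigma>) * norm (A x)" by (rule norm_blinfun)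
          also have "\<dots> \<le> K * norm (A x)" using True u by (intro mult_right_mono K) auto
          finally show ?thesis using True K by (simp add: abs_mult mult_left_mono)
        qed simp
      qed
    qed (rule gm)
    have "S u x - x = (LINT \<tau>:{0..u}|lebesgue. a (u - \<tau>) *\<^sub>R A (S \<tau> x))" using eq[OF x u(1)] by simp
    also have "\<dots> = integral\<^sup>L lborel ?g"
      unfolding set_lebesgue_integral_def by (rule lebesgue_integral_cong_lborel(2)[OF gm ae])
    finally have "S u x \<bullet> \<xi> - x \<bullet> \<xi> = integral\<^sup>L lborel ?g \<bullet> \<xi>"
      by (simp only: inner_diff_left[symmetric])
    also have "\<dots> = (\<integral>\<sigma>. ?g \<sigma> \<bullet> \<xi> \<partial>lborel)"
      by (rule integral_inner_left[symmetric]) (rule gi)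
    also have "\<dots> = (\<integral>\<sigma>. indicat_real {0..u} \<sigma> * b (u - \<sigma>) * (S (max 0 \<sigma>) x \<bullet> \<eta>) \<partial>lborel)"
    proof (intro Bochner_Integration.integral_cong refl)
      fix \<sigma>
      show "?g \<sigma> \<bullet> \<xi> = indicat_real {0..u} \<sigma> * b (u - \<sigma>) * (S (max 0 \<sigma>) x \<bullet> \<eta>)"
        using SD[OF _ x, of "max 0 \<sigma>"] adj[of "S (max 0 \<sigma>) x"] by simp
    qed
    \<comment> \<open>Substitution \<open>\<sigma> = \<tau> - r\<close>, under which
      \<open>u - \<sigma>\<close> becomes \<open>t - \<tau>\<close>.\<close>
    also have "\<dots> = (\<integral>\<tau>. indicat_real {0..u} (\<tau> - r) * b (u - (\<tau> - r)) * (S (max 0 (\<tau> - r)) x \<bullet> \<eta>) \<partial>lborel)"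
      using lborel_integral_real_affine[where c=1 and t="- r" and f="\<lambda>\<sigma>. indicat_real {0..u} \<sigma> * b (u - \<sigma>) * (S (max 0 \<sigma>) x \<bullet> \<eta>)"]
      by simp
    also have "\<dots> = (\<integral>\<tau>. ?k \<tau> * ?m \<tau> x \<partial>lborel)"
      using r by (intro Bochner_Integration.integral_cong refl) (auto simp: indicator_def u_def)
    finally show ?thesis by (simp add: u_def)
  qed
  have "x \<in> closure D" using D by simp
  then obtain X where X: "\<And>n. X n \<in> D" "X \<longlonglongrightarrow> x" by (auto simp: closure_sequential)
  \<comment> \<open>\<open>B\<close> bounds the approximating sequence and enters the integrable
    majorant for dominated convergence.\<close>
  obtain B where B: "\<And>n. norm (X n) \<le> B"
    using convergent_imp_Bseq[of X] X(2) by (auto simp: convergent_def Bseq_def)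
  have "(\<lambda>n. \<integral>\<tau>. ?k \<tau> * ?m \<tau> (X n) \<partial>lborel) \<longlonglongrightarrow> (\<integral>\<tau>. ?k \<tau> * ?m \<tau> x \<partial>lborel)"
  proof (rule integral_dominated_convergence)
    show "integrable lborel (\<lambda>\<tau>. \<bar>?k \<tau>\<bar> * (K * B * norm \<eta>))" using k by (intro integrable_mult_left integrable_abs)
    show "AE \<tau> in lborel. (\<lambda>n. ?k \<tau> * ?m \<tau> (X n)) \<longlonglongrightarrow> ?k \<tau> * ?m \<tau> x"
    proof (rule AE_I2)
      fix \<tau> show "(\<lambda>n. ?k \<tau> * ?m \<tau> (X n)) \<longlonglongrightarrow> ?k \<tau> * ?m \<tau> x"
        by (cases "r \<le> \<tau>") (auto intro!: tendsto_intros X(2))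
    qed
    show "AE \<tau> in lborel. norm (?k \<tau> * ?m \<tau> (X n)) \<le> \<bar>?k \<tau>\<bar> * (K * B * norm \<eta>)" for n
    proof (rule AE_I2)
      fix \<tau>
      show "norm (?k \<tau> * ?m \<tau> (X n)) \<le> \<bar>?k \<tau>\<bar> * (K * B * norm \<eta>)"
      proof (cases "\<tau> \<le> t")
        case True
        have "\<bar>?m \<tau> (X n)\<bar> \<le> K * norm (X n) * norm \<eta>" by (rule mb[OF True])
        also have "\<dots> \<le> K * B * norm \<eta>" using B K by (intro mult_right_mono mult_left_mono) auto
        finally show ?thesis unfolding real_norm_def abs_mult[of "?k \<tau>"] by (rule mult_left_mono) auto
      qed simp
    qed
  qed measurable
  moreover have "(\<lambda>n. S (t - r) (X n) \<bullet> \<xi> - X n \<bullet> \<xi>) \<longlonglongrightarrow> S (t - r) x \<bullet> \<xi> - x \<bullet> \<xi>"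
    by (intro tendsto_intros X(2))
  ultimately show ?thesis using D_case[OF X(1)] by (simp add: LIMSEQ_unique)
qed

text \<open>Density of \<open>D\<close> makes the representing vector unique, so that
  \<open>THE\<close> in \<open>adj_op\<close> denotes it.\<close>

lemma adj_op_eq:
  fixes D :: "'h::real_inner set"
  assumes D: "closure D = UNIV" and \<xi>: "\<xi> \<in> adj_dom D A" and x: "x \<in> D"
  shows "A x \<bullet> \<xi> = x \<bullet> adj_op D A \<xi>"
proof -
  obtain \<eta> where \<eta>: "\<forall>x\<in>D. A x \<bullet> \<xi> = x \<bullet> \<eta>" using \<xi> by (auto simp: adj_dom_def)
  have "\<eta>' = \<eta>" if \<eta>': "\<forall>x\<in>D. A x \<bullet> \<xi> = x \<bullet> \<eta>'" for \<eta>'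
  proof -
    have "closure D \<subseteq> {x. x \<bullet> (\<eta>' - \<eta>) = 0}"
    proof (rule closure_minimal)
      show "D \<subseteq> {x. x \<bullet> (\<eta>' - \<eta>) = 0}"
      proof
        fix x assume "x \<in> D"
        with \<eta> \<eta>' have "x \<bullet> \<eta>' = x \<bullet> \<eta>" by metis
        thus "x \<in> {x. x \<bullet> (\<eta>' - \<eta>) = 0}" by (simp add: inner_diff_right)
      qed
      show "closed {x. x \<bullet> (\<eta>' - \<eta>) = 0}" by (intro closed_Collect_eq continuous_intros)
    qed
    hence "(\<eta>' - \<eta>) \<bullet> (\<eta>' - \<eta>) = 0" using D by blast
    thus ?thesis by simp
  qed
  hence "\<exists>!\<eta>. \<forall>x\<in>D. A x \<bullet> \<xi> = x \<bullet> \<eta>" using \<eta> by blast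
  from theI'[OF this] x show ?thesis unfolding adj_op_def by blast
qed

section \<open>Pairing with elementary integrals\<close>

context cyl_wiener
begin

lemma stoch_int_approx:
  fixes \<Phi> :: "real \<Rightarrow> 'w \<Rightarrow> 'u \<Rightarrow> 'h::{real_inner,banach,second_countable_topology}"
  assumes r: "0 \<le> r" and Y: "is_stoch_int W r \<Phi> Y"
  obtains xs where "\<And>n. elementary W r (xs n)"
    "(\<lambda>n. sqN (\<lambda>z k. elem_coord (xs n) z k - xcoord r \<Phi> z k)) \<longlonglongrightarrow> 0"
    "(\<lambda>n. \<integral>\<^sup>+w. sqn (ito (xs n) w - Y w) \<partial>P) \<longlonglongrightarrow> 0"
proof -
  from Y obtain xs where \<Phi>: "\<Phi> \<in> N2 W r" and xs: "\<And>n. elementary W r (xs n)"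
    and 1: "(\<lambda>n. \<integral>\<^sup>+w. (\<integral>\<^sup>+\<tau>\<in>{0..r}. ennreal ((L20_norm W (\<lambda>u. elem_process (xs n) \<tau> w u - \<Phi> \<tau> w u))\<^sup>2)
              \<partial>lborel) \<partial>P) \<longlonglongrightarrow> 0"
    and 2: "(\<lambda>n. \<integral>\<^sup>+w. ennreal ((norm (ito (xs n) w - Y w))\<^sup>2) \<partial>P) \<longlonglongrightarrow> 0"
    unfolding is_stoch_int_def by blast
  show thesis
    by (rule that[OF xs]) (use 1 2 in \<open>simp_all only: elem_dist_sqN[OF r \<Phi> xs] sqn_def\<close>)
qed

text \<open>4 = 2 * 2 comes from two uses of the quadratic triangle inequality through the
  approximating sequence. Only a bound uniform over integrands is wanted here.\<close>

lemma stoch_int_sqn_le: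
  fixes \<Phi> :: "real \<Rightarrow> 'w \<Rightarrow> 'u \<Rightarrow> 'h::{real_inner,banach,second_countable_topology}"
  assumes r: "0 \<le> r" and Y: "is_stoch_int W r \<Phi> Y"
  shows "msq P Y \<le> 4 * sqN (xcoord r \<Phi>)"
proof -
  have \<Phi>: "\<Phi> \<in> N2 W r" and Ym: "Y \<in> borel_measurable P" using Y by (auto simp: is_stoch_int_def)
  obtain xs where xs: "\<And>n. elementary W r (xs n)"
    and 1: "(\<lambda>n. sqN (\<lambda>z k. elem_coord (xs n) z k - xcoord r \<Phi> z k)) \<longlonglongrightarrow> 0"
    and 2: "(\<lambda>n. \<integral>\<^sup>+w. sqn (ito (xs n) w - Y w) \<partial>P) \<longlonglongrightarrow> 0"
    by (rule stoch_int_approx[OF r Y]) blast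
  let ?a = "\<lambda>n. \<integral>\<^sup>+w. sqn (ito (xs n) w - Y w) \<partial>P"
  let ?b = "\<lambda>n. sqN (\<lambda>z k. elem_coord (xs n) z k - xcoord r \<Phi> z k)"
  have le: "msq P Y \<le> 2 * ?a n + 2 * (2 * ?b n + 2 * sqN (xcoord r \<Phi>))" for n
  proof -
    have A: "msq P (\<lambda>w. Y w - 0) \<le> 2 * msq P (\<lambda>w. Y w - ito (xs n) w)
        + 2 * msq P (\<lambda>w. ito (xs n) w - 0)"
      by (intro msq_triangle Ym elem_integral_measurable[OF xs] borel_measurable_const)
    have "sqN (\<lambda>z k. elem_coord (xs n) z k - 0) \<le> 2 * ?b n + 2 * sqN (\<lambda>z k. xcoord r \<Phi> z k - 0)"
      by (intro sqN_triangle allI elem_coord_measurable[OF xs] xcoord_measurable[OF r \<Phi>] borel_measurable_const)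
    hence B: "msq P (\<lambda>w. ito (xs n) w) \<le> 2 * ?b n + 2 * sqN (xcoord r \<Phi>)"
      by (simp only: diff_zero elem_isometry_norm(1)[OF xs, of n])
    show ?thesis
      by (rule order_trans[OF A[unfolded diff_zero sqn_minus_commute[of "Y _"]] add_left_mono[OF mult_left_mono[OF B zero_le]]])
  qed
  have "(\<lambda>n. 2 * ?a n + 2 * (2 * ?b n + 2 * sqN (xcoord r \<Phi>))) \<longlonglongrightarrow> 2 * 0 + 2 * (2 * 0 + 2 * sqN (xcoord r \<Phi>))"
    by (intro tendsto_add ennreal_tendsto_cmult tendsto_const 1 2) auto
  hence "msq P Y \<le> 2 * 0 + 2 * (2 * 0 + 2 * sqN (xcoord r \<Phi>))"
    by (rule LIMSEQ_le_const) (use le in blast)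
  thus ?thesis by (simp flip: mult.assoc)
qed

lemma stoch_int_L2:
  fixes \<Phi> :: "real \<Rightarrow> 'w \<Rightarrow> 'u \<Rightarrow> 'h::{real_inner,banach,second_countable_topology}"
  assumes r: "0 \<le> r" and Y: "is_stoch_int W r \<Phi> Y"
  shows "msq P Y < \<infinity>"
proof -
  have "sqN (xcoord r \<Phi>) < \<infinity>" using N2_sqN[OF r] Y by (auto simp: is_stoch_int_def)
  hence "4 * sqN (xcoord r \<Phi>) < \<infinity>" by (simp add: ennreal_mult_less_top)
  with stoch_int_sqn_le[OF r Y] show ?thesis by (rule order.strict_trans1)
qed

text \<open>Composing the approximating operators with the scalar product against \<open>h\<close>
  gives real elementary processes, so \<open>Y \<bullet> h\<close> can be compared with real test
  integrals.\<close>

lemma stoch_int_inner_approx: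
  fixes \<Phi> :: "real \<Rightarrow> 'w \<Rightarrow> 'u \<Rightarrow> 'h::{real_inner,banach,second_countable_topology}"
  assumes r: "0 \<le> r" and Y: "is_stoch_int W r \<Phi> Y"
  obtains zs where "\<And>n. elementary W r (zs n)"
    "\<And>k. (\<lambda>n. \<integral>\<^sup>+z. sqn (elem_coord (zs n) z k - xcoord r \<Phi> z k \<bullet> h) \<partial>PP) \<longlonglongrightarrow> 0"
    "(\<lambda>n. \<integral>\<^sup>+w. sqn (ito (zs n) w - Y w \<bullet> h) \<partial>P) \<longlonglongrightarrow> 0"
proof -
  have \<Phi>: "\<Phi> \<in> N2 W r" and Ym: "Y \<in> borel_measurable P" using Y by (auto simp: is_stoch_int_def)
  obtain xs where xs: "\<And>n. elementary W r (xs n)"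
    and 1: "(\<lambda>n. sqN (\<lambda>z k. elem_coord (xs n) z k - xcoord r \<Phi> z k)) \<longlonglongrightarrow> 0"
    and 2: "(\<lambda>n. \<integral>\<^sup>+w. sqn (ito (xs n) w - Y w) \<partial>P) \<longlonglongrightarrow> 0"
    by (rule stoch_int_approx[OF r Y]) blast
  define zs where "zs n = elem_map (blinfun_inner_left h) (xs n)" for n
  have c: "elem_coord (zs n) z k = elem_coord (xs n) z k \<bullet> h" for n z k
    by (simp add: zs_def coord_def elem_process_elem_map)
  have i: "ito (zs n) w = ito (xs n) w \<bullet> h" for n w
    by (simp add: zs_def elem_integral_elem_map[OF xs])
  show thesis
  proof (rule that[of zs])
    show "elementary W r (zs n)" for n unfolding zs_def by (rule elementary_elem_map[OF xs])
    show "(\<lambda>n. \<integral>\<^sup>+z. sqn (elem_coord (zs n) z k - xcoord r \<Phi> z k \<bullet> h) \<partial>PP) \<longlonglongrightarrow> 0" for k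
      unfolding c
    proof (intro msq_inner_tendsto elem_coord_measurable[OF xs] xcoord_measurable[OF r \<Phi>])
      show "(\<lambda>n. \<integral>\<^sup>+z. sqn (elem_coord (xs n) z k - xcoord r \<Phi> z k) \<partial>PP) \<longlonglongrightarrow> 0"
        by (rule tendsto_sandwich[OF _ _ tendsto_const 1])
          (simp_all add: coordinate_le_sqN[of "\<lambda>z k. elem_coord (xs _) z k - xcoord r \<Phi> z k" k])
    qed
    show "(\<lambda>n. \<integral>\<^sup>+w. sqn (ito (zs n) w - Y w \<bullet> h) \<partial>P) \<longlonglongrightarrow> 0"
      unfolding i by (intro msq_inner_tendsto elem_integral_measurable[OF xs] Ym 2)
  qed
qed

lemma elem_coord_sqn: 
  fixes ys :: "('w, 'u, 'h::{real_inner,banach,second_countable_topology}) elem"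
  assumes "elementary W r ys" shows "msq PP (\<lambda>z. elem_coord ys z k) < \<infinity>"
  using coordinate_le_sqN elem_isometry_norm(2)[OF assms] by (rule order.strict_trans1)

lemma elem_integral_sqn: 
  fixes ys :: "('w, 'u, 'h::{real_inner,banach,second_countable_topology}) elem"
  assumes "elementary W r ys" shows "msq P (\<lambda>w. ito ys w) < \<infinity>"
  using elem_isometry_norm[OF assms] by simp

lemma xcoord_sqn:
  fixes \<Phi> :: "real \<Rightarrow> 'w \<Rightarrow> 'u \<Rightarrow> 'h::{real_inner,banach,second_countable_topology}"
  assumes "0 \<le> r" "\<Phi> \<in> N2 W r" shows "msq PP (\<lambda>z. xcoord r \<Phi> z k) < \<infinity>"
  using coordinate_le_sqN N2_sqN[OF assms] by (rule order.strict_trans1)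

text \<open>The isometry against a real elementary integral. Only finitely many coordinates enter,
  so the limit is taken in each of them separately. The horizons \<open>r\<close> and
  \<open>r'\<close> are unrelated because \<open>xcoord r\<close> vanishes beyond
  \<open>r\<close>.\<close>

lemma stoch_int_pairing:
  fixes \<Phi> :: "real \<Rightarrow> 'w \<Rightarrow> 'u \<Rightarrow> 'h::{real_inner,banach,second_countable_topology}"
    and ys :: "('w, 'u, real) elem"
  assumes r: "0 \<le> r" and Y: "is_stoch_int W r \<Phi> Y" and ys: "elementary W r' ys"
  shows "(\<integral>w. (Y w \<bullet> h) * ito ys w \<partial>P) =
    (\<Sum>k\<in>elem_supp ys. \<integral>z. (xcoord r \<Phi> z k \<bullet> h) * elem_coord ys z k \<partial>PP)"
proof -
  have \<Phi>: "\<Phi> \<in> N2 W r" and Ym: "Y \<in> borel_measurable P" using Y by (auto simp: is_stoch_int_def)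
  obtain zs where zs: "\<And>n. elementary W r (zs n)"
    "\<And>k. (\<lambda>n. \<integral>\<^sup>+z. sqn (elem_coord (zs n) z k - xcoord r \<Phi> z k \<bullet> h) \<partial>PP) \<longlonglongrightarrow> 0"
    "(\<lambda>n. \<integral>\<^sup>+w. sqn (ito (zs n) w - Y w \<bullet> h) \<partial>P) \<longlonglongrightarrow> 0"
    by (rule stoch_int_inner_approx[OF r Y, where h=h]) blast
  have "(\<lambda>n. \<integral>w. ito (zs n) w * ito ys w \<partial>P) \<longlonglongrightarrow>
     (\<integral>w. (Y w \<bullet> h) * ito ys w \<partial>P)"
    by (intro integral_mult_tendsto_sqn elem_integral_measurable[OF zs(1)] elem_integral_measurable[OF ys]
      borel_measurable_inner Ym borel_measurable_const elem_integral_sqn[OF zs(1)] elem_integral_sqn[OF ys]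
      msq_inner_finite stoch_int_L2[OF r Y] zs(3))
  moreover have "(\<integral>w. ito (zs n) w * ito ys w \<partial>P) =
     (\<Sum>k\<in>elem_supp ys. \<integral>z. elem_coord (zs n) z k * elem_coord ys z k \<partial>PP)" for n
  proof -
    have "(\<integral>w. ito (zs n) w * ito ys w \<partial>P) =
       (\<integral>z. (\<Sum>k\<in>elem_supp ys. elem_coord (zs n) z k * elem_coord ys z k) \<partial>PP)"
      using has_bochner_integral_integral_eq[OF elem_isometry(1)[OF zs(1)[of n] ys finite_elem_supp[OF ys] order_refl]]
      by simp
    also have "\<dots> = (\<Sum>k\<in>elem_supp ys. \<integral>z. elem_coord (zs n) z k * elem_coord ys z k \<partial>PP)"
      by (intro Bochner_Integration.integral_sum integrable_mult_sqn elem_coord_measurable[OF zs(1)]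
         elem_coord_measurable[OF ys] elem_coord_sqn[OF zs(1)] elem_coord_sqn[OF ys])
    finally show ?thesis .
  qed
  moreover have "(\<lambda>n. \<Sum>k\<in>elem_supp ys. \<integral>z. elem_coord (zs n) z k * elem_coord ys z k \<partial>PP) \<longlonglongrightarrow>
     (\<Sum>k\<in>elem_supp ys. \<integral>z. (xcoord r \<Phi> z k \<bullet> h) * elem_coord ys z k \<partial>PP)"
    by (intro tendsto_sum integral_mult_tendsto_sqn elem_coord_measurable[OF zs(1)] elem_coord_measurable[OF ys]
      borel_measurable_inner xcoord_measurable[OF r \<Phi>] borel_measurable_const elem_coord_sqn[OF zs(1)] elem_coord_sqn[OF ys]
      msq_inner_finite xcoord_sqn[OF r \<Phi>] zs(2))
  ultimately show ?thesis by (simp add: LIMSEQ_unique)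
qed

text \<open>\<open>Y \<bullet> h\<close> is a mean-square limit of elementary integrals with horizon
  \<open>r\<close>, which are also elementary up to \<open>t\<close>; orthogonality to
  \<open>V\<close> survives the limit.\<close>

lemma stoch_int_orthogonal:
  fixes \<Phi> :: "real \<Rightarrow> 'w \<Rightarrow> 'u \<Rightarrow> 'h::{real_inner,banach,second_countable_topology}"
  assumes r: "0 \<le> r" "r \<le> t" and Y: "is_stoch_int W r \<Phi> Y"
    and V: "V \<in> borel_measurable P" "msq P V < \<infinity>"
    and orth: "\<And>ys :: ('w, 'u, real) elem. elementary W t ys \<Longrightarrow> (\<integral>w. ito ys w * V w \<partial>P) = 0"
  shows "(\<integral>w. (Y w \<bullet> h) * V w \<partial>P) = 0"
proof -
  have Ym: "Y \<in> borel_measurable P" using Y by (auto simp: is_stoch_int_def)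
  obtain zs where zs: "\<And>n. elementary W r (zs n)"
    "\<And>k. (\<lambda>n. \<integral>\<^sup>+z. sqn (elem_coord (zs n) z k - xcoord r \<Phi> z k \<bullet> h) \<partial>PP) \<longlonglongrightarrow> 0"
    "(\<lambda>n. \<integral>\<^sup>+w. sqn (ito (zs n) w - Y w \<bullet> h) \<partial>P) \<longlonglongrightarrow> 0"
    by (rule stoch_int_inner_approx[OF r(1) Y, where h=h]) blast
  have "(\<lambda>n. \<integral>w. ito (zs n) w * V w \<partial>P) \<longlonglongrightarrow> (\<integral>w. (Y w \<bullet> h) * V w \<partial>P)"
    by (intro integral_mult_tendsto_sqn elem_integral_measurable[OF zs(1)] V
      borel_measurable_inner Ym borel_measurable_const elem_integral_sqn[OF zs(1)]
      msq_inner_finite stoch_int_L2[OF r(1) Y] zs(3))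
  moreover have "(\<integral>w. ito (zs n) w * V w \<partial>P) = 0" for n
    by (rule orth[OF elementary_mono[OF zs(1) r(2)]])
  ultimately show ?thesis by (simp add: LIMSEQ_const_iff)
qed

text \<open>Lets the values of the predictable version serve as stochastic integrals in place of the
  arbitrary choice made by \<open>stoch_int\<close>.\<close>

lemma is_stoch_int_AE_cong:
  fixes Y Z :: "'w \<Rightarrow> 'h::{real_inner,banach,second_countable_topology}"
  assumes Y: "is_stoch_int W r \<Phi> Y" and Z: "Z \<in> borel_measurable P" and ae: "AE w in P. Z w = Y w"
  shows "is_stoch_int W r \<Phi> Z"
proof -
  have "(\<integral>\<^sup>+w. ennreal ((norm (ito xs w - Z w))\<^sup>2) \<partial>P) =
      (\<integral>\<^sup>+w. ennreal ((norm (ito xs w - Y w))\<^sup>2) \<partial>P)" for xs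
    by (rule nn_integral_cong_AE) (use ae in eventually_elim, simp)
  thus ?thesis using Y Z unfolding is_stoch_int_def by simp
qed

section \<open>Shorter horizons and composition with operator families\<close>

lemma measurable_predictable_mono:
  assumes r: "0 \<le> r" "r \<le> r'" and g: "g \<in> pred_sigma r' \<rightarrow>\<^sub>M N"
  shows "g \<in> pred_sigma r \<rightarrow>\<^sub>M N"
proof -
  let ?\<Omega> = "strip r"
  have r': "0 \<le> r'" using r by simp
  have "(\<lambda>z. z) \<in> pred_sigma r \<rightarrow>\<^sub>M pred_sigma r'"
  \<comment> \<open>It is enough to cut the generators for the longer horizon with the shorter
    strip; the result is again a generator, or empty.\<close>
  proof (rule measurable_sigma_sets[OF sets_predictable[OF r'] pred_gen_Pow[OF r']])
    show "(\<lambda>z. z) \<in> space (pred_sigma r) \<rightarrow> strip r'"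
      using r by (auto simp: space_predictable)
    fix E assume E: "E \<in> pred_gen r'"
    have "E \<inter> ?\<Omega> \<in> sets (pred_sigma r)"
      using E
    proof (cases rule: pred_gen_cases)
      case (rect s t B)
      show ?thesis
      proof (cases "s < r")
        case True
        have eq: "E \<inter> ?\<Omega> = {s<..min t r} \<times> B"
          using rect sets.sets_into_space[OF rect(6)] by auto
        have "\<exists>a b C. E \<inter> ?\<Omega> = {a<..b} \<times> C \<and> 0 \<le> a \<and> a < b \<and> b \<le> r \<and> C \<in> sets (filt W a)"
          unfolding eq using rect True by (intro exI[of _ s] exI[of _ "min t r"] exI[of _ B]) auto
        hence "E \<inter> ?\<Omega> \<in> pred_gen r" unfolding pred_gen_def by blast
        thus ?thesis unfolding sets_predictable[OF r(1)] by (rule sigma_sets.Basic)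
      next
        case False
        hence "E \<inter> ?\<Omega> = {}" using rect by auto
        thus ?thesis by simp
      qed
    next
      case (zero B)
      hence "E \<inter> ?\<Omega> = E" "E \<in> pred_gen r"
        using r sets.sets_into_space[OF zero(3)] by (auto simp: pred_gen_def)
      thus ?thesis unfolding sets_predictable[OF r(1)] by (simp add: sigma_sets.Basic)
    qed
    thus "(\<lambda>z. z) -` E \<inter> space (pred_sigma r) \<in> sets (pred_sigma r)"
      by (simp add: space_predictable)
  qed
  from measurable_compose[OF this g] show ?thesis by simp
qed

text \<open>The integrand of the convolution depends on time also through \<open>S\<close>, so time
  itself has to be a predictable function.\<close>

lemma time_predictable:
  assumes r: "0 \<le> r" shows "fst \<in> borel_measurable (pred_sigma r)"
proof (rule borel_measurableI_le)
  fix c :: real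
  let ?\<Omega> = "space P"
  have zero: "{0::real} \<times> ?\<Omega> \<in> sets (pred_sigma r)"
    unfolding sets_predictable[OF r] using sets_filt_space[of 0] by (intro sigma_sets.Basic) (auto simp: pred_gen_def)
  have pos: "{0<..min c r} \<times> ?\<Omega> \<in> sets (pred_sigma r)"
  proof (cases "0 < min c r")
    case True
    have "\<exists>a b C. {0<..min c r} \<times> ?\<Omega> = {a<..b} \<times> C \<and> 0 \<le> a \<and> a < b \<and> b \<le> r \<and> C \<in> sets (filt W a)"
      using True sets_filt_space[of 0] by (intro exI[of _ 0] exI[of _ "min c r"] exI[of _ ?\<Omega>]) auto
    hence "{0<..min c r} \<times> ?\<Omega> \<in> pred_gen r" unfolding pred_gen_def by blast
    thus ?thesis unfolding sets_predictable[OF r] by (rule sigma_sets.Basic)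
  next
    case False
    hence "{0<..min c r} = {}" by simp
    thus ?thesis by (simp only: Sigma_empty1 sets.empty_sets)
  qed
  have "{z \<in> space (pred_sigma r). fst z \<le> c} =
     (if 0 \<le> c then {0} \<times> ?\<Omega> \<union> {0<..min c r} \<times> ?\<Omega> else {})"
    using r by (auto simp: space_predictable)
  also have "\<dots> \<in> sets (pred_sigma r)" using zero pos by auto
  finally show "{z \<in> space (pred_sigma r). fst z \<le> c} \<in> sets (pred_sigma r)" .
qed

text \<open>Used for \<open>R s = S (max 0 (\<tau> - s))\<close> and for the constant functional
  given by \<open>\<xi>\<close>. The formula for \<open>\<Phi>\<close> is asked only on
  \<open>{0..r}\<close>, since \<open>S\<close> at negative times is arbitrary.\<close>

lemma
  fixes \<Psi> :: "real \<Rightarrow> 'w \<Rightarrow> 'u \<Rightarrow> 'h::{real_inner,banach,second_countable_topology}"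
    and R :: "real \<Rightarrow> 'h \<Rightarrow>\<^sub>L 'g::{real_inner,banach,second_countable_topology}"
  assumes r: "0 \<le> r" "r \<le> T" and \<Psi>: "\<Psi> \<in> N2 W T"
    and Rm: "(\<lambda>p. R (fst p) (snd p)) \<in> borel_measurable (borel \<Otimes>\<^sub>M borel)"
    and RK: "\<And>s. s \<in> {0..r} \<Longrightarrow> norm (R s) \<le> K" and K: "0 \<le> K"
    and \<Phi>: "\<And>s w u. s \<in> {0..r} \<Longrightarrow> \<Phi> s w u = R s (\<Psi> s w u)"
  shows N2_compose: "\<Phi> \<in> N2 W r"
    and xcoord_compose: "xcoord r \<Phi> z k = indicat_real {0..r} (fst z) *\<^sub>R R (fst z) (xcoord T \<Psi> z k)"
    and sqN_compose: "sqN (xcoord r \<Phi>) \<le> ennreal (K\<^sup>2) * sqN (xcoord T \<Psi>)"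
proof -
  have T: "0 \<le> T" using r by simp
  have coord: "coord W (\<Phi> s w) k = R s (coord W (\<Psi> s w) k)" if "s \<in> {0..r}" for s w k
    using \<Phi>[OF that] by (simp add: coord_def blinfun.zero_right)
  show xc: "xcoord r \<Phi> z k = indicat_real {0..r} (fst z) *\<^sub>R R (fst z) (xcoord T \<Psi> z k)" for z k
    using coord r by (auto simp: xcoord_def indicator_def)
  have normR: "norm (R s x) \<le> K * norm x" if "s \<in> {0..r}" for s x
    using norm_blinfun[of "R s" x] mult_right_mono[OF RK[OF that], of "norm x"] by simp
  show sq: "sqN (xcoord r \<Phi>) \<le> ennreal (K\<^sup>2) * sqN (xcoord T \<Psi>)"
  proof -
    have [measurable]: "(\<lambda>z. xcoord T \<Psi> z k) \<in> borel_measurable PP" for k by (rule xcoord_measurable[OF T \<Psi>])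
    have "sqN (xcoord r \<Phi>) \<le> (\<integral>\<^sup>+z. ennreal (K\<^sup>2) * (\<Sum>k. sqn (xcoord T \<Psi> z k)) \<partial>PP)"
      unfolding sqN_def
    proof (intro nn_integral_mono)
      fix z
      have "sqn (xcoord r \<Phi> z k) \<le> ennreal (K\<^sup>2) * sqn (xcoord T \<Psi> z k)" for k
      proof (cases "fst z \<in> {0..r}")
        case True
        have "(norm (xcoord r \<Phi> z k))\<^sup>2 \<le> (K * norm (xcoord T \<Psi> z k))\<^sup>2"
          using True normR[OF True] by (intro power_mono) (simp_all add: xc)
        thus ?thesis by (simp add: sqn_def power_mult_distrib flip: ennreal_mult)
      qed (simp add: xc)
      hence "(\<Sum>k. sqn (xcoord r \<Phi> z k)) \<le> (\<Sum>k. ennreal (K\<^sup>2) * sqn (xcoord T \<Psi> z k))" by (intro suminf_le) auto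
      thus "(\<Sum>k. sqn (xcoord r \<Phi> z k)) \<le> ennreal (K\<^sup>2) * (\<Sum>k. sqn (xcoord T \<Psi> z k))" by simp
    qed
    also have "\<dots> = ennreal (K\<^sup>2) * sqN (xcoord T \<Psi>)"
      unfolding sqN_def by (rule nn_integral_cmult) measurable
    finally show ?thesis .
  qed
  show "\<Phi> \<in> N2 W r"
    unfolding N2_iff[OF r(1)]
  proof (intro conjI ballI allI)
    fix s w assume s: "s \<in> {0..r}" and w: "w \<in> space P"
    have "\<Psi> s w \<in> L20 W" using s w r by (intro N2_L20[OF T \<Psi>]) auto
    hence lin: "\<And>u v c. u \<in> U0 (cov W) \<Longrightarrow> v \<in> U0 (cov W) \<Longrightarrow>
          \<Psi> s w (u + v) = \<Psi> s w u + \<Psi> s w v \<and> \<Psi> s w (c *\<^sub>R u) = c *\<^sub>R \<Psi> s w u"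
      and bd: "\<exists>C. \<forall>u\<in>U0 (cov W). norm (\<Psi> s w u) \<le> C * U0_norm (cov W) u"
      and sm: "hs_summable W (\<Psi> s w)"
      by (simp_all add: L20_def)
    obtain C where C: "\<And>u. u \<in> U0 (cov W) \<Longrightarrow> norm (\<Psi> s w u) \<le> C * U0_norm (cov W) u" using bd by blast
    have "norm (\<Phi> s w u) \<le> (K * C) * U0_norm (cov W) u" if "u \<in> U0 (cov W)" for u
      using normR[OF s, of "\<Psi> s w u"] mult_left_mono[OF C[OF that] K] by (simp add: \<Phi>[OF s] mult.assoc)
    moreover have "hs_summable W (\<Phi> s w)"
    proof (rule summable_on_comparison_test)
      show "(\<lambda>k. K\<^sup>2 * (norm (\<Psi> s w (U0_basis W k)))\<^sup>2) summable_on U0_idx W"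
        by (rule summable_on_cmult_right[OF sm])
      show "(norm (\<Phi> s w (U0_basis W k)))\<^sup>2 \<le> K\<^sup>2 * (norm (\<Psi> s w (U0_basis W k)))\<^sup>2" for k
        unfolding power_mult_distrib[symmetric] \<Phi>[OF s] by (intro power_mono normR[OF s]) auto
    qed auto
    ultimately show "\<Phi> s w \<in> L20 W"
      unfolding L20_def using lin by (auto simp: \<Phi>[OF s] blinfun.add_right blinfun.scaleR_right)
  next
    fix k
    have "(\<lambda>z. coord W (\<Psi> (fst z) (snd z)) k) \<in> borel_measurable (pred_sigma r)"
      by (rule measurable_predictable_mono[OF r N2_coord_predictable[OF T \<Psi>]])
    from measurable_compose[OF measurable_Pair[OF time_predictable[OF r(1)] this] Rm]
    have "(\<lambda>z. R (fst z) (coord W (\<Psi> (fst z) (snd z)) k)) \<in> borel_measurable (pred_sigma r)" by simp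
    also have "?this \<longleftrightarrow> (\<lambda>z. coord W (\<Phi> (fst z) (snd z)) k) \<in> borel_measurable (pred_sigma r)"
      by (rule measurable_cong) (auto simp: space_predictable coord)
    finally show "(\<lambda>z. coord W (\<Phi> (fst z) (snd z)) k) \<in> borel_measurable (pred_sigma r)" .
  next
    show "sqN (xcoord r \<Phi>) < \<infinity>"
      by (rule order.strict_trans1[OF sq]) (use N2_sqN[OF T \<Psi>] in \<open>simp add: ennreal_mult_less_top\<close>)
  qed
qed

section \<open>The weak equation for the stochastic convolution\<close>

lemma stochastic_convolution_weak:
  fixes \<Psi> :: "real \<Rightarrow> 'w \<Rightarrow> 'u \<Rightarrow> 'h::{real_inner,banach,second_countable_topology}"
    and X :: "real \<Rightarrow> 'w \<Rightarrow> 'h"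
  assumes D: "closure D = UNIV"
    and a: "a absolutely_integrable_on {0..t}"
    and S: "is_resolvent a D A S"
    and \<Psi>: "\<Psi> \<in> N2 W T"
    and X: "predictable_version W T (stoch_conv W S \<Psi>) X"
    and t: "0 \<le> t" "t \<le> T"
    and adj: "\<And>x. x \<in> D \<Longrightarrow> A x \<bullet> \<xi> = x \<bullet> \<eta>"
  shows "AE w in P.
     set_integrable lebesgue {0..t} (\<lambda>\<tau>. (a (t - \<tau>) *\<^sub>R X \<tau> w) \<bullet> \<eta>) \<and>
     X t w \<bullet> \<xi> = (LINT \<tau>:{0..t}|lebesgue. (a (t - \<tau>) *\<^sub>R X \<tau> w) \<bullet> \<eta>) +
                stoch_int W t (\<lambda>\<tau> w u. \<xi> \<bullet> \<Psi> \<tau> w u) w"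
proof -
  have T: "0 \<le> T" using t by simp
  have cont: "\<And>x. continuous_on {0..} (\<lambda>t. S t x)" using S unfolding is_resolvent_def by blast
  obtain K where K: "0 \<le> K" "\<And>s. s \<in> {0..T} \<Longrightarrow> norm (S s) \<le> K"
    using strongly_continuous_bounded[OF cont, of T] by blast
  have Sjoint: "(\<lambda>p. S (max 0 (fst p)) (snd p)) \<in> borel_measurable (borel \<Otimes>\<^sub>M borel)"
    using borel_measurable_continuous_onI[OF strongly_continuous_jointly[OF cont]]
    by (simp add: borel_prod case_prod_beta')
  obtain b0 where b0: "integrable lborel b0" "AE s in lborel. s \<in> {0..t} \<longrightarrow> b0 s = a s"
    using borel_version_absolutely_integrable[OF a] by blast
  \<comment> \<open>The reflection and the cut-off are built into the kernel, so that time integrals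
    run over the whole line.\<close>
  define b where "b \<tau> = indicat_real {0..t} \<tau> * b0 (t - \<tau>)" for \<tau>
  have b: "integrable lborel b"
  proof -
    have "integrable lborel (\<lambda>\<tau>. b0 (t - \<tau>))" using lborel_integrable_real_affine[OF b0(1), of "-1" t] by simp
    from integrable_real_mult_indicator[OF _ this, of "{0..t}"] show ?thesis
      by (simp add: b_def[abs_def] mult.commute)
  qed
  have [measurable]: "b \<in> borel_measurable lborel" using b by auto
  have b_nz: "\<tau> \<in> {0..t}" if "b \<tau> \<noteq> 0" for \<tau> using that by (auto simp: b_def indicator_def split: if_splits)

  \<comment> \<open>Integrand of the convolution at the final time \<open>\<tau>\<close>, as a
    process with horizon \<open>\<tau>\<close>.\<close>
  define \<Phi> where "\<Phi> \<tau> = (\<lambda>s w u. S (\<tau> - s) (\<Psi> s w u))" for \<tau>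
  have \<Phi>: "\<Phi> \<tau> \<in> N2 W \<tau>"
    and x\<Phi>: "\<And>z k. xcoord \<tau> (\<Phi> \<tau>) z k = indicat_real {0..\<tau>} (fst z) *\<^sub>R S (max 0 (\<tau> - fst z)) (xcoord T \<Psi> z k)"
    and sq\<Phi>: "sqN (xcoord \<tau> (\<Phi> \<tau>)) \<le> ennreal (K\<^sup>2) * sqN (xcoord T \<Psi>)" if \<tau>: "\<tau> \<in> {0..T}" for \<tau>
  proof -
    have \<tau>': "0 \<le> \<tau>" "\<tau> \<le> T" using \<tau> by auto
    have m: "(\<lambda>p. S (max 0 (\<tau> - fst p)) (snd p)) \<in> borel_measurable (borel \<Otimes>\<^sub>M borel)"
    proof -
      have "(\<lambda>p. (\<tau> - fst p, snd p)) \<in> borel \<Otimes>\<^sub>M borel \<rightarrow>\<^sub>M borel \<Otimes>\<^sub>M (borel :: 'h measure)" by measurable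
      from measurable_compose[OF this Sjoint] show ?thesis by simp
    qed
    have bd: "norm (S (max 0 (\<tau> - s))) \<le> K" if "s \<in> {0..\<tau>}" for s using that \<tau> by (intro K) auto
    have eq: "\<Phi> \<tau> s w u = S (max 0 (\<tau> - s)) (\<Psi> s w u)" if "s \<in> {0..\<tau>}" for s w u
      using that by (simp add: \<Phi>_def)
    note * = \<tau>' \<Psi> m bd K(1) eq
    show "\<Phi> \<tau> \<in> N2 W \<tau>" by (rule N2_compose[where R="\<lambda>s. S (max 0 (\<tau> - s))" and \<Phi>="\<Phi> \<tau>", OF *])
    show "xcoord \<tau> (\<Phi> \<tau>) z k = indicat_real {0..\<tau>} (fst z) *\<^sub>R S (max 0 (\<tau> - fst z)) (xcoord T \<Psi> z k)" for z k
      by (rule xcoord_compose[where R="\<lambda>s. S (max 0 (\<tau> - s))" and \<Phi>="\<Phi> \<tau>", OF *])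
    show "sqN (xcoord \<tau> (\<Phi> \<tau>)) \<le> ennreal (K\<^sup>2) * sqN (xcoord T \<Psi>)"
      by (rule sqN_compose[where R="\<lambda>s. S (max 0 (\<tau> - s))" and \<Phi>="\<Phi> \<tau>", OF *])
  qed
  define \<Theta> where "\<Theta> = (\<lambda>s w u. \<xi> \<bullet> \<Psi> s w u)"
  have \<Theta>: "\<Theta> \<in> N2 W t"
    and x\<Theta>: "\<And>z k. xcoord t \<Theta> z k = indicat_real {0..t} (fst z) *\<^sub>R (\<xi> \<bullet> xcoord T \<Psi> z k)"
  proof -
    have m: "(\<lambda>p. blinfun_inner_right \<xi> (snd p)) \<in> borel_measurable (borel \<Otimes>\<^sub>M (borel :: 'h measure))"
      by simp
    have eq: "\<Theta> s w u = blinfun_inner_right \<xi> (\<Psi> s w u)" for s w u by (simp add: \<Theta>_def)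
    show "\<Theta> \<in> N2 W t"
      by (rule N2_compose[where R="\<lambda>s. blinfun_inner_right \<xi>" and \<Phi>=\<Theta>, OF t \<Psi> m order_refl norm_ge_zero eq])
    show "xcoord t \<Theta> z k = indicat_real {0..t} (fst z) *\<^sub>R (\<xi> \<bullet> xcoord T \<Psi> z k)" for z k
      using xcoord_compose[where R="\<lambda>s. blinfun_inner_right \<xi>" and \<Phi>=\<Theta>, OF t \<Psi> m order_refl norm_ge_zero eq] by simp
  qed

  \<comment> \<open>The place where predictability of \<open>X\<close> enters: it provides the joint
    measurability in time and chance for Fubini.\<close>
  define xX where "xX z = indicat_real {0..T} (fst z) *\<^sub>R X (fst z) (snd z)" for z
  have xXm[measurable]: "xX \<in> borel_measurable PP"
    unfolding xX_def using X by (intro predictable_extend_measurable[OF T])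
      (simp add: predictable_version_def case_prod_beta')
  have IX: "is_stoch_int W \<tau> (\<Phi> \<tau>) (\<lambda>w. xX (\<tau>, w))" if \<tau>: "\<tau> \<in> {0..T}" for \<tau>
  proof (rule is_stoch_int_AE_cong)
    show "is_stoch_int W \<tau> (\<Phi> \<tau>) (stoch_int W \<tau> (\<Phi> \<tau>))" using \<tau> by (intro stoch_int_exists \<Phi>) auto
    show "(\<lambda>w. xX (\<tau>, w)) \<in> borel_measurable P" by measurable
    have "AE w in P. X \<tau> w = stoch_conv W S \<Psi> \<tau> w"
      using X \<tau> unfolding predictable_version_def by blast
    thus "AE w in P. xX (\<tau>, w) = stoch_int W \<tau> (\<Phi> \<tau>) w"
      by eventually_elim (use \<tau> in \<open>simp add: xX_def stoch_conv_def \<Phi>_def\<close>)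
  qed
  define G0 where "G0 = stoch_int W t \<Theta>"
  have IG: "is_stoch_int W t \<Theta> G0" unfolding G0_def by (rule stoch_int_exists[OF t(1) \<Theta>])
  have [measurable]: "G0 \<in> borel_measurable P" using IG by (simp add: is_stoch_int_def)
  have tT: "t \<in> {0..T}" using t by simp

  define J where "J z = xX z \<bullet> \<eta>" for z
  have Jm[measurable]: "J \<in> borel_measurable PP" unfolding J_def by measurable
  obtain N where N: "sqN (xcoord T \<Psi>) = ennreal N" "0 \<le> N"
    using N2_sqN[OF T \<Psi>] by (cases "sqN (xcoord T \<Psi>)") auto
  \<comment> \<open>Collects Cauchy-Schwarz with \<open>\<eta>\<close>, the constant of
    \<open>stoch_int_sqn_le\<close>, the bound on \<open>S\<close> and the norm of
    \<open>\<Psi>\<close>. It is independent of \<open>\<tau>\<close> and also covers single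
    coordinates, where the factor 4 is slack.\<close>
  define C where "C = (norm \<eta>)\<^sup>2 * (4 * (K\<^sup>2 * N))"
  have Jbd: "msq P (\<lambda>w. J (\<tau>, w)) \<le> ennreal C" if "b \<tau> \<noteq> 0" for \<tau>
  proof -
    have \<tau>: "\<tau> \<in> {0..T}" "0 \<le> \<tau>" using b_nz[OF that] t by auto
    have "msq P (\<lambda>w. J (\<tau>, w)) \<le> ennreal ((norm \<eta>)\<^sup>2) * msq P (\<lambda>w. xX (\<tau>, w))"
      unfolding J_def by (rule msq_inner_le) measurable
    also have "\<dots> \<le> ennreal ((norm \<eta>)\<^sup>2) * (4 * (ennreal (K\<^sup>2) * ennreal N))"
      using order_trans[OF stoch_int_sqn_le[OF \<tau>(2) IX[OF \<tau>(1)]] mult_left_mono[OF sq\<Phi>[OF \<tau>(1)]]]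
      by (intro mult_left_mono) (simp_all add: N(1))
    also have "\<dots> = ennreal C" using N(2) by (simp add: C_def ennreal_mult)
    finally show ?thesis .
  qed

  \<comment> \<open>Explicit formula for the tested \<open>k\<close>-th coordinate of
    \<open>\<Phi> \<tau>\<close>, with \<open>\<tau>\<close> now a variable, so that measurability
    jointly in \<open>\<tau>\<close> and the point of \<open>PP\<close> can be read off.\<close>
  define Jk where "Jk k p = (if 0 \<le> fst (snd p) \<and> fst (snd p) \<le> fst p
      then S (max 0 (fst p - fst (snd p))) (xcoord T \<Psi> (snd p) k) \<bullet> \<eta> else 0)" for k and p :: "real \<times> real \<times> 'w"
  have [measurable]: "(\<lambda>z. xcoord T \<Psi> z k) \<in> borel_measurable PP" for k by (rule xcoord_measurable[OF T \<Psi>])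
  have Jkm: "Jk k \<in> borel_measurable (lborel \<Otimes>\<^sub>M PP)" for k
  proof -
    have "(\<lambda>p :: real \<times> real \<times> 'w. (fst p - fst (snd p), xcoord T \<Psi> (snd p) k)) \<in> lborel \<Otimes>\<^sub>M PP \<rightarrow>\<^sub>M borel \<Otimes>\<^sub>M borel"
      by measurable
    from measurable_compose[OF this Sjoint]
    have [measurable]: "(\<lambda>p. S (max 0 (fst p - fst (snd p))) (xcoord T \<Psi> (snd p) k)) \<in> borel_measurable (lborel \<Otimes>\<^sub>M PP)"
      by simp
    show ?thesis unfolding Jk_def by measurable
  qed
  have Jk_eq: "Jk k (\<tau>, z) = xcoord \<tau> (\<Phi> \<tau>) z k \<bullet> \<eta>" if "\<tau> \<in> {0..T}" for \<tau> z k
    using that by (simp add: Jk_def x\<Phi> indicator_def)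
  have Jkbd: "msq PP (\<lambda>z. Jk k (\<tau>, z)) \<le> ennreal C" if "b \<tau> \<noteq> 0" for \<tau> k
  proof -
    have \<tau>: "\<tau> \<in> {0..T}" "0 \<le> \<tau>" using b_nz[OF that] t by auto
    have "msq PP (\<lambda>z. Jk k (\<tau>, z)) \<le> ennreal ((norm \<eta>)\<^sup>2) * msq PP (\<lambda>z. xcoord \<tau> (\<Phi> \<tau>) z k)"
      unfolding Jk_eq[OF \<tau>(1)] by (rule msq_inner_le[OF xcoord_measurable[OF \<tau>(2) \<Phi>[OF \<tau>(1)]]])
    also have "\<dots> \<le> ennreal ((norm \<eta>)\<^sup>2) * (ennreal (K\<^sup>2) * ennreal N)"
      using order_trans[OF coordinate_le_sqN sq\<Phi>[OF \<tau>(1)]] by (intro mult_left_mono) (simp_all add: N(1))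
    also have "\<dots> = ennreal ((norm \<eta>)\<^sup>2 * (K\<^sup>2 * N))" using N(2) by (simp add: ennreal_mult)
    also have "\<dots> \<le> ennreal C"
      unfolding C_def using N(2) by (intro ennreal_leI mult_left_mono) auto
    finally show ?thesis .
  qed
  \<comment> \<open>\<open>weak_resolvent_equation\<close> at each point \<open>z\<close>, with
    \<open>r\<close> the time of \<open>z\<close> and \<open>x\<close> the \<open>k\<close>-th
    coordinate of \<open>\<Psi>\<close> there. When that time is outside \<open>{0..t}\<close>, both
    sides vanish.\<close>
  have kernel: "(xcoord t (\<Phi> t) z k \<bullet> \<xi>) - xcoord t \<Theta> z k = (\<integral>\<tau>. b \<tau> * Jk k (\<tau>, z) \<partial>lborel)" for z k
  proof (cases "fst z \<in> {0..t}")
    case True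
    hence "S (t - fst z) (xcoord T \<Psi> z k) \<bullet> \<xi> - xcoord T \<Psi> z k \<bullet> \<xi> = (\<integral>\<tau>. indicat_real {0..t} \<tau> * b0 (t - \<tau>) *
        (if fst z \<le> \<tau> then S (max 0 (\<tau> - fst z)) (xcoord T \<Psi> z k) \<bullet> \<eta> else 0) \<partial>lborel)"
      by (intro weak_resolvent_equation[OF D S b0 adj]) auto
    thus ?thesis using True by (simp add: x\<Phi>[OF tT] x\<Theta> b_def Jk_def inner_commute cong: if_cong)
  next
    case False
    hence "b \<tau> * Jk k (\<tau>, z) = 0" for \<tau> using b_nz[of \<tau>] by (cases "b \<tau> = 0") (auto simp: Jk_def)
    hence "(\<integral>\<tau>. b \<tau> * Jk k (\<tau>, z) \<partial>lborel) = 0" by (simp only: Bochner_Integration.integral_zero)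
    thus ?thesis using False by (simp add: x\<Phi>[OF tT] x\<Theta>)
  qed

  define Y where "Y w = (\<integral>\<tau>. b \<tau> * J (\<tau>, w) \<partial>lborel)" for w
  define Z where "Z w = xX (t, w) \<bullet> \<xi> - G0 w" for w
  have Ym: "Y \<in> borel_measurable P" unfolding Y_def by measurable
  have Zm: "Z \<in> borel_measurable P" unfolding Z_def by measurable
  have YL2: "msq P Y < \<infinity>"
    unfolding Y_def by (rule kernel_integral_L2[OF sigma_finite_measure_axioms b Jm Jbd])
  have XL2: "msq P (\<lambda>w. xX (t, w) \<bullet> \<xi>) < \<infinity>"
    by (rule msq_inner_finite[OF _ stoch_int_L2[OF t(1) IX[OF tT]]]) measurable
  have GL2: "msq P G0 < \<infinity>" by (rule stoch_int_L2[OF t(1) IG])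
  have diffL2: "msq P (\<lambda>w. f w - g w) < \<infinity>"
    if [measurable]: "f \<in> borel_measurable P" "g \<in> borel_measurable P"
      and fg: "msq P f < \<infinity>" "msq P g < \<infinity>" for f g :: "'w \<Rightarrow> real"
  proof -
    have "msq P (\<lambda>w. f w - g w) \<le>
        2 * msq P (\<lambda>w. f w - 0) + 2 * msq P (\<lambda>w. 0 - g w)"
      by (rule msq_triangle) measurable
    also have "\<dots> < \<infinity>" using fg by (simp add: ennreal_mult_less_top)
    finally show ?thesis .
  qed
  have ZL2: "msq P Z < \<infinity>"
    unfolding Z_def by (rule diffL2[OF _ _ XL2 GL2]) measurable
  define V where "V w = Z w - Y w" for w
  have Vm: "V \<in> borel_measurable P" unfolding V_def using Zm Ym by measurable
  have VL2: "msq P V < \<infinity>" unfolding V_def by (rule diffL2[OF Zm Ym ZL2 YL2])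

  have orth: "(\<integral>w. ito ys w * V w \<partial>P) = 0"
    if ys: "elementary W t ys" for ys :: "('w, 'u, real) elem"
  proof -
    let ?I = "ito ys" and ?g = "\<lambda>k z. elem_coord ys z k" and ?F = "elem_supp ys"
    note Im = elem_integral_measurable[OF ys] and IL2 = elem_integral_sqn[OF ys]
      and gm = elem_coord_measurable[OF ys] and gL2 = elem_coord_sqn[OF ys]
    \<comment> \<open>\<open>\<bullet> 1\<close> presents the real integral as tested against the
      vector 1, the form that \<open>stoch_int_pairing\<close> expects.\<close>
    have "(\<integral>w. Z w * ?I w \<partial>P) =
        (\<integral>w. (xX (t, w) \<bullet> \<xi>) * ?I w \<partial>P) - (\<integral>w. (G0 w \<bullet> 1) * ?I w \<partial>P)"
    proof -
      have "integrable P (\<lambda>w. (xX (t, w) \<bullet> \<xi>) * ?I w)"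
        by (rule integrable_mult_sqn[OF _ Im XL2 IL2]) measurable
      moreover have "integrable P (\<lambda>w. G0 w * ?I w)"
        by (rule integrable_mult_sqn[OF _ Im GL2 IL2]) measurable
      ultimately show ?thesis by (simp add: Z_def left_diff_distrib)
    qed
    also have "\<dots> = (\<Sum>k\<in>?F. \<integral>z. (xcoord t (\<Phi> t) z k \<bullet> \<xi>) * ?g k z \<partial>PP) -
        (\<Sum>k\<in>?F. \<integral>z. (xcoord t \<Theta> z k \<bullet> 1) * ?g k z \<partial>PP)"
      by (simp only: stoch_int_pairing[OF t(1) IX[OF tT] ys] stoch_int_pairing[OF t(1) IG ys])
    also have "\<dots> = (\<Sum>k\<in>?F. \<integral>z. (\<integral>\<tau>. b \<tau> * Jk k (\<tau>, z) \<partial>lborel) * ?g k z \<partial>PP)"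
      unfolding sum_subtractf[symmetric]
    proof (intro sum.cong refl)
      fix k
      have "integrable PP (\<lambda>z. (xcoord t (\<Phi> t) z k \<bullet> \<xi>) * ?g k z)"
        by (intro integrable_mult_sqn gm gL2 borel_measurable_inner borel_measurable_const
          msq_inner_finite xcoord_sqn xcoord_measurable t \<Phi> tT)
      moreover have "integrable PP (\<lambda>z. xcoord t \<Theta> z k * ?g k z)"
        by (intro integrable_mult_sqn gm gL2 xcoord_sqn xcoord_measurable t \<Theta>)
      ultimately show "(\<integral>z. (xcoord t (\<Phi> t) z k \<bullet> \<xi>) * ?g k z \<partial>PP) - (\<integral>z. (xcoord t \<Theta> z k \<bullet> 1) * ?g k z \<partial>PP) =
          (\<integral>z. (\<integral>\<tau>. b \<tau> * Jk k (\<tau>, z) \<partial>lborel) * ?g k z \<partial>PP)"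
        by (simp add: kernel[symmetric] left_diff_distrib)
    qed
    also have "\<dots> = (\<Sum>k\<in>?F. \<integral>\<tau>. b \<tau> * (\<integral>z. Jk k (\<tau>, z) * ?g k z \<partial>PP) \<partial>lborel)"
      by (intro sum.cong refl kernel_fubini[OF PP.P.sigma_finite_measure_axioms b Jkm Jkbd gm gL2])
    also have "\<dots> = (\<integral>\<tau>. (\<Sum>k\<in>?F. b \<tau> * (\<integral>z. Jk k (\<tau>, z) * ?g k z \<partial>PP)) \<partial>lborel)"
      by (intro Bochner_Integration.integral_sum[symmetric]
        integrable_kernel_fubini[OF PP.P.sigma_finite_measure_axioms b Jkm Jkbd gm gL2])
    \<comment> \<open>The pairing formula is now read backwards, for the convolution at time
      \<open>\<tau>\<close>; where \<open>b\<close> vanishes both sides are 0.\<close>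
    also have "\<dots> = (\<integral>\<tau>. b \<tau> * (\<integral>w. J (\<tau>, w) * ?I w \<partial>P) \<partial>lborel)"
    proof (intro Bochner_Integration.integral_cong refl)
      fix \<tau>
      show "(\<Sum>k\<in>?F. b \<tau> * (\<integral>z. Jk k (\<tau>, z) * ?g k z \<partial>PP)) = b \<tau> * (\<integral>w. J (\<tau>, w) * ?I w \<partial>P)"
      proof (cases "b \<tau> = 0")
        case False
        hence \<tau>: "\<tau> \<in> {0..T}" "0 \<le> \<tau>" using b_nz[OF False] t by auto
        show ?thesis
          unfolding J_def stoch_int_pairing[OF \<tau>(2) IX[OF \<tau>(1)] ys] Jk_eq[OF \<tau>(1)] sum_distrib_left ..
      qed simp
    qed
    also have "\<dots> = (\<integral>w. Y w * ?I w \<partial>P)"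
      unfolding Y_def by (rule kernel_fubini[OF sigma_finite_measure_axioms b Jm Jbd Im IL2, symmetric])
    finally have "(\<integral>w. Z w * ?I w \<partial>P) = (\<integral>w. Y w * ?I w \<partial>P)" .
    moreover have "integrable P (\<lambda>w. Z w * ?I w)" "integrable P (\<lambda>w. Y w * ?I w)"
      using integrable_mult_sqn[OF Zm Im ZL2 IL2] integrable_mult_sqn[OF Ym Im YL2 IL2] .
    ultimately show ?thesis by (simp add: V_def right_diff_distrib mult.commute[of "?I _"])
  qed

  have VX: "(\<integral>w. (xX (t, w) \<bullet> \<xi>) * V w \<partial>P) = 0"
    by (rule stoch_int_orthogonal[OF t(1) order_refl IX[OF tT] Vm VL2 orth])
  have VG: "(\<integral>w. (G0 w \<bullet> 1) * V w \<partial>P) = 0"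
    by (rule stoch_int_orthogonal[OF t(1) order_refl IG Vm VL2 orth])
  \<comment> \<open>The factor \<open>b \<tau>\<close> confines the claim to times in
    \<open>{0..t}\<close>, where the convolution is an integral with horizon at most
    \<open>t\<close>.\<close>
  have VJ: "b \<tau> * (\<integral>w. J (\<tau>, w) * V w \<partial>P) = 0" for \<tau>
  proof (cases "b \<tau> = 0")
    case False
    hence \<tau>: "\<tau> \<in> {0..T}" "0 \<le> \<tau>" "\<tau> \<le> t" using b_nz[OF False] t by auto
    show ?thesis unfolding J_def
      by (simp add: stoch_int_orthogonal[OF \<tau>(2,3) IX[OF \<tau>(1)] Vm VL2 orth])
  qed simp
  have VY: "(\<integral>w. Y w * V w \<partial>P) = 0"
  proof -
    have "(\<integral>w. Y w * V w \<partial>P) = (\<integral>\<tau>. b \<tau> * (\<integral>w. J (\<tau>, w) * V w \<partial>P) \<partial>lborel)"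
      unfolding Y_def by (rule kernel_fubini[OF sigma_finite_measure_axioms b Jm Jbd Vm VL2])
    thus ?thesis by (simp only: VJ Bochner_Integration.integral_zero)
  qed
  have int: "integrable P (\<lambda>w. (xX (t, w) \<bullet> \<xi>) * V w)" "integrable P (\<lambda>w. G0 w * V w)"
    "integrable P (\<lambda>w. Y w * V w)" "integrable P (\<lambda>w. V w * V w)"
    by (rule integrable_mult_sqn[OF _ Vm XL2 VL2] integrable_mult_sqn[OF _ Vm GL2 VL2]
       integrable_mult_sqn[OF Ym Vm YL2 VL2] integrable_mult_sqn[OF Vm Vm VL2 VL2]; measurable)+
  have "(\<integral>w. V w * V w \<partial>P) =
      (\<integral>w. (xX (t, w) \<bullet> \<xi>) * V w - G0 w * V w - Y w * V w \<partial>P)"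
    by (intro Bochner_Integration.integral_cong) (auto simp: V_def Z_def algebra_simps)
  also have "\<dots> = 0" using int VX VG VY by simp
  finally have V0: "AE w in P. V w = 0"
    using int(4) by (subst (asm) integral_nonneg_eq_0_iff_AE) auto

  \<comment> \<open>Testing with the constant 1 gives the existence of the Volterra integral for
    almost every path.\<close>
  have "AE w in P. integrable lborel (\<lambda>\<tau>. b \<tau> * (J (\<tau>, w) * 1))"
    by (rule PP.AE_integrable_snd[OF integrable_kernel_product[OF sigma_finite_measure_axioms b Jm Jbd, where V="\<lambda>_. 1"]])
      (simp_all add: sqn_def emeasure_space_1)
  with V0 show ?thesis
  proof eventually_elim
    case (elim w)
    let ?f = "\<lambda>\<tau>. b \<tau> * J (\<tau>, w)"
    have fi: "integrable lborel ?f" using elim(2) by simp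
    hence fm: "?f \<in> borel_measurable lborel" by (rule borel_measurable_integrable)
    \<comment> \<open>Return from the Borel version \<open>b0\<close> to the given kernel
      \<open>a\<close>, at the reflected argument.\<close>
    have "AE \<tau> in lborel. t + (-1) * \<tau> \<in> {0..t} \<longrightarrow> b0 (t + (-1) * \<tau>) = a (t + (-1) * \<tau>)"
      by (rule AE_lborel_affine[OF b0(2)]) simp
    hence ae: "AE \<tau> in lborel. indicat_real {0..t} \<tau> *\<^sub>R ((a (t - \<tau>) *\<^sub>R X \<tau> w) \<bullet> \<eta>) = ?f \<tau>"
      by eventually_elim (use t in \<open>auto simp: b_def J_def xX_def indicator_def\<close>)
    note c = lebesgue_integral_cong_lborel[OF fm ae]
    have "set_integrable lebesgue {0..t} (\<lambda>\<tau>. (a (t - \<tau>) *\<^sub>R X \<tau> w) \<bullet> \<eta>)"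
      unfolding set_integrable_def c(1) by (rule fi)
    moreover have "(LINT \<tau>:{0..t}|lebesgue. (a (t - \<tau>) *\<^sub>R X \<tau> w) \<bullet> \<eta>) = Y w"
      unfolding set_lebesgue_integral_def c(2) Y_def ..
    moreover have "X t w \<bullet> \<xi> = Y w + G0 w" using elim(1) t by (simp add: V_def Z_def xX_def)
    ultimately show ?case unfolding G0_def \<Theta>_def by simp
  qed
qed

end

theorem proposition5:
  fixes W :: "('w, 'u::{real_inner,banach,second_countable_topology}) noise"
    and D :: "'h::{real_inner,banach,second_countable_topology} set"
    and A :: "'h \<Rightarrow> 'h"
    and a :: "real \<Rightarrow> real"
    and S :: "real \<Rightarrow> 'h \<Rightarrow>\<^sub>L 'h"
    and T :: real
    and \<Psi> :: "real \<Rightarrow> 'w \<Rightarrow> 'u \<Rightarrow> 'h"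
    and X :: "real \<Rightarrow> 'w \<Rightarrow> 'h"
  assumes "0 < T"
    and "cylindrical_wiener W"
    and "closed_densely_defined D A"
    and "\<forall>r\<ge>0. a absolutely_integrable_on {0..r}"
    and "is_resolvent a D A S"
    and "\<Psi> \<in> N2 W T"
    and "AE \<omega> in pspace W. \<forall>t\<in>{0..T}. \<forall>u\<in>U0 (cov W). \<Psi> t \<omega> u \<in> D"
    and "predictable_version W T (stoch_conv W S \<Psi>) X"
  shows "\<forall>t\<in>{0..T}. \<forall>\<xi>\<in>adj_dom D A. AE \<omega> in pspace W.
     set_integrable lebesgue {0..t} (\<lambda>\<tau>. (a (t - \<tau>) *\<^sub>R X \<tau> \<omega>) \<bullet> adj_op D A \<xi>) \<and>
     X t \<omega> \<bullet> \<xi> = (LINT \<tau>:{0..t}|lebesgue. (a (t - \<tau>) *\<^sub>R X \<tau> \<omega>) \<bullet> adj_op D A \<xi>) +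
                stoch_int W t (\<lambda>\<tau> \<omega> u. \<xi> \<bullet> \<Psi> \<tau> \<omega> u) \<omega>"
proof (intro ballI)
  fix t \<xi> assume t: "t \<in> {0..T}" and \<xi>: "\<xi> \<in> adj_dom D A"
  interpret cyl_wiener W by unfold_locales fact
  have D: "closure D = UNIV" using assms(3) by (simp add: closed_densely_defined_def)
  have "a absolutely_integrable_on {0..t}" using assms(4) t by simp
  from stochastic_convolution_weak[OF D this assms(5,6,8) _ _ adj_op_eq[OF D \<xi>]] t
  show "AE \<omega> in pspace W.
     set_integrable lebesgue {0..t} (\<lambda>\<tau>. (a (t - \<tau>) *\<^sub>R X \<tau> \<omega>) \<bullet> adj_op D A \<xi>) \<and>
     X t \<omega> \<bullet> \<xi> = (LINT \<tau>:{0..t}|lebesgue. (a (t - \<tau>) *\<^sub>R X \<tau> \<omega>) \<bullet> adj_op D A \<xi>) +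
                stoch_int W t (\<lambda>\<tau> \<omega> u. \<xi> \<bullet> \<Psi> \<tau> \<omega> u) \<omega>"
    by simp
qed

end
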